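(* Let $J,K$ be non-negative integers or half-integers and let $k=2(K-J)\in\mathbb{Z}$. If $f:[0,1]\to\mathbb{R}$ is concave and $\rho$ is a density matrix on $\mathcal{H}_J$, then $$\operatorname{Tr}_K\big[f(\Phi^k(\rho))\big]\;\geq\;\operatorname{Tr}_K\big[f(\Phi^k(|\omega\rangle_J\,{}_J\langle\omega|))\big]$$ for all $\omega\in\mathbb{S}^2$.
   Context: For each integer or half-integer $L\ge 0$, $\mathcal{H}_L=\mathbb{C}^{2L+1}$ is the irreducible spin-$L$ representation space of $SU(2)$, with spin operators $\mathbf{S}_L=(S_x,S_y,S_z)$ (self-adjoint, $[S_x,S_y]=iS_z$ and cyclic permutations); $\operatorname{Tr}_L$ denotes the (partial) trace over $\mathcal{H}_L$. For $\omega\in\mathbb{S}^2$ the Bloch coherent state $|\omega\rangle_J\in\mathcal{H}_J$ is a unit vector, unique up to phase, spanning the eigenspace of $\omega\cdot\mathbf{S}_J$ with eigenvalue $J$. $P_-$ is the orthogonal projection in $\mathcal{H}_J\otimes\mathcal{H}_K$ onto the subspace of minimal total spin $|K-J|$, i.e. onto the unique copy of $\mathcal{H}_{|K-J|}$ in the tensor product representation. With $k=2K-2J\in\mathbb{Z}$, the map $\Phi^k$ from operators on $\mathcal{H}_J$ to operators on $\mathcal{H}_K$ is $$\Phi^k(\rho)=\frac{2J+1}{2|K-J|+1}\operatorname{Tr}_J\big(P_-(\rho\otimes I_K)\big),$$ where $I_K$ is the identity on $\mathcal{H}_K$. It is completely positive and trace preserving. A density matrix is a positive semi-definite operator of trace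 $1$; $f$ of a Hermitian matrix is defined by functional calculus. *)

theory Defs
  imports
    "HOL-Analysis.Analysis"
    "Jordan_Normal_Form.Schur_Decomposition"
begin

unbundle no vec_syntax

section \<open>Matrices\<close>

definition mat_trace :: "complex mat \<Rightarrow> complex" where
  "mat_trace A = (\<Sum>i<dim_row A. A $$ (i, i))"

definition hermitian_mat :: "nat \<Rightarrow> complex mat \<Rightarrow> bool" where
  "hermitian_mat n A \<longleftrightarrow> A \<in> carrier_mat n n \<and> mat_adjoint A = A"

definition unitary_mat :: "nat \<Rightarrow> complex mat \<Rightarrow> bool" where
  "unitary_mat n U \<longleftrightarrow> U \<in> carrier_mat n n \<and> mat_adjoint U * U = 1\<^sub>m n"

text \<open>The order on \<^typ>\<open>complex\<close> is that of \<^theory>\<open>HOL-Library.Complex_Order\<close>: \<open>0 \<le> z\<close>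
  says that \<open>z\<close> is real and nonnegative.\<close>

definition density_mat :: "nat \<Rightarrow> complex mat \<Rightarrow> bool" where
  "density_mat n \<rho> \<longleftrightarrow>
     hermitian_mat n \<rho> \<and> (\<forall>v \<in> carrier_vec n. 0 \<le> (\<rho> *\<^sub>v v) \<bullet>c v) \<and> mat_trace \<rho> = 1"

text \<open>The rank-one operator \<open>|v\<rangle>\<langle>v|\<close>.\<close>

definition ket_bra :: "complex vec \<Rightarrow> complex mat" where
  "ket_bra v = Matrix.mat (dim_vec v) (dim_vec v) (\<lambda>(i, j). v $ i * cnj (v $ j))"

text \<open>Functional calculus: \<open>U diag(d) U\<^sup>* \<mapsto> U diag(f \<circ> d) U\<^sup>*\<close>. For Hermitian \<open>A\<close> the result
  does not depend on the diagonalisation, and only the values of \<open>f\<close> on the spectrum of \<open>A\<close>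
  matter; for non-Hermitian \<open>A\<close> the value is unspecified.\<close>

definition mat_fun :: "(real \<Rightarrow> real) \<Rightarrow> complex mat \<Rightarrow> complex mat" where
  "mat_fun f A = (THE B. \<exists>U (d :: nat \<Rightarrow> real). let n = dim_row A in
     unitary_mat n U \<and>
     A = U * mat_diag n (\<lambda>i. complex_of_real (d i)) * mat_adjoint U \<and>
     B = U * mat_diag n (\<lambda>i. complex_of_real (f (d i))) * mat_adjoint U)"

definition is_orth_proj :: "nat \<Rightarrow> complex vec set \<Rightarrow> complex mat \<Rightarrow> bool" where
  "is_orth_proj n V P \<longleftrightarrow>
     hermitian_mat n P \<and> P * P = P \<and> (\<lambda>v. P *\<^sub>v v) ` carrier_vec n = V"

definition orth_proj :: "nat \<Rightarrow> complex vec set \<Rightarrow> complex mat" where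
  "orth_proj n V = (THE P. is_orth_proj n V P)"

text \<open>In \<open>\<complex>\<^sup>m \<otimes> \<complex>\<^sup>n\<close> the basis vector \<open>e\<^sub>a \<otimes> e\<^sub>b\<close> has index \<open>a * n + b\<close>.\<close>

definition tensor_mat :: "complex mat \<Rightarrow> complex mat \<Rightarrow> complex mat" (infixl "\<otimes>\<^sub>m" 70) where
  "A \<otimes>\<^sub>m B = Matrix.mat (dim_row A * dim_row B) (dim_col A * dim_col B)
     (\<lambda>(i, j). A $$ (i div dim_row B, j div dim_col B) * B $$ (i mod dim_row B, j mod dim_col B))"

text \<open>Partial trace over the first factor of \<open>\<complex>\<^sup>m \<otimes> \<complex>\<^sup>n\<close>.\<close>

definition partial_trace1 :: "nat \<Rightarrow> nat \<Rightarrow> complex mat \<Rightarrow> complex mat" where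
  "partial_trace1 m n X = Matrix.mat n n (\<lambda>(b, b'). \<Sum>a<m. X $$ (a * n + b, a * n + b'))"


section \<open>Spin operators\<close>

text \<open>A spin is a real number \<open>L\<close> with \<open>2 * L \<in> \<nat>\<close>. The spin-\<open>L\<close> representation lives on
  \<open>\<complex>\<^bsup>2L+1\<^esup>\<close>, where the standard basis vector \<open>e\<^sub>a\<close>, \<open>a = 0, \<dots>, 2L\<close>, is the weight vector
  \<open>|m\<rangle>\<close> with \<open>m = L - a\<close>; thus \<open>S\<^sub>z e\<^sub>a = (L - a) e\<^sub>a\<close> and
  \<open>S\<^sub>+ e\<^sub>a = \<surd>(L(L+1) - m(m+1)) e\<^bsub>a-1\<^esub> = \<surd>(a (2L + 1 - a)) e\<^bsub>a-1\<^esub>\<close>.\<close>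

definition spin_dim :: "real \<Rightarrow> nat" where
  "spin_dim L = nat \<lfloor>2 * L\<rfloor> + 1"

definition spin_plus :: "real \<Rightarrow> complex mat" where
  "spin_plus L = Matrix.mat (spin_dim L) (spin_dim L)
     (\<lambda>(i, j). if j = Suc i then complex_of_real (sqrt (real j * (2 * L + 1 - real j))) else 0)"

definition spin_x :: "real \<Rightarrow> complex mat" where
  "spin_x L = (1 / 2) \<cdot>\<^sub>m (spin_plus L + mat_adjoint (spin_plus L))"

definition spin_y :: "real \<Rightarrow> complex mat" where
  "spin_y L = (1 / (2 * \<i>)) \<cdot>\<^sub>m (spin_plus L - mat_adjoint (spin_plus L))"

definition spin_z :: "real \<Rightarrow> complex mat" where
  "spin_z L = mat_diag (spin_dim L) (\<lambda>a. complex_of_real (L - real a))"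

text \<open>\<open>\<omega> \<cdot> S\<^sub>L\<close>\<close>

definition spin_dir :: "real \<Rightarrow> real^3 \<Rightarrow> complex mat" where
  "spin_dir L \<omega> =
     complex_of_real (vec_nth \<omega> 1) \<cdot>\<^sub>m spin_x L +
     complex_of_real (vec_nth \<omega> 2) \<cdot>\<^sub>m spin_y L +
     complex_of_real (vec_nth \<omega> 3) \<cdot>\<^sub>m spin_z L"

text \<open>\<open>v\<close> is a Bloch coherent state \<open>|\<omega>\<rangle>\<^sub>J\<close>; this determines \<open>v\<close> up to a phase.\<close>

definition coherent_state :: "real \<Rightarrow> real^3 \<Rightarrow> complex vec \<Rightarrow> bool" where
  "coherent_state J \<omega> v \<longleftrightarrow>
     v \<in> carrier_vec (spin_dim J) \<and> v \<bullet>c v = 1 \<and>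
     spin_dir J \<omega> *\<^sub>v v = complex_of_real J \<cdot>\<^sub>v v"


section \<open>The channels\<close>

text \<open>The generators of the tensor product representation on \<open>\<H>\<^sub>J \<otimes> \<H>\<^sub>K\<close>, as a function of the
  component \<open>S\<close> (one of \<^const>\<open>spin_x\<close>, \<^const>\<open>spin_y\<close>, \<^const>\<open>spin_z\<close>), and the
  squared total spin.\<close>

definition total_spin :: "(real \<Rightarrow> complex mat) \<Rightarrow> real \<Rightarrow> real \<Rightarrow> complex mat" where
  "total_spin S J K = S J \<otimes>\<^sub>m 1\<^sub>m (spin_dim K) + 1\<^sub>m (spin_dim J) \<otimes>\<^sub>m S K"

definition total_spin_sq :: "real \<Rightarrow> real \<Rightarrow> complex mat" where
  "total_spin_sq J K =
     total_spin spin_x J K * total_spin spin_x J K +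
     total_spin spin_y J K * total_spin spin_y J K +
     total_spin spin_z J K * total_spin spin_z J K"

text \<open>The subspace of total spin \<open>s\<close> is the eigenspace of the squared total spin for the
  eigenvalue \<open>s (s + 1)\<close>.\<close>

definition total_spin_space :: "real \<Rightarrow> real \<Rightarrow> real \<Rightarrow> complex vec set" where
  "total_spin_space J K s =
     {v \<in> carrier_vec (spin_dim J * spin_dim K).
        total_spin_sq J K *\<^sub>v v = complex_of_real (s * (s + 1)) \<cdot>\<^sub>v v}"

definition P_minus :: "real \<Rightarrow> real \<Rightarrow> complex mat" where
  "P_minus J K = orth_proj (spin_dim J * spin_dim K) (total_spin_space J K \<bar>K - J\<bar>)"

text \<open>\<open>\<Phi>\<^sup>k\<close> on operators on \<open>\<H>\<^sub>J\<close>; the output spin is \<open>K = J + k/2\<close>.\<close>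

definition channel :: "real \<Rightarrow> int \<Rightarrow> complex mat \<Rightarrow> complex mat" where
  "channel J k \<rho> = (let K = J + of_int k / 2 in
     complex_of_real ((2 * J + 1) / (2 * \<bar>K - J\<bar> + 1)) \<cdot>\<^sub>m
       partial_trace1 (spin_dim J) (spin_dim K) (P_minus J K * (\<rho> \<otimes>\<^sub>m 1\<^sub>m (spin_dim K))))"

end

(*
  With n = 2J and m = 2K, the space of spin L is the space of 2L bosons in two modes.  The Casimir
  operator of the tensor product minus its minimal value is D* D, where D removes a boson from the
  smaller spin and adds one to the larger; the kernel of D consists of explicit vectors, and up to
  the time reversal of rho the channel becomes a multiple of X |-> sum_i a_i* X a_i, iterated |k|
  times, or of X |-> sum_i a_i X a_i* if k < 0.

  For k < 0 a coherent state is mapped to a pure state, so that concavity suffices.  For k > 0 one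
  shows by induction on k that the spectrum of the output is majorized by that of the output of a
  coherent state.  In one step the spectrum is multiplied by a nonnegative matrix whose row sums
  and column sums are constant, because sum_i a_i* a_i and sum_i a_i a_i* are scalars, and a sorted
  diagonal matrix attains all the bounds on partial sums of eigenvalues that follow from this alone.
  The spectrum for a coherent state is computed by rotating it to a basis vector: a rotation of the
  modes is implemented by unitaries that intertwine the creation operators.
*)
theory Submission
  imports Defs
begin

section \<open>Hermitian matrices and functional calculus\<close>

text \<open>For \<open>k > 0\<close> the eigenbases of successive outputs are not controlled. What
  passes from one stage to the next is a bound on partial sums: the sum of \<open>r + 1\<close>
  output eigenvalues is a combination of the \<open>d\<close> input eigenvalues with coefficients
  between 0 and 1 that add up to \<open>(r + 1) * d / (d + 1)\<close>. Since this equals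
  \<open>r + (d - r) / (d + 1)\<close>, the largest value for a sorted spectrum takes
  \<open>r\<close> eigenvalues in full and a fraction of the next. A diagonal state with decreasing
  entries attains it, and its output is again diagonal with decreasing entries.

  The kernel of the shifted Casimir operator is found by elementary recurrences: the adjoint of
  \<open>D\<close> is injective, so that it can be cancelled from the equation.

  Time reversal enters because a vector of minimal total spin pairs each basis vector of the smaller
  spin with a product that contains the reflected basis vector. It takes a coherent state to the one
  in the opposite direction, which is why the spinor of \<open>-\<omega>\<close> appears at the
  end.\<close>

lemma dim_mat_adjoint [simp]:
  "dim_row (mat_adjoint A) = dim_col A" "dim_col (mat_adjoint A) = dim_row A"
  by (auto simp: mat_adjoint_def)

lemma index_mat_adjoint [simp]:
  fixes A :: "complex mat"
  assumes "i < dim_col A" "j < dim_row A"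
  shows "mat_adjoint A $$ (i, j) = cnj (A $$ (j, i))"
  using assms by (simp add: mat_adjoint_def mat_of_rows_index)

lemma mat_adjoint_carrier [simp]:
  "A \<in> carrier_mat m n \<Longrightarrow> mat_adjoint A \<in> carrier_mat n m"
  by (metis carrier_matD carrier_matI dim_mat_adjoint)

lemma mat_adjoint_adjoint [simp]: "mat_adjoint (mat_adjoint A) = (A :: complex mat)"
  by (rule eq_matI) auto

lemma assoc_mult_mat_dim:
  "dim_col A = dim_row B \<Longrightarrow> dim_col B = dim_row C \<Longrightarrow> A * B * C = A * (B * C)"
  for A B C :: "'a::semiring_0 mat"
  by (rule assoc_mult_mat[OF carrier_matI carrier_matI carrier_matI]) auto

lemma mat_adjoint_mult:
  fixes A B :: "complex mat"
  assumes "A \<in> carrier_mat l m" "B \<in> carrier_mat m n"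
  shows "mat_adjoint (A * B) = mat_adjoint B * mat_adjoint A"
  using assms by (intro eq_matI) (auto simp: scalar_prod_def mult.commute intro!: sum.cong)

lemma mat_adjoint_add:
  fixes A B :: "complex mat"
  assumes "A \<in> carrier_mat m n" "B \<in> carrier_mat m n"
  shows "mat_adjoint (A + B) = mat_adjoint A + mat_adjoint B"
  using assms by (intro eq_matI) auto

lemma mat_adjoint_smult:
  "mat_adjoint (c \<cdot>\<^sub>m A) = cnj c \<cdot>\<^sub>m mat_adjoint (A :: complex mat)"
  by (intro eq_matI) auto

lemma mat_adjoint_one [simp]: "mat_adjoint (1\<^sub>m n :: complex mat) = 1\<^sub>m n"
  by (intro eq_matI) auto

lemma mat_adjoint_diag_real:
  "mat_adjoint (mat_diag n (\<lambda>i. complex_of_real (d i))) = mat_diag n (\<lambda>i. complex_of_real (d i))"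
  by (intro eq_matI) (auto simp: mat_diag_def)

lemma unitary_matD:
  assumes "unitary_mat n U"
  shows "U \<in> carrier_mat n n" "mat_adjoint U * U = 1\<^sub>m n" "U * mat_adjoint U = 1\<^sub>m n"
proof -
  show 1: "U \<in> carrier_mat n n" and 2: "mat_adjoint U * U = 1\<^sub>m n"
    using assms by (auto simp: unitary_mat_def)
  show "U * mat_adjoint U = 1\<^sub>m n"
    using mat_mult_left_right_inverse[OF mat_adjoint_carrier[OF 1] 1 2] .
qed

lemma unitary_mat_mult:
  assumes "unitary_mat n U" "unitary_mat n V"
  shows "unitary_mat n (U * V)"
proof -
  note U = unitary_matD[OF assms(1)] and V = unitary_matD[OF assms(2)]
  have "mat_adjoint (U * V) * (U * V) = mat_adjoint V * (mat_adjoint U * U) * V"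
    using U(1) V(1) by (simp add: mat_adjoint_mult assoc_mult_mat_dim)
  then show ?thesis using U V by (simp add: unitary_mat_def)
qed

lemma unitary_mat_one: "unitary_mat n (1\<^sub>m n)"
  by (simp add: unitary_mat_def)

section \<open>Spectral decompositions\<close>

definition spectral_dec :: "nat \<Rightarrow> complex mat \<Rightarrow> complex mat \<Rightarrow> (nat \<Rightarrow> real) \<Rightarrow> bool" where
  "spectral_dec n A U d \<longleftrightarrow> unitary_mat n U \<and>
     A = U * mat_diag n (\<lambda>i. complex_of_real (d i)) * mat_adjoint U"

lemma spectral_dec_conj:
  assumes "unitary_mat n W" "spectral_dec n A U d"
  shows "spectral_dec n (W * A * mat_adjoint W) (W * U) d"
proof -
  note W = unitary_matD[OF assms(1)]
  have U: "U \<in> carrier_mat n n" using assms(2) by (simp add: spectral_dec_def unitary_mat_def)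
  show ?thesis
    using assms W(1) U
    by (simp add: spectral_dec_def unitary_mat_mult mat_adjoint_mult assoc_mult_mat_dim mat_diag_def)
qed

text \<open>Complete \<open>v\<close> to a basis, orthogonalise it by Gram-Schmidt, which keeps the
  first vector, and normalise the columns. The scalar \<open>c\<close> is the reciprocal of the norm
  of \<open>v\<close>.\<close>

lemma unitary_completion:
  fixes v :: "complex vec"
  assumes v: "v \<in> carrier_vec n" and v0: "v \<noteq> 0\<^sub>v n"
  shows "\<exists>U c. unitary_mat n U \<and> c \<noteq> 0 \<and> col U 0 = c \<cdot>\<^sub>v v"
proof -
  interpret cof_vec_space n "TYPE(complex)" .
  have n: "n \<noteq> 0" using v v0 by (metis carrier_vecD eq_vecI index_zero_vec(2) less_nat_zero_code)
  define b where "b = basis_completion v"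
  define ws where "ws = gram_schmidt n b"
  from basis_completion[OF v v0, folded b_def]
  have dist_b: "distinct b" and indep: "\<not> lin_dep (set b)" and b: "set b \<subseteq> carrier_vec n"
    and hdb: "hd b = v" and len_b: "length b = n" by auto
  from hdb len_b n obtain vs where bv: "b = v # vs" by (cases b, auto)
  from gram_schmidt_result[OF b dist_b indep refl, folded ws_def]
  have ws: "set ws \<subseteq> carrier_vec n" "corthogonal ws" "length ws = n"
    by (auto simp: len_b)
  from gram_schmidt_hd[OF v, of vs, folded bv] have hdws: "hd ws = v" unfolding ws_def .
  have wsc: "ws ! i \<in> carrier_vec n" if "i < n" for i using ws that by auto
  define r where "r i = sqrt (Re (ws ! i \<bullet>c ws ! i))" for i
  have orth: "ws ! i \<bullet>c ws ! j = 0" if "i < n" "j < n" "i \<noteq> j" for i j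
    using corthogonalD[OF ws(2)] that ws(3) by auto
  have nz: "ws ! i \<bullet>c ws ! i \<noteq> 0" if "i < n" for i
    using corthogonalD[OF ws(2)] that ws(3) by auto
  have pos: "ws ! i \<bullet>c ws ! i = complex_of_real ((r i)\<^sup>2)" "r i \<noteq> 0" if i: "i < n" for i
  proof -
    have ge: "ws ! i \<bullet>c ws ! i \<ge> 0" by (rule conjugate_square_ge_0_vec)
    then have im: "Im (ws ! i \<bullet>c ws ! i) = 0" and re: "Re (ws ! i \<bullet>c ws ! i) \<ge> 0"
      by (auto simp: less_eq_complex_def)
    show "ws ! i \<bullet>c ws ! i = complex_of_real ((r i)\<^sup>2)"
      using im re by (simp add: r_def complex_eq_iff)
    then show "r i \<noteq> 0" using nz[OF i] by auto
  qed
  define us where "us = map (\<lambda>i. complex_of_real (1 / r i) \<cdot>\<^sub>v ws ! i) [0..<n]"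
  define U where "U = mat_of_cols n us"
  have U: "U \<in> carrier_mat n n" using mat_of_cols_carrier(1)[of n us] by (simp add: U_def us_def)
  have colU: "col U i = complex_of_real (1 / r i) \<cdot>\<^sub>v ws ! i" if "i < n" for i
    using that wsc[OF that] by (simp add: U_def us_def col_mat_of_cols)
  have "mat_adjoint U * U = 1\<^sub>m n"
  proof (rule eq_matI)
    fix i j assume "i < dim_row (1\<^sub>m n :: complex mat)" "j < dim_col (1\<^sub>m n :: complex mat)"
    then have i: "i < n" and j: "j < n" by auto
    have "(mat_adjoint U * U) $$ (i, j) = (\<Sum>k<n. cnj (U $$ (k, i)) * U $$ (k, j))"
      using U i j by (auto simp: scalar_prod_def atLeast0LessThan)
    also have "\<dots> = (\<Sum>k<n. cnj (col U i $ k) * col U j $ k)"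
      using U i j by (intro sum.cong) auto
    also have "\<dots> = (\<Sum>k<n. complex_of_real (1 / r i) * complex_of_real (1 / r j) * (ws ! j $ k * cnj (ws ! i $ k)))"
      using wsc[OF i] wsc[OF j] by (intro sum.cong) (auto simp: colU i j)
    also have "\<dots> = complex_of_real (1 / r i) * complex_of_real (1 / r j) * (ws ! j \<bullet>c ws ! i)"
      using wsc[OF i] by (simp add: scalar_prod_def sum_distrib_left atLeast0LessThan)
    also have "\<dots> = (if i = j then 1 else 0)"
      using orth[OF j i] pos[OF i] by (auto simp: power2_eq_square)
    finally show "(mat_adjoint U * U) $$ (i, j) = 1\<^sub>m n $$ (i, j)" using i j by simp
  qed (use U in auto)
  then have "unitary_mat n U" using U by (simp add: unitary_mat_def)
  moreover have "col U 0 = complex_of_real (1 / r 0) \<cdot>\<^sub>v v"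
    using colU[of 0] n hdws ws(3) by (metis bot_nat_0.not_eq_extremum hd_conv_nth length_0_conv)
  moreover have "complex_of_real (1 / r 0) \<noteq> 0" using pos(2)[of 0] n by simp
  ultimately show ?thesis by blast
qed

lemma hermitian_conj:
  assumes "hermitian_mat n A" "W \<in> carrier_mat n m"
  shows "hermitian_mat m (mat_adjoint W * A * W)"
proof -
  have A: "A \<in> carrier_mat n n" "mat_adjoint A = A" using assms by (auto simp: hermitian_mat_def)
  have "mat_adjoint W * A \<in> carrier_mat m n"
    using A assms(2) by (intro mult_carrier_mat[of _ m n]) auto
  then have "mat_adjoint (mat_adjoint W * A * W) = mat_adjoint W * (A * W)"
    using A assms(2) by (simp add: mat_adjoint_mult[of _ m n _ m] mat_adjoint_mult[of _ m n _ n])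
  moreover have "mat_adjoint W * A * W = mat_adjoint W * (A * W)"
    using carrier_matD[OF A(1)] carrier_matD[OF assms(2)] by (intro assoc_mult_mat_dim) auto
  moreover have "mat_adjoint W * A * W \<in> carrier_mat m m"
    using carrier_matD[OF A(1)] carrier_matD[OF assms(2)] by auto
  ultimately show ?thesis by (metis hermitian_mat_def)
qed

text \<open>Deflation: a unitary with an eigenvector as first column conjugates \<open>A\<close> to
  a matrix whose first column, and by hermiticity also first row, vanishes off the diagonal. The
  remaining block is Hermitian of size \<open>n\<close>. The split-off eigenvalue is real, being a
  diagonal entry of a Hermitian matrix.\<close>

theorem spectral_theorem:
  assumes "hermitian_mat n A"
  shows "\<exists>U d. spectral_dec n A U d"
  using assms
proof (induction n arbitrary: A)
  case 0
  then have "spectral_dec 0 A (1\<^sub>m 0) (\<lambda>_. 0)"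
    unfolding spectral_dec_def by (auto simp: hermitian_mat_def unitary_mat_one intro!: eq_matI)
  then show ?case by blast
next
  case (Suc n)
  have A: "A \<in> carrier_mat (Suc n) (Suc n)" using Suc.prems by (simp add: hermitian_mat_def)
  obtain as where as: "char_poly A = (\<Prod>a\<leftarrow>as. [:- a, 1:])" "length as = Suc n"
    using char_poly_factorized[OF A] by blast
  then obtain e bs where "as = e # bs" by (cases as) auto
  then have "eigenvalue A e" using eigenvalue_root_char_poly[OF A] as by simp
  then obtain v where v: "v \<in> carrier_vec (Suc n)" "v \<noteq> 0\<^sub>v (Suc n)" "A *\<^sub>v v = e \<cdot>\<^sub>v v"
    using A by (auto simp: eigenvalue_def eigenvector_def)
  obtain W c where W: "unitary_mat (Suc n) W" and c: "col W 0 = c \<cdot>\<^sub>v v"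
    using unitary_completion[OF v(1,2)] by blast
  note Wd = unitary_matD[OF W]
  define B where "B = mat_adjoint W * A * W"
  have hB: "hermitian_mat (Suc n) B" unfolding B_def by (rule hermitian_conj[OF Suc.prems Wd(1)])
  have B: "B \<in> carrier_mat (Suc n) (Suc n)" using hB by (simp add: hermitian_mat_def)
  have Bherm: "B $$ (i, j) = cnj (B $$ (j, i))" if "i < Suc n" "j < Suc n" for i j
    using hB that unfolding hermitian_mat_def by (metis carrier_matD index_mat_adjoint)
  have AW: "A *\<^sub>v col W 0 = e \<cdot>\<^sub>v col W 0"
    using v A by (simp add: c mult_mat_vec smult_smult_assoc mult.commute)
  have B0: "B $$ (i, 0) = (if i = 0 then e else 0)" if i: "i < Suc n" for i
  proof -
    have "B $$ (i, 0) = (mat_adjoint W * (A * W)) $$ (i, 0)"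
      using A Wd(1) by (simp add: B_def assoc_mult_mat_dim)
    also have "\<dots> = row (mat_adjoint W) i \<bullet> (A *\<^sub>v col W 0)"
      using A Wd(1) i col_mult2[OF A Wd(1), of 0] by (subst index_mult_mat(1)) auto
    also have "\<dots> = e * (mat_adjoint W * W) $$ (i, 0)"
      using Wd(1) i by (simp add: AW)
    finally show ?thesis using i by (simp add: Wd(2))
  qed
  define C where "C = Matrix.mat n n (\<lambda>(i, j). B $$ (Suc i, Suc j))"
  have "hermitian_mat n C"
    unfolding hermitian_mat_def C_def by (intro conjI eq_matI) (auto intro: Bherm[symmetric])
  then obtain V d where "spectral_dec n C V d" using Suc.IH by blast
  then have V: "unitary_mat n V" and CV: "C = V * mat_diag n (\<lambda>i. complex_of_real (d i)) * mat_adjoint V"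
    by (auto simp: spectral_dec_def)
  note Vd = unitary_matD[OF V]
  \<comment> \<open>The direct sum of the number 1 and \<open>V\<close>.\<close>
  define V' where "V' = Matrix.mat (Suc n) (Suc n)
    (\<lambda>(i, j). if i = 0 \<or> j = 0 then (if i = j then 1 else 0) else V $$ (i - 1, j - 1))"
  define d' where "d' i = (if i = 0 then Re e else d (i - 1))" for i
  have er: "complex_of_real (Re e) = e"
  proof -
    have "e = cnj e" using Bherm[of 0 0] B0[of 0] by (metis zero_less_Suc)
    then show ?thesis by (simp add: complex_eq_iff)
  qed
  have V'c: "V' \<in> carrier_mat (Suc n) (Suc n)" by (simp add: V'_def)
  have s: "(\<Sum>k = 0..<Suc n. f k) = f 0 + (\<Sum>k = 0..<n. f (Suc k))" for f :: "nat \<Rightarrow> complex"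
    by (simp add: sum.atLeast0_lessThan_Suc_shift del: sum.op_ivl_Suc)
  have V'u: "unitary_mat (Suc n) V'"
  proof -
    have "(mat_adjoint V' * V') $$ (i, j) = 1\<^sub>m (Suc n) $$ (i, j)" if i: "i < Suc n" and j: "j < Suc n" for i j
    proof -
      have "(mat_adjoint V' * V') $$ (i, j) = (\<Sum>k = 0..<Suc n. cnj (V' $$ (k, i)) * V' $$ (k, j))"
        using V'c i j by (auto simp: scalar_prod_def simp del: sum.op_ivl_Suc)
      also have "\<dots> = 1\<^sub>m (Suc n) $$ (i, j)"
      proof (cases "i = 0 \<or> j = 0")
        case True
        then show ?thesis using i j by (auto simp: s V'_def simp del: sum.op_ivl_Suc)
      next
        case False
        then obtain i' j' where ij: "i = Suc i'" "j = Suc j'" "i' < n" "j' < n"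
          using i j by (metis Suc_less_SucD gr0_implies_Suc not_gr_zero)
        have "(\<Sum>k = 0..<n. cnj (V $$ (k, i')) * V $$ (k, j')) = (mat_adjoint V * V) $$ (i', j')"
          using Vd(1) ij by (auto simp: scalar_prod_def)
        then show ?thesis using ij by (simp add: s V'_def Vd(2) del: sum.op_ivl_Suc)
      qed
      finally show ?thesis .
    qed
    then have "mat_adjoint V' * V' = 1\<^sub>m (Suc n)" using V'c by (intro eq_matI) auto
    then show ?thesis using V'c by (simp add: unitary_mat_def)
  qed
  have "B = V' * mat_diag (Suc n) (\<lambda>i. complex_of_real (d' i)) * mat_adjoint V'"
  proof (rule eq_matI)
    fix i j assume "i < dim_row (V' * mat_diag (Suc n) (\<lambda>i. complex_of_real (d' i)) * mat_adjoint V')"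
      "j < dim_col (V' * mat_diag (Suc n) (\<lambda>i. complex_of_real (d' i)) * mat_adjoint V')"
    then have i: "i < Suc n" and j: "j < Suc n" using V'c by auto
    have "(V' * mat_diag (Suc n) (\<lambda>i. complex_of_real (d' i)) * mat_adjoint V') $$ (i, j)
        = (\<Sum>k = 0..<Suc n. V' $$ (i, k) * d' k * cnj (V' $$ (j, k)))"
      using V'c i j by (auto simp: mat_diag_mult_right[OF V'c] scalar_prod_def simp del: sum.op_ivl_Suc)
    also have "\<dots> = B $$ (i, j)"
    proof (cases "i = 0 \<or> j = 0")
      case True
      have "B $$ (0, j) = (if j = 0 then e else 0)"
        using Bherm[of 0 j] B0[OF j] j B0[of 0] by (cases "j = 0") auto
      then show ?thesis using True i j B0[OF i] er
        by (cases "i = 0"; cases "j = 0") (simp_all add: s V'_def d'_def del: sum.op_ivl_Suc)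
    next
      case False
      then obtain i' j' where ij: "i = Suc i'" "j = Suc j'" "i' < n" "j' < n"
        using i j by (metis Suc_less_SucD gr0_implies_Suc not_gr_zero)
      have "(\<Sum>k = 0..<n. V $$ (i', k) * d k * cnj (V $$ (j', k))) = C $$ (i', j')"
        unfolding CV using Vd(1) ij by (auto simp: mat_diag_mult_right[OF Vd(1)] scalar_prod_def)
      then show ?thesis using ij by (simp add: s V'_def d'_def C_def del: sum.op_ivl_Suc)
    qed
    finally show "B $$ (i, j) = (V' * mat_diag (Suc n) (\<lambda>i. complex_of_real (d' i)) * mat_adjoint V') $$ (i, j)"
      by simp
  qed (use B V'c in auto)
  then have "spectral_dec (Suc n) B V' d'" using V'u by (simp add: spectral_dec_def)
  from spectral_dec_conj[OF W this]
  have "spectral_dec (Suc n) (W * B * mat_adjoint W) (W * V') d'" .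
  moreover have "W * B * mat_adjoint W = A"
  proof -
    have "W * B * mat_adjoint W = (W * mat_adjoint W) * A * (W * mat_adjoint W)"
      using A Wd(1) by (simp add: B_def assoc_mult_mat_dim)
    then show ?thesis using A by (simp add: Wd(3))
  qed
  ultimately show ?case by auto
qed

section \<open>Traces and functional calculus in a spectral decomposition\<close>

lemma mat_trace_mult_comm:
  assumes "A \<in> carrier_mat m n" "B \<in> carrier_mat n m"
  shows "mat_trace (A * B) = mat_trace (B * A)"
proof -
  have "mat_trace (A * B) = (\<Sum>i<m. \<Sum>j<n. A $$ (i, j) * B $$ (j, i))"
    using assms by (auto simp: mat_trace_def scalar_prod_def atLeast0LessThan intro!: sum.cong)
  also have "\<dots> = (\<Sum>j<n. \<Sum>i<m. B $$ (j, i) * A $$ (i, j))"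
    by (subst sum.swap) (simp add: mult.commute)
  also have "\<dots> = mat_trace (B * A)"
    using assms by (auto simp: mat_trace_def scalar_prod_def atLeast0LessThan intro!: sum.cong)
  finally show ?thesis .
qed

lemma spectral_decD:
  assumes "spectral_dec n A U d"
  shows "unitary_mat n U" "U \<in> carrier_mat n n" "A \<in> carrier_mat n n"
    "A = U * mat_diag n (\<lambda>i. complex_of_real (d i)) * mat_adjoint U"
    "mat_adjoint U * A * U = mat_diag n (\<lambda>i. complex_of_real (d i))"
    "hermitian_mat n A"
proof -
  let ?D = "mat_diag n (\<lambda>i. complex_of_real (d i))"
  show 1: "unitary_mat n U" and 2: "A = U * ?D * mat_adjoint U"
    using assms by (auto simp: spectral_dec_def)
  note U = unitary_matD[OF 1]
  note Ud = carrier_matD[OF U(1)]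
  show "U \<in> carrier_mat n n" by (rule U(1))
  show A: "A \<in> carrier_mat n n" unfolding 2 using Ud by (intro carrier_matI) auto
  have "mat_adjoint U * A * U = (mat_adjoint U * U) * ?D * (mat_adjoint U * U)"
    unfolding 2 using Ud by (simp add: assoc_mult_mat_dim mat_diag_def)
  then show "mat_adjoint U * A * U = ?D" unfolding U(2) by (simp add: mat_diag_def)
  have "hermitian_mat n ?D" by (simp add: hermitian_mat_def mat_adjoint_diag_real)
  from hermitian_conj[OF this mat_adjoint_carrier[OF U(1)]]
  show "hermitian_mat n A" unfolding 2 by simp
qed

lemma mat_trace_spectral:
  assumes "spectral_dec n A U d"
  shows "mat_trace A = (\<Sum>i<n. complex_of_real (d i))"
proof -
  note A = spectral_decD[OF assms]
  have "mat_trace A = mat_trace (mat_adjoint U * (U * mat_diag n (\<lambda>i. complex_of_real (d i))))"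
    unfolding A(4) using A(2) by (intro mat_trace_mult_comm[of _ n n]) auto
  also have "mat_adjoint U * (U * mat_diag n (\<lambda>i. complex_of_real (d i))) = mat_diag n (\<lambda>i. complex_of_real (d i))"
    using A(2) unitary_matD(2)[OF A(1)]
    by (subst assoc_mult_mat_dim[symmetric]) (auto simp: mat_diag_def)
  finally show ?thesis by (simp add: mat_trace_def mat_diag_def)
qed

text \<open>Makes the definite description usable. For two diagonalisations with unitaries
  \<open>U\<close> and \<open>V\<close>, the matrix \<open>W = mat_adjoint V * U\<close> intertwines
  the diagonal matrices of \<open>d\<close> and \<open>e\<close>, so \<open>W\<close> has a nonzero
  entry \<open>(i, j)\<close> only if \<open>e i = d j\<close>. Hence it also intertwines the
  diagonal matrices after \<open>f\<close> is applied.\<close>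

lemma mat_fun_eq:
  assumes "spectral_dec n A U d"
  shows "mat_fun f A = U * mat_diag n (\<lambda>i. complex_of_real (f (d i))) * mat_adjoint U"
proof -
  note A = spectral_decD[OF assms]
  have n: "dim_row A = n" using A(3) by simp
  let ?B = "U * mat_diag n (\<lambda>i. complex_of_real (f (d i))) * mat_adjoint U"
  show ?thesis
    unfolding mat_fun_def Let_def n
  proof (rule the_equality)
    show "\<exists>U' d'. unitary_mat n U' \<and>
        A = U' * mat_diag n (\<lambda>i. complex_of_real (d' i)) * mat_adjoint U' \<and>
        ?B = U' * mat_diag n (\<lambda>i. complex_of_real (f (d' i))) * mat_adjoint U'"
      using A(1,4) by blast
  next
    fix B assume "\<exists>U' d'. unitary_mat n U' \<and>
        A = U' * mat_diag n (\<lambda>i. complex_of_real (d' i)) * mat_adjoint U' \<and>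
        B = U' * mat_diag n (\<lambda>i. complex_of_real (f (d' i))) * mat_adjoint U'"
    then obtain V e where V: "unitary_mat n V"
      and AV: "A = V * mat_diag n (\<lambda>i. complex_of_real (e i)) * mat_adjoint V"
      and B: "B = V * mat_diag n (\<lambda>i. complex_of_real (f (e i))) * mat_adjoint V" by blast
    note Ud = unitary_matD[OF A(1)] and Vd = unitary_matD[OF V]
    note dims = carrier_matD[OF Ud(1)] carrier_matD[OF Vd(1)]
    let ?D = "\<lambda>d :: nat \<Rightarrow> real. mat_diag n (\<lambda>i. complex_of_real (d i))"
    define W where "W = mat_adjoint V * U"
    have W: "W \<in> carrier_mat n n" using dims by (auto simp: W_def)
    have "?D e * W = mat_adjoint V * (V * ?D e * mat_adjoint V) * U"
      using dims by (simp add: W_def assoc_mult_mat_dim[symmetric] Vd(2) mat_diag_def)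
    also have "\<dots> = mat_adjoint V * (U * ?D d * mat_adjoint U) * U"
      unfolding A(4)[symmetric] AV[symmetric] ..
    also have "\<dots> = W * ?D d * (mat_adjoint U * U)"
      using dims by (simp add: W_def assoc_mult_mat_dim mat_diag_def)
    also have "\<dots> = W * ?D d" using dims by (simp add: Ud(2) W_def mat_diag_def)
    finally have comm: "?D e * W = W * ?D d" .
    have "?D (f \<circ> e) * W = W * ?D (f \<circ> d)"
    proof (rule eq_matI)
      fix i j assume "i < dim_row (W * ?D (f \<circ> d))" "j < dim_col (W * ?D (f \<circ> d))"
      then have i: "i < n" and j: "j < n" using W by (auto simp: mat_diag_def)
      have "(?D e * W) $$ (i, j) = (W * ?D d) $$ (i, j)" by (simp only: comm)
      then have "complex_of_real (e i) * W $$ (i, j) = W $$ (i, j) * complex_of_real (d j)"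
        using W i j by (simp add: mat_diag_mult_left[OF W] mat_diag_mult_right[OF W])
      then have "W $$ (i, j) = 0 \<or> e i = d j" by (auto simp: mult.commute)
      then show "(?D (f \<circ> e) * W) $$ (i, j) = (W * ?D (f \<circ> d)) $$ (i, j)"
        using W i j by (auto simp: mat_diag_mult_left[OF W] mat_diag_mult_right[OF W])
    qed (use W in \<open>auto simp: mat_diag_def\<close>)
    then have fcomm: "?D (\<lambda>i. f (e i)) * W = W * ?D (\<lambda>i. f (d i))" by (simp add: o_def)
    have "B = V * ?D (\<lambda>i. f (e i)) * mat_adjoint V * (U * mat_adjoint U)"
      unfolding B Ud(3) using dims by (simp add: mat_diag_def)
    also have "\<dots> = V * (?D (\<lambda>i. f (e i)) * W) * mat_adjoint U"
      using dims by (simp add: W_def assoc_mult_mat_dim mat_diag_def)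
    also have "\<dots> = (V * mat_adjoint V) * U * ?D (\<lambda>i. f (d i)) * mat_adjoint U"
      unfolding fcomm using dims by (simp add: W_def assoc_mult_mat_dim mat_diag_def)
    also have "\<dots> = ?B" using dims Ud(1) by (simp add: Vd(3))
    finally show "B = ?B" .
  qed
qed

lemma mat_trace_mat_fun:
  assumes "spectral_dec n A U d"
  shows "mat_trace (mat_fun f A) = complex_of_real (\<Sum>i<n. f (d i))"
proof -
  have "spectral_dec n (mat_fun f A) U (\<lambda>i. f (d i))"
    using assms unfolding mat_fun_eq[OF assms] by (simp add: spectral_dec_def)
  from mat_trace_spectral[OF this] show ?thesis by simp
qed

lemma spectral_dec_pos:
  assumes "density_mat n A" "spectral_dec n A U d"
  shows "i < n \<Longrightarrow> 0 \<le> d i" "(\<Sum>i<n. d i) = 1"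
proof -
  note A = spectral_decD[OF assms(2)]
  show "(\<Sum>i<n. d i) = 1"
    using mat_trace_spectral[OF assms(2)] assms(1)
    by (simp add: density_mat_def flip: of_real_sum)
  assume i: "i < n"
  have "complex_of_real (d i) = (mat_adjoint U * A * U) $$ (i, i)"
    unfolding A(5) using i by (simp add: mat_diag_def)
  also have "\<dots> = (mat_adjoint U * (A * U)) $$ (i, i)"
    using A(2,3) by (simp add: assoc_mult_mat_dim)
  also have "\<dots> = (A *\<^sub>v col U i) \<bullet>c col U i"
    using A(2,3) i by (auto simp: scalar_prod_def mult.commute intro!: sum.cong)
  also have "\<dots> \<ge> 0" using assms(1) A(2) i by (auto simp: density_mat_def)
  finally show "0 \<le> d i" by (simp add: less_eq_complex_def)
qed

section \<open>Majorization and concave functions\<close>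

text \<open>A sequence \<open>x\<close> is majorized by \<open>y\<close> if both have the same sum and \<open>excess n x t \<le> excess n y t\<close>
  for all \<open>t\<close>; in this form no sorting is needed.\<close>

definition excess :: "nat \<Rightarrow> (nat \<Rightarrow> real) \<Rightarrow> real \<Rightarrow> real" where
  "excess n x t = (\<Sum>i<n. max (x i - t) 0)"

lemma concave_on_chord:
  fixes f :: "real \<Rightarrow> real"
  assumes "concave_on {0..1} f" "x \<in> {0..1}"
  shows "f x \<ge> x * f 1 + (1 - x) * f 0"
  using assms concave_onD[OF assms(1), of x 0 1] by (simp add: algebra_simps)

lemma concave_slope_antimono:
  fixes f :: "real \<Rightarrow> real"
  assumes f: "concave_on {0..1} f" and "0 \<le> a" "a < b" "b < c" "c \<le> 1"
  shows "(f c - f b) / (c - b) \<le> (f b - f a) / (b - a)"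
proof -
  define u where "u = (b - a) / (c - a)"
  have u: "0 \<le> u" "u \<le> 1" "(1 - u) * a + u * c = b"
  proof -
    show "0 \<le> u" "u \<le> 1" using assms by (auto simp: u_def)
    have "u * (c - a) = b - a" using assms by (simp add: u_def)
    then show "(1 - u) * a + u * c = b" by (simp add: algebra_simps)
  qed
  have "f b \<ge> (1 - u) * f a + u * f c"
    using concave_onD[OF f, of u a c] u assms by simp
  then have "(c - a) * f b \<ge> (c - a) * ((1 - u) * f a + u * f c)"
    using assms by (intro mult_left_mono) auto
  also have "(c - a) * ((1 - u) * f a + u * f c) = (c - b) * f a + (b - a) * f c"
  proof -
    have u': "(c - a) * u = b - a" using assms by (simp add: u_def)
    have "(c - a) * ((1 - u) * f a + u * f c) = (c - a - (c - a) * u) * f a + ((c - a) * u) * f c"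
      by (simp add: algebra_simps)
    then show ?thesis unfolding u' by simp
  qed
  finally show ?thesis using assms by (simp add: field_simps)
qed

lemma excess_eq:
  assumes "\<And>i. i < n \<Longrightarrow> t \<le> x i"
  shows "excess n x t = (\<Sum>i<n. x i) - real n * t"
proof -
  have "excess n x t = (\<Sum>i<n. x i - t)"
    unfolding excess_def by (intro sum.cong) (use assms in \<open>simp_all add: max_absorb1\<close>)
  then show ?thesis by (simp add: sum_subtractf)
qed

lemma excess_eq_0:
  assumes "\<And>i. i < n \<Longrightarrow> x i \<le> t"
  shows "excess n x t = 0"
  using assms by (simp add: excess_def max_def)

text \<open>Only finitely many values of \<open>f\<close> occur, so \<open>f\<close> can be replaced
  by its piecewise linear interpolant at these values and at 0 and 1; a jump of \<open>f\<close> at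
  an end of the interval then does no harm. The interpolant is a combination of functions
  \<open>max (z - t) 0\<close>, whose sums are the \<open>excess\<close> terms, and summation by
  parts uses that its slopes decrease.\<close>

lemma concave_sum_antimono:
  fixes f :: "real \<Rightarrow> real" and x y :: "nat \<Rightarrow> real"
  assumes f: "concave_on {0..1} f"
    and x: "\<And>i. i < n \<Longrightarrow> x i \<in> {0..1}" and y: "\<And>i. i < n \<Longrightarrow> y i \<in> {0..1}"
    and eq: "(\<Sum>i<n. x i) = (\<Sum>i<n. y i)"
    and le: "\<And>t. excess n x t \<le> excess n y t"
  shows "(\<Sum>i<n. f (y i)) \<le> (\<Sum>i<n. f (x i))"
proof -
  define T where "T = sorted_list_of_set (insert 0 (insert 1 (x ` {..<n} \<union> y ` {..<n})))"
  have T: "set T = insert 0 (insert 1 (x ` {..<n} \<union> y ` {..<n}))" "sorted_wrt (<) T"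
    unfolding T_def by (simp_all del: sorted_list_of_set_insert_remove)
  then have T01: "set T \<subseteq> {0..1}" using x y by auto
  define p where "p = length T - 1"
  have "card (set T) \<le> length T" by (rule card_length)
  moreover have "card {0, 1 :: real} \<le> card (set T)" using T(1) by (intro card_mono) auto
  ultimately have p: "1 \<le> p" "length T = Suc p" by (auto simp: p_def)
  have mono: "T ! i < T ! j" if "i < j" "j \<le> p" for i j
    using sorted_wrt_nth_less[OF T(2), of i j] that p by simp
  have T_in: "T ! i \<in> {0..1}" if "i \<le> p" for i
    using T01 that p nth_mem[of i T] by (metis le_imp_less_Suc subsetD)
  define s where "s j = (f (T ! Suc j) - f (T ! j)) / (T ! Suc j - T ! j)" for j
  have s_dec: "s (Suc j) \<le> s j" if "Suc j < p" for j
    unfolding s_def using that T_in[of j] T_in[of "Suc (Suc j)"] mono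
    by (intro concave_slope_antimono[OF f]) auto
  \<comment> \<open>The factor of \<open>s j\<close> is the length of the part of the interval from
    \<open>T ! j\<close> to \<open>T ! Suc j\<close> that lies below \<open>z\<close>.\<close>
  define pl where "pl z = f (T ! 0) + (\<Sum>j<p. s j * (max (z - T ! j) 0 - max (z - T ! Suc j) 0))" for z
  have pl: "pl (T ! i) = f (T ! i)" if i: "i \<le> p" for i
  proof -
    have "(\<Sum>j<p. s j * (max (T ! i - T ! j) 0 - max (T ! i - T ! Suc j) 0))
        = (\<Sum>j<p. if j < i then f (T ! Suc j) - f (T ! j) else 0)"
    proof (intro sum.cong refl)
      fix j assume j: "j \<in> {..<p}"
      have "T ! i \<le> T ! j" if "\<not> j < i" using mono[of i j] that j by (cases "i = j") auto
      moreover have "T ! Suc j \<le> T ! i" if "j < i" using mono[of "Suc j" i] that i by (cases "Suc j = i") auto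
      moreover have "T ! j < T ! Suc j" using mono[of j "Suc j"] j by auto
      ultimately show "s j * (max (T ! i - T ! j) 0 - max (T ! i - T ! Suc j) 0)
          = (if j < i then f (T ! Suc j) - f (T ! j) else 0)"
        by (cases "j < i") (auto simp: s_def max_def)
    qed
    also have "\<dots> = (\<Sum>j<i. f (T ! Suc j) - f (T ! j))"
      using i by (intro sum.mono_neutral_cong_right) auto
    also have "\<dots> = f (T ! i) - f (T ! 0)" by (rule sum_lessThan_telescope)
    finally show ?thesis by (simp add: pl_def)
  qed
  have pl': "f z = pl z" if "z \<in> set T" for z
    using that pl p by (metis in_set_conv_nth less_Suc_eq_le)
  have sum_pl: "(\<Sum>i<n. f (z i)) = real n * f (T ! 0) + (\<Sum>j<p. s j * (excess n z (T ! j) - excess n z (T ! Suc j)))"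
    if "\<And>i. i < n \<Longrightarrow> z i \<in> set T" for z
  proof -
    have "(\<Sum>i<n. f (z i)) = (\<Sum>i<n. pl (z i))" using pl' that by (intro sum.cong) auto
    also have "\<dots> = real n * f (T ! 0) + (\<Sum>i<n. \<Sum>j<p. s j * (max (z i - T ! j) 0 - max (z i - T ! Suc j) 0))"
      by (simp add: pl_def sum.distrib)
    also have "(\<Sum>i<n. \<Sum>j<p. s j * (max (z i - T ! j) 0 - max (z i - T ! Suc j) 0))
        = (\<Sum>j<p. s j * (excess n z (T ! j) - excess n z (T ! Suc j)))"
      by (subst sum.swap) (simp add: excess_def sum_distrib_left[symmetric] sum_subtractf)
    finally show ?thesis .
  qed
  define G where "G t = excess n y t - excess n x t" for t
  have G: "G t \<ge> 0" for t using le by (simp add: G_def)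
  have lo: "T ! 0 \<le> z" and hi: "z \<le> T ! p" if "z \<in> set T" for z
  proof -
    obtain i where i: "i \<le> p" "z = T ! i" using \<open>z \<in> set T\<close> p by (metis in_set_conv_nth less_Suc_eq_le)
    show "T ! 0 \<le> z" using mono[of 0 i] i by (cases "i = 0") auto
    show "z \<le> T ! p" using mono[of i p] i by (cases "i = p") auto
  qed
  \<comment> \<open>Both boundary terms of the summation by parts vanish: at the smallest node the
    excess is determined by the sum, which is the same for \<open>x\<close> and \<open>y\<close>,
    and at the largest node there is no excess.\<close>
  have G0: "G (T ! 0) = 0"
    using lo T(1) eq by (simp add: G_def excess_eq)
  have Gp: "G (T ! p) = 0"
    using hi T(1) by (simp add: G_def excess_eq_0)
  have "(\<Sum>i<n. f (y i)) - (\<Sum>i<n. f (x i)) = (\<Sum>j<p. s j * (G (T ! j) - G (T ! Suc j)))"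
    using T(1) by (simp add: sum_pl G_def sum_subtractf algebra_simps)
  \<comment> \<open>Partial summation: the telescoped boundary term is kept on the right, and each
    interior term is a slope increment, at most zero, times \<open>G\<close>, at least zero.\<close>
  moreover have "(\<Sum>j<Suc q. s j * (G (T ! j) - G (T ! Suc j))) \<le> - s q * G (T ! Suc q)" if "q < p" for q
    using that
  proof (induction q)
    case 0
    then show ?case by (simp add: G0)
  next
    case (Suc q)
    have "(s (Suc q) - s q) * G (T ! Suc q) \<le> 0"
      using s_dec[OF Suc.prems] G by (simp add: mult_nonpos_nonneg)
    then show ?case using Suc by (simp add: algebra_simps)
  qed
  from this[of "p - 1"] have "(\<Sum>j<p. s j * (G (T ! j) - G (T ! Suc j))) \<le> 0"
    using p Gp by simp
  ultimately show ?thesis by linarith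
qed

text \<open>The convex function \<open>max (x - t) 0\<close> lies below its chord over the interval
  from 0 to 1. Since the \<open>x i\<close> add up to 1, the chords add up to the value at 1 once
  and the value at 0 in the other \<open>n - 1\<close> places.\<close>

lemma excess_le_pure:
  assumes "\<And>i. i < n \<Longrightarrow> 0 \<le> x i" "(\<Sum>i<n. x i) = 1" "0 < n"
  shows "excess n x t \<le> excess n (\<lambda>i. if i = 0 then 1 else 0) t"
proof -
  have x1: "x i \<le> 1" if "i < n" for i
    using member_le_sum[of i "{..<n}" x] assms that by auto
  have "max (x i - t) 0 \<le> x i * max (1 - t) 0 + (1 - x i) * max (- t) 0" if "i < n" for i
  proof -
    have a: "0 \<le> x i" "x i \<le> 1" using assms x1 that by auto
    have "x i - t = x i * (1 - t) + (1 - x i) * (- t)" by (simp add: algebra_simps)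
    also have "\<dots> \<le> x i * max (1 - t) 0 + (1 - x i) * max (- t) 0"
      using a by (intro add_mono mult_left_mono) auto
    finally show ?thesis using a by simp
  qed
  then have "excess n x t \<le> (\<Sum>i<n. x i * max (1 - t) 0 + (1 - x i) * max (- t) 0)"
    unfolding excess_def by (intro sum_mono) auto
  also have "\<dots> = max (1 - t) 0 + (real n - 1) * max (- t) 0"
    using assms(2) by (simp add: sum.distrib sum_subtractf flip: sum_distrib_right)
  also have "\<dots> = excess n (\<lambda>i. if i = 0 then 1 else 0) t"
  proof -
    obtain m where n: "n = Suc m" using assms(3) by (cases n) auto
    show ?thesis unfolding excess_def n sum.lessThan_Suc_shift by simp
  qed
  finally show ?thesis .
qed

text \<open>The action of one creation step on a diagonal matrix, see \<open>up_diag\<close>: level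
  \<open>j\<close> is reached from level \<open>j\<close> by a boson in the first mode and from
  level \<open>j - 1\<close> by one in the second. The truncated index at \<open>j = 0\<close> and
  the range \<open>j > d\<close> are harmless because the factors \<open>real j\<close> and
  \<open>real (d - j)\<close> vanish there.\<close>

definition raise :: "nat \<Rightarrow> (nat \<Rightarrow> real) \<Rightarrow> nat \<Rightarrow> real" where
  "raise d l j = (real (d - j) * l j + real j * l (j - 1)) / real (d + 1)"

text \<open>The sorted spectrum of a matrix of size \<open>d\<close>, continued by zeros. Together
  with monotonicity the zeros make all entries nonnegative.\<close>

definition decreasing :: "nat \<Rightarrow> (nat \<Rightarrow> real) \<Rightarrow> bool" where
  "decreasing d l \<longleftrightarrow> antimono l \<and> (\<forall>j\<ge>d. l j = 0)"

lemma decreasing_nonneg: "decreasing d l \<Longrightarrow> 0 \<le> l j"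
  unfolding decreasing_def antimono_def by (metis linorder_linear order_refl)

text \<open>For \<open>j < d\<close>, \<open>d + 1\<close> times the difference of the entries
  \<open>j\<close> and \<open>Suc j\<close> is
  \<open>(d - j - 1) * (l j - l (j + 1)) + j * (l (j - 1) - l j)\<close>.\<close>

lemma decreasing_raise:
  assumes "decreasing d l" shows "decreasing (Suc d) (raise d l)"
proof -
  have dec: "raise d l (Suc j) \<le> raise d l j" for j
  proof (cases "j < d")
    case True
    have "l (Suc j) \<le> l j" "l j \<le> l (j - 1)" using assms by (auto simp: decreasing_def antimono_def)
    then have "real (d - Suc j) * l (Suc j) \<le> real (d - Suc j) * l j" "real j * l j \<le> real j * l (j - 1)"
      by (auto intro: mult_left_mono)
    moreover have "real (d - j) = real (d - Suc j) + 1" using True by auto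
    ultimately show ?thesis by (simp add: raise_def divide_right_mono algebra_simps)
  next
    case False
    then have "l j = 0" "l (Suc j) = 0" "0 \<le> l (j - 1)" using assms decreasing_nonneg by (auto simp: decreasing_def)
    then show ?thesis by (simp add: raise_def)
  qed
  then have "antimono (raise d l)" by (rule decseq_SucI)
  moreover have "raise d l j = 0" if "j \<ge> Suc d" for j
    using assms that by (auto simp: raise_def decreasing_def)
  ultimately show ?thesis by (simp add: decreasing_def)
qed

text \<open>Each \<open>l i\<close> contributes with weight \<open>(d - i) / (d + 1)\<close> to
  entry \<open>i\<close> and with weight \<open>(i + 1) / (d + 1)\<close> to entry
  \<open>i + 1\<close>, in total 1. Only the contribution of \<open>l r\<close> is cut off by the
  end of the sum.\<close>

lemma sum_raise:
  assumes "decreasing d l" "r \<le> d"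
  shows "(\<Sum>j<Suc r. raise d l j) = (\<Sum>j<r. l j) + real (d - r) / real (d + 1) * l r"
  using assms(2)
proof (induction r)
  case 0
  then show ?case by (simp add: raise_def)
next
  case (Suc r)
  have e: "real (d - r) + real (Suc r) = real (d + 1)" using Suc.prems by linarith
  have A: "raise d l (Suc r) = real (d - Suc r) / real (d + 1) * l (Suc r) + real (Suc r) / real (d + 1) * l r"
    by (simp only: raise_def add_divide_distrib diff_Suc_1 times_divide_eq_left)
  have B: "real (d - r) / real (d + 1) + real (Suc r) / real (d + 1) = 1"
    unfolding add_divide_distrib[symmetric] e by simp
  have C: "real (d - r) / real (d + 1) * l r + real (Suc r) / real (d + 1) * l r = l r"
    using arg_cong[OF B, of "\<lambda>z. z * l r"] by (simp only: distrib_right mult_1)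
  have IH: "(\<Sum>j<Suc r. raise d l j) = (\<Sum>j<r. l j) + real (d - r) / real (d + 1) * l r"
    using Suc by simp
  show ?case
    unfolding sum.lessThan_Suc[of "raise d l" "Suc r"] sum.lessThan_Suc[of l r] IH A using C by linarith
qed

text \<open>The quantum input of the induction is only that the spectrum \<open>\<beta>\<close> of the output arises from
  the spectrum \<open>\<alpha>\<close> of the input through a matrix with constant row and column sums.\<close>

lemma excess_raise:
  fixes M :: "nat \<Rightarrow> nat \<Rightarrow> real"
  assumes l: "decreasing d l"
    and M: "\<And>i j. 0 \<le> M j i"
    and row: "\<And>j. j < Suc d \<Longrightarrow> (\<Sum>i<d. M j i) = real d / real (d + 1)"
    and col: "\<And>i. i < d \<Longrightarrow> (\<Sum>j<Suc d. M j i) = 1"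
    and \<beta>: "\<And>j. j < Suc d \<Longrightarrow> \<beta> j = (\<Sum>i<d. M j i * \<alpha> i)"
    and maj: "\<And>t. excess d \<alpha> t \<le> excess d l t"
  shows "excess (Suc d) \<beta> t \<le> excess (Suc d) (raise d l) t"
proof -
  \<comment> \<open>The output eigenvalues above the threshold; the excess is the sum of
    \<open>\<beta> j - t\<close> over them, and from here on only their number matters.\<close>
  define S where "S = {j. j < Suc d \<and> \<beta> j > t}"
  have S: "finite S" "S \<subseteq> {..<Suc d}" by (auto simp: S_def)
  have lhs: "excess (Suc d) \<beta> t = (\<Sum>j\<in>S. \<beta> j - t)"
    unfolding excess_def S_def by (intro sum.mono_neutral_cong_right) (auto simp: max_def)
  show ?thesis
  proof (cases "S = {}")
    case True
    then show ?thesis using lhs by (simp add: excess_def sum_nonneg)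
  next
    case False
    define r where "r = card S - 1"
    have cS: "card S = Suc r" using False S by (simp add: r_def card_gt_0_iff)
    have rd: "r \<le> d" using card_mono[OF _ S(2)] cS by simp
    define b where "b i = (\<Sum>j\<in>S. M j i)" for i
    have b: "0 \<le> b i" "b i \<le> 1" if "i < d" for i
    proof -
      show "0 \<le> b i" using M by (simp add: b_def sum_nonneg)
      show "b i \<le> 1" unfolding b_def col[OF that, symmetric] using S M by (intro sum_mono2) auto
    qed
    have sb: "(\<Sum>i<d. b i) = real (Suc r) * (real d / real (d + 1))"
    proof -
      have "(\<Sum>i<d. b i) = (\<Sum>j\<in>S. \<Sum>i<d. M j i)" unfolding b_def by (rule sum.swap)
      also have "\<dots> = (\<Sum>j\<in>S. real d / real (d + 1))" using S row by (intro sum.cong) auto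
      finally show ?thesis using cS by simp
    qed
    \<comment> \<open>The sum of \<open>b i * \<alpha> i\<close> is to be bounded knowing only that
      the \<open>b i\<close> lie between 0 and 1 and have the total \<open>sb\<close>. That total is
      \<open>r + (d - r) / (d + 1)\<close>, so for the sorted \<open>l\<close> the optimum fills the
      places below \<open>r\<close> and a fraction of place \<open>r\<close>. Hence
      \<open>l r\<close> is the right multiplier; for \<open>r = d\<close> it is 0.\<close>
    define u where "u = l r"
    have "(\<Sum>j\<in>S. \<beta> j) = (\<Sum>j\<in>S. \<Sum>i<d. M j i * \<alpha> i)" using S \<beta> by (intro sum.cong) auto
    also have "\<dots> = (\<Sum>i<d. b i * \<alpha> i)" unfolding b_def by (subst sum.swap) (simp add: sum_distrib_right)
    also have "\<dots> = u * (\<Sum>i<d. b i) + (\<Sum>i<d. b i * (\<alpha> i - u))"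
      by (simp add: algebra_simps sum_subtractf sum_distrib_left)
    also have "(\<Sum>i<d. b i * (\<alpha> i - u)) \<le> excess d \<alpha> u"
      unfolding excess_def
    proof (intro sum_mono)
      fix i assume "i \<in> {..<d}"
      then have "b i * (\<alpha> i - u) \<le> b i * max (\<alpha> i - u) 0" "b i * max (\<alpha> i - u) 0 \<le> 1 * max (\<alpha> i - u) 0"
        using b[of i] by (intro mult_left_mono mult_right_mono; simp)+
      then show "b i * (\<alpha> i - u) \<le> max (\<alpha> i - u) 0" by simp
    qed
    also have "excess d \<alpha> u \<le> excess d l u" by (rule maj)
    also have "excess d l u = (\<Sum>i<r. l i - u)"
      unfolding excess_def
    proof (intro sum.mono_neutral_cong_right)
      have "l i \<le> u" if "r \<le> i" for i using l that by (auto simp: u_def decreasing_def antimono_def)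
      then show "\<forall>i\<in>{..<d} - {..<r}. max (l i - u) 0 = 0" by auto
      show "max (l i - u) 0 = l i - u" if "i \<in> {..<r}" for i
        using l that by (auto simp: u_def decreasing_def antimono_def intro!: max_absorb1)
    qed (use rd in auto)
    also have "u * (\<Sum>i<d. b i) + (\<Sum>i<r. l i - u) = (\<Sum>i<r. l i) + u * (real (Suc r) * (real d / real (d + 1)) - real r)"
      by (simp add: sb sum_subtractf algebra_simps)
    also have "real (Suc r) * (real d / real (d + 1)) - real r = real (d - r) / real (d + 1)"
      using rd by (simp add: field_simps of_nat_diff)
    also have "(\<Sum>i<r. l i) + u * (real (d - r) / real (d + 1)) = (\<Sum>j<Suc r. raise d l j)"
      using sum_raise[OF l rd] by (simp add: u_def)
    finally have "(\<Sum>j\<in>S. \<beta> j) \<le> (\<Sum>j<Suc r. raise d l j)" by simp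
    then have "(\<Sum>j\<in>S. \<beta> j - t) \<le> (\<Sum>j<Suc r. raise d l j - t)"
      using cS by (simp add: sum_subtractf)
    also have "\<dots> \<le> (\<Sum>j<Suc r. max (raise d l j - t) 0)" by (intro sum_mono) auto
    also have "\<dots> \<le> excess (Suc d) (raise d l) t"
      unfolding excess_def using rd by (intro sum_mono2) auto
    finally show ?thesis using lhs by simp
  qed
qed

section \<open>Bosonic creation operators\<close>

lemma mult_add_distrib_mat_dim:
  "dim_col A = dim_row B \<Longrightarrow> dim_row B = dim_row C \<Longrightarrow> dim_col B = dim_col C \<Longrightarrow> A * (B + C) = A * B + A * C"
  for A B C :: "'a::semiring_0 mat"
  by (rule mult_add_distrib_mat[OF carrier_matI carrier_matI carrier_matI]) auto

lemma add_mult_distrib_mat_dim: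
  "dim_row A = dim_row B \<Longrightarrow> dim_col A = dim_col B \<Longrightarrow> dim_col A = dim_row C \<Longrightarrow> (A + B) * C = A * C + B * C"
  for A B C :: "'a::semiring_0 mat"
  by (rule add_mult_distrib_mat[OF carrier_matI carrier_matI carrier_matI]) auto

lemma smult_mult_mat_dim:
  "dim_col A = dim_row B \<Longrightarrow> (c \<cdot>\<^sub>m A) * B = c \<cdot>\<^sub>m (A * B)"
  for A B :: "'a::comm_semiring_0 mat"
  by (rule mult_smult_assoc_mat[OF carrier_matI carrier_matI]) auto

lemma mult_smult_mat_dim:
  "dim_col A = dim_row B \<Longrightarrow> A * (c \<cdot>\<^sub>m B) = c \<cdot>\<^sub>m (A * B)"
  for A B :: "'a::comm_semiring_0 mat"
  by (rule mult_smult_distrib[OF carrier_matI carrier_matI]) auto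

lemma adjoint_mult_dim:
  "dim_col A = dim_row B \<Longrightarrow> mat_adjoint (A * B) = mat_adjoint B * mat_adjoint (A :: complex mat)"
  by (rule mat_adjoint_mult[OF carrier_matI carrier_matI]) auto

lemma adjoint_add_dim:
  "dim_row A = dim_row B \<Longrightarrow> dim_col A = dim_col B \<Longrightarrow>
    mat_adjoint (A + B) = mat_adjoint A + mat_adjoint (B :: complex mat)"
  by (rule mat_adjoint_add[OF carrier_matI carrier_matI]) auto

lemma smult_smult_mat: "a \<cdot>\<^sub>m (b \<cdot>\<^sub>m A) = (a * b) \<cdot>\<^sub>m (A :: 'a :: semigroup_mult mat)"
  by (intro eq_matI) (auto simp: mult.assoc)

lemma smult_one_mat: "1 \<cdot>\<^sub>m A = (A :: 'a :: monoid_mult mat)"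
  by (intro eq_matI) auto

lemmas mat_alg = assoc_mult_mat_dim mult_add_distrib_mat_dim add_mult_distrib_mat_dim
  smult_mult_mat_dim mult_smult_mat_dim adjoint_mult_dim adjoint_add_dim mat_adjoint_smult

text \<open>\<open>creation d p q\<close> is the creation operator \<open>p a\<^sub>1\<^sup>* + q a\<^sub>2\<^sup>*\<close> from the \<open>d - 1\<close> to the \<open>d\<close> particle
  space of two bosonic modes; these spaces have dimensions \<open>d\<close> and \<open>d + 1\<close>, and the \<open>i\<close>-th basis
  vector has \<open>i\<close> particles in the second mode.\<close>

definition nsqrt :: "nat \<Rightarrow> complex" where
  "nsqrt n = complex_of_real (sqrt (real n))"

lemma nsqrt_0 [simp]: "nsqrt 0 = 0"
  by (simp add: nsqrt_def)

lemma cnj_nsqrt [simp]: "cnj (nsqrt n) = nsqrt n"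
  by (simp add: nsqrt_def)

lemma nsqrt_mult_self [simp]: "nsqrt n * nsqrt n = of_nat n" "nsqrt n * (nsqrt n * z) = of_nat n * z"
  by (simp_all add: nsqrt_def mult.assoc[symmetric] flip: of_real_mult)

definition creation :: "nat \<Rightarrow> complex \<Rightarrow> complex \<Rightarrow> complex mat" where
  "creation d p q = Matrix.mat (Suc d) d (\<lambda>(i, j).
     (if j = i then p * nsqrt (d - j) else 0) + (if Suc j = i then q * nsqrt (Suc j) else 0))"

lemma creation_dim [simp]: "dim_row (creation d p q) = Suc d" "dim_col (creation d p q) = d"
  by (simp_all add: creation_def)

lemma creation_carrier [simp]: "creation d p q \<in> carrier_mat (Suc d) d"
  by (simp add: creation_def)

text \<open>In row \<open>i = 0\<close> the index \<open>i - 1\<close> is truncated, but its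
  coefficient contains \<open>nsqrt 0\<close>.\<close>

lemma creation_mult_index:
  assumes X: "dim_row X = d" and i: "i < Suc d" and j: "j < dim_col X"
  shows "(creation d p q * X) $$ (i, j) =
    (if i < d then p * nsqrt (d - i) * X $$ (i, j) else 0) + q * nsqrt i * X $$ (i - 1, j)"
proof -
  have "(creation d p q * X) $$ (i, j) = (\<Sum>k = 0..<d. creation d p q $$ (i, k) * X $$ (k, j))"
    using assms by (simp add: scalar_prod_def)
  also have "\<dots> = (\<Sum>k = 0..<d. (if k = i then p * nsqrt (d - k) * X $$ (k, j) else 0) +
       (if Suc k = i then q * nsqrt (Suc k) * X $$ (k, j) else 0))"
    using i by (intro sum.cong) (auto simp: creation_def)
  also have "\<dots> = (if i < d then p * nsqrt (d - i) * X $$ (i, j) else 0) +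
      (\<Sum>k = 0..<d. if Suc k = i then q * nsqrt (Suc k) * X $$ (k, j) else 0)"
    by (simp add: sum.distrib)
  also have "(\<Sum>k = 0..<d. if Suc k = i then q * nsqrt (Suc k) * X $$ (k, j) else 0) = q * nsqrt i * X $$ (i - 1, j)"
    using i by (cases i) auto
  finally show ?thesis .
qed

lemma adj_creation_mult_index:
  assumes X: "dim_row X = Suc d" and i: "i < d" and j: "j < dim_col X"
  shows "(mat_adjoint (creation d p q) * X) $$ (i, j) =
    cnj p * nsqrt (d - i) * X $$ (i, j) + cnj q * nsqrt (Suc i) * X $$ (Suc i, j)"
proof -
  have "(mat_adjoint (creation d p q) * X) $$ (i, j) = (\<Sum>k = 0..<Suc d. cnj (creation d p q $$ (k, i)) * X $$ (k, j))"
    using assms by (simp add: scalar_prod_def del: sum.op_ivl_Suc)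
  also have "\<dots> = (\<Sum>k = 0..<Suc d. (if k = i then cnj p * nsqrt (d - i) * X $$ (k, j) else 0) +
       (if k = Suc i then cnj q * nsqrt (Suc i) * X $$ (k, j) else 0))"
    using i by (intro sum.cong) (auto simp: creation_def)
  also have "\<dots> = cnj p * nsqrt (d - i) * X $$ (i, j) + cnj q * nsqrt (Suc i) * X $$ (Suc i, j)"
    using i by (simp add: sum.distrib del: sum.op_ivl_Suc)
  finally show ?thesis .
qed

lemma mult_creation_index:
  assumes X: "dim_col X = Suc d" and i: "i < dim_row X" and j: "j < d"
  shows "(X * creation d p q) $$ (i, j) = p * nsqrt (d - j) * X $$ (i, j) + q * nsqrt (Suc j) * X $$ (i, Suc j)"
proof -
  have "X * creation d p q = mat_adjoint (mat_adjoint (creation d p q) * mat_adjoint X)"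
    using X by (simp add: mat_alg)
  then show ?thesis using assms by (simp add: adj_creation_mult_index del: index_mult_mat(1))
qed

lemma mult_adj_creation_index:
  assumes X: "dim_col X = d" and i: "i < dim_row X" and j: "j < Suc d"
  shows "(X * mat_adjoint (creation d p q)) $$ (i, j) =
    (if j < d then cnj p * nsqrt (d - j) * X $$ (i, j) else 0) + cnj q * nsqrt j * X $$ (i, j - 1)"
proof -
  have "X * mat_adjoint (creation d p q) = mat_adjoint (creation d p q * mat_adjoint X)"
    using X by (simp add: mat_alg)
  then show ?thesis using assms
    by (cases j) (simp_all add: creation_mult_index del: index_mult_mat(1))
qed

text \<open>The canonical commutation relation, with the inner product of the two spinors as scalar.
  The two orders of the product pass through different particle numbers, hence the different indices
  of \<open>creation\<close>.\<close>

lemma ccr: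
  "mat_adjoint (creation (Suc d) p q) * creation (Suc d) p' q' =
    (cnj p * p' + cnj q * q') \<cdot>\<^sub>m 1\<^sub>m (Suc d) + creation d p' q' * mat_adjoint (creation d p q)"
proof (rule eq_matI)
  fix i j assume "i < dim_row ((cnj p * p' + cnj q * q') \<cdot>\<^sub>m 1\<^sub>m (Suc d) + creation d p' q' * mat_adjoint (creation d p q))"
    "j < dim_col ((cnj p * p' + cnj q * q') \<cdot>\<^sub>m 1\<^sub>m (Suc d) + creation d p' q' * mat_adjoint (creation d p q))"
  then have i: "i < Suc d" and j: "j < Suc d" by auto
  have "(mat_adjoint (creation (Suc d) p q) * creation (Suc d) p' q') $$ (i, j) =
      (cnj p * p' + cnj q * q') * 1\<^sub>m (Suc d) $$ (i, j) + (creation d p' q' * mat_adjoint (creation d p q)) $$ (i, j)"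
  proof -
    obtain e where e: "d = j + e" using j by (metis less_Suc_eq_le le_Suc_ex)
    show ?thesis
      using i j
      by (simp add: adj_creation_mult_index creation_mult_index del: index_mult_mat(1))
        (cases i; cases e; auto simp: e creation_def algebra_simps Suc_diff_le)
  qed
  then show "(mat_adjoint (creation (Suc d) p q) * creation (Suc d) p' q') $$ (i, j) =
    ((cnj p * p' + cnj q * q') \<cdot>\<^sub>m 1\<^sub>m (Suc d) + creation d p' q' * mat_adjoint (creation d p q)) $$ (i, j)"
    using i j by simp
qed auto

lemma creation_commute: "creation (Suc d) p q * creation d p' q' = creation (Suc d) p' q' * creation d p q"
proof (rule eq_matI)
  fix i j assume "i < dim_row (creation (Suc d) p' q' * creation d p q)" "j < dim_col (creation (Suc d) p' q' * creation d p q)"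
  then have i: "i < Suc (Suc d)" and j: "j < d" by auto
  obtain e where e: "d = Suc (j + e)" using less_imp_Suc_add[OF j] by auto
  show "(creation (Suc d) p q * creation d p' q') $$ (i, j) = (creation (Suc d) p' q' * creation d p q) $$ (i, j)"
    using i j
    by (simp add: creation_mult_index del: index_mult_mat(1))
      (cases i; auto simp: e creation_def algebra_simps Suc_diff_le)
qed auto

abbreviation creation1 :: "nat \<Rightarrow> complex mat" where "creation1 d \<equiv> creation d 1 0"
abbreviation creation2 :: "nat \<Rightarrow> complex mat" where "creation2 d \<equiv> creation d 0 1"

lemma number_op: "creation1 d * mat_adjoint (creation1 d) + creation2 d * mat_adjoint (creation2 d) = of_nat d \<cdot>\<^sub>m 1\<^sub>m (Suc d)"
proof (rule eq_matI)
  fix i j assume "i < dim_row (of_nat d \<cdot>\<^sub>m 1\<^sub>m (Suc d) :: complex mat)" "j < dim_col (of_nat d \<cdot>\<^sub>m 1\<^sub>m (Suc d) :: complex mat)"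
  then show "(creation1 d * mat_adjoint (creation1 d) + creation2 d * mat_adjoint (creation2 d)) $$ (i, j) = (of_nat d \<cdot>\<^sub>m 1\<^sub>m (Suc d)) $$ (i, j)"
    by (simp add: creation_mult_index del: index_mult_mat(1))
      (cases i; auto simp: creation_def of_nat_diff)
qed auto

text \<open>On the space of dimension \<open>d\<close> the particle number is \<open>d - 1\<close>,
  and normal ordering adds 1 for each of the two modes.\<close>

lemma number_op': "mat_adjoint (creation1 d) * creation1 d + mat_adjoint (creation2 d) * creation2 d = of_nat (Suc d) \<cdot>\<^sub>m 1\<^sub>m d"
proof (rule eq_matI)
  fix i j assume "i < dim_row (of_nat (Suc d) \<cdot>\<^sub>m 1\<^sub>m d :: complex mat)" "j < dim_col (of_nat (Suc d) \<cdot>\<^sub>m 1\<^sub>m d :: complex mat)"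
  then show "(mat_adjoint (creation1 d) * creation1 d + mat_adjoint (creation2 d) * creation2 d) $$ (i, j) = (of_nat (Suc d) \<cdot>\<^sub>m 1\<^sub>m d) $$ (i, j)"
    by (simp add: adj_creation_mult_index del: index_mult_mat(1))
      (auto simp: creation_def of_nat_diff)
qed auto

lemma creation_conj_index:
  assumes X: "X \<in> carrier_mat d d" and i: "i < Suc d" and j: "j < Suc d"
  shows "(creation d p q * X * mat_adjoint (creation d p q)) $$ (i, j) =
    p * cnj p * (if i < d \<and> j < d then nsqrt (d - i) * nsqrt (d - j) * X $$ (i, j) else 0) +
    p * cnj q * (if i < d then nsqrt (d - i) * nsqrt j * X $$ (i, j - 1) else 0) +
    q * cnj p * (if j < d then nsqrt i * nsqrt (d - j) * X $$ (i - 1, j) else 0) +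
    q * cnj q * (nsqrt i * nsqrt j * X $$ (i - 1, j - 1))"
proof (cases "j = 0")
  case True
  then show ?thesis using assms
    by (simp add: creation_mult_index mult_adj_creation_index algebra_simps del: index_mult_mat(1))
next
  case False
  then have "j - 1 < d" using j by simp
  then show ?thesis using assms
    by (simp add: creation_mult_index mult_adj_creation_index algebra_simps del: index_mult_mat(1))
qed

lemma adj_creation_conj_index:
  assumes X: "X \<in> carrier_mat (Suc d) (Suc d)" and i: "i < d" and j: "j < d"
  shows "(mat_adjoint (creation d p q) * X * creation d p q) $$ (i, j) =
    p * cnj p * (nsqrt (d - i) * nsqrt (d - j) * X $$ (i, j)) +
    q * cnj p * (nsqrt (d - i) * nsqrt (Suc j) * X $$ (i, Suc j)) +
    p * cnj q * (nsqrt (Suc i) * nsqrt (d - j) * X $$ (Suc i, j)) +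
    q * cnj q * (nsqrt (Suc i) * nsqrt (Suc j) * X $$ (Suc i, Suc j))"
  using assms by (simp add: adj_creation_mult_index mult_creation_index algebra_simps del: index_mult_mat(1))

section \<open>Rotations of the two modes\<close>

lemma rotate_aux:
  fixes p q :: complex
  assumes "p * cnj p + q * cnj q = 1"
  shows "(p * cnj p * A + p * cnj q * B + q * cnj p * C + q * cnj q * D) +
    ((- cnj q) * cnj (- cnj q) * A + (- cnj q) * cnj (cnj p) * B + cnj p * cnj (- cnj q) * C + cnj p * cnj (cnj p) * D)
    = A + D"
proof -
  have "(p * cnj p * A + p * cnj q * B + q * cnj p * C + q * cnj q * D) +
    ((- cnj q) * cnj (- cnj q) * A + (- cnj q) * cnj (cnj p) * B + cnj p * cnj (- cnj q) * C + cnj p * cnj (cnj p) * D)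
    = (p * cnj p + q * cnj q) * (A + D)"
    by (simp add: algebra_simps)
  then show ?thesis using assms by simp
qed

text \<open>Kraus operators that differ by a unitary matrix of coefficients define the same map;
  here the rows of this matrix are \<open>(p, q)\<close> and
  \<open>(- cnj q, cnj p)\<close>.\<close>

lemma creation_kraus_rotate:
  assumes X: "X \<in> carrier_mat d d" and pq: "p * cnj p + q * cnj q = 1"
  shows "creation d p q * X * mat_adjoint (creation d p q) + creation d (- cnj q) (cnj p) * X * mat_adjoint (creation d (- cnj q) (cnj p))
    = creation1 d * X * mat_adjoint (creation1 d) + creation2 d * X * mat_adjoint (creation2 d)" (is "?L = ?R")
proof (rule eq_matI)
  fix i j assume "i < dim_row ?R" "j < dim_col ?R"
  then have i: "i < Suc d" and j: "j < Suc d" by auto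
  show "?L $$ (i, j) = ?R $$ (i, j)"
    using i j rotate_aux[OF pq]
    by (simp add: creation_conj_index[OF X i j] del: index_mult_mat(1) complex_cnj_minus complex_cnj_cnj)
qed (use X in auto)

lemma adj_creation_kraus_rotate:
  assumes X: "X \<in> carrier_mat (Suc d) (Suc d)" and pq: "p * cnj p + q * cnj q = 1"
  shows "mat_adjoint (creation d p q) * X * creation d p q + mat_adjoint (creation d (- cnj q) (cnj p)) * X * creation d (- cnj q) (cnj p)
    = mat_adjoint (creation1 d) * X * creation1 d + mat_adjoint (creation2 d) * X * creation2 d" (is "?L = ?R")
proof (rule eq_matI)
  fix i j assume "i < dim_row ?R" "j < dim_col ?R"
  then have i: "i < d" and j: "j < d" by auto
  have pq': "q * cnj q + p * cnj p = 1" using pq by (simp add: add.commute)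
  show "?L $$ (i, j) = ?R $$ (i, j)"
    using i j rotate_aux[OF pq, of "nsqrt (d - i) * nsqrt (d - j) * X $$ (i, j)" "nsqrt (Suc i) * nsqrt (d - j) * X $$ (Suc i, j)"
        "nsqrt (d - i) * nsqrt (Suc j) * X $$ (i, Suc j)" "nsqrt (Suc i) * nsqrt (Suc j) * X $$ (Suc i, Suc j)"]
    by (simp add: adj_creation_conj_index[OF X i j] algebra_simps del: index_mult_mat(1) complex_cnj_minus complex_cnj_cnj)
qed (use X in auto)

text \<open>The normalisations of \<open>up\<close> and \<open>down\<close> preserve the trace: by
  cyclicity the unnormalised maps multiply it by the scalars of \<open>number_op'\<close> and
  \<open>number_op\<close>, respectively.\<close>

definition up :: "nat \<Rightarrow> complex mat \<Rightarrow> complex mat" where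
  "up d X = (1 / of_nat (Suc d)) \<cdot>\<^sub>m (creation1 d * X * mat_adjoint (creation1 d) + creation2 d * X * mat_adjoint (creation2 d))"

definition down :: "nat \<Rightarrow> complex mat \<Rightarrow> complex mat" where
  "down d X = (1 / of_nat d) \<cdot>\<^sub>m (mat_adjoint (creation1 d) * X * creation1 d + mat_adjoint (creation2 d) * X * creation2 d)"

lemma up_carrier [simp]: "up d X \<in> carrier_mat (Suc d) (Suc d)"
  by (intro carrier_matI) (simp_all add: up_def)

lemma down_carrier [simp]: "down d X \<in> carrier_mat d d"
  by (intro carrier_matI) (simp_all add: down_def)

lemma up_dim [simp]: "dim_row (up d X) = Suc d" "dim_col (up d X) = Suc d"
  using up_carrier[of d X] by (auto simp del: up_carrier)

lemma down_dim [simp]: "dim_row (down d X) = d" "dim_col (down d X) = d"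
  using down_carrier[of d X] by (auto simp del: down_carrier)

lemma up_index:
  assumes "X \<in> carrier_mat d d" "i < Suc d" "j < Suc d"
  shows "up d X $$ (i, j) = ((if i < d \<and> j < d then nsqrt (d - i) * nsqrt (d - j) * X $$ (i, j) else 0) +
    nsqrt i * nsqrt j * X $$ (i - 1, j - 1)) / of_nat (Suc d)"
  using assms by (simp add: up_def creation_conj_index del: index_mult_mat(1))

lemma down_index:
  assumes "X \<in> carrier_mat (Suc d) (Suc d)" "i < d" "j < d"
  shows "down d X $$ (i, j) = (nsqrt (d - i) * nsqrt (d - j) * X $$ (i, j) +
    nsqrt (Suc i) * nsqrt (Suc j) * X $$ (Suc i, Suc j)) / of_nat d"
  using assms by (simp add: down_def adj_creation_conj_index del: index_mult_mat(1))

text \<open>The unitary \<open>U\<close> with \<open>U a\<^sub>i\<^sup>* = b\<^sub>i\<^sup>* U\<close> for the rotated modes \<open>b\<^sub>1\<^sup>* = p a\<^sub>1\<^sup>* + q a\<^sub>2\<^sup>*\<close>,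
  \<open>b\<^sub>2\<^sup>* = - q\<^sup>* a\<^sub>1\<^sup>* + p\<^sup>* a\<^sub>2\<^sup>*\<close>. Multiplying by \<open>a\<^sub>i\<close> and summing, where \<open>\<Sum>a\<^sub>i\<^sup>* a\<^sub>i\<close> is the particle
  number, gives the recursion.\<close>

fun mode_rot :: "complex \<Rightarrow> complex \<Rightarrow> nat \<Rightarrow> complex mat" where
  "mode_rot p q 0 = 1\<^sub>m 0"
| "mode_rot p q (Suc d) = (if d = 0 then 1\<^sub>m 1 else
     (1 / of_nat d) \<cdot>\<^sub>m (creation d p q * mode_rot p q d * mat_adjoint (creation1 d) +
       creation d (- cnj q) (cnj p) * mode_rot p q d * mat_adjoint (creation2 d)))"

lemma mode_rot_dim [simp]: "dim_row (mode_rot p q d) = d" "dim_col (mode_rot p q d) = d"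
  by (cases d; simp)+

lemma mode_rot_step:
  "creation d p q * mode_rot p q d * mat_adjoint (creation1 d) + creation d (- cnj q) (cnj p) * mode_rot p q d * mat_adjoint (creation2 d)
    = of_nat d \<cdot>\<^sub>m mode_rot p q (Suc d)"
  by (cases "d = 0") (auto simp: smult_smult_mat smult_one_mat scalar_prod_def intro!: eq_matI)

declare mode_rot.simps(2) [simp del]

lemma average_mat: "(1 / of_nat (Suc d)) \<cdot>\<^sub>m (X + of_nat d \<cdot>\<^sub>m X) = (X :: complex mat)"
proof (rule eq_matI)
  fix i j assume ij: "i < dim_row X" "j < dim_col X"
  have "X $$ (i, j) + of_nat d * X $$ (i, j) = of_nat (Suc d) * X $$ (i, j)" by (simp add: algebra_simps)
  then show "((1 / of_nat (Suc d)) \<cdot>\<^sub>m (X + of_nat d \<cdot>\<^sub>m X)) $$ (i, j) = X $$ (i, j)"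
    using ij by (simp del: of_nat_Suc)
qed auto

text \<open>The arguments of the rotated creator are the coefficients of \<open>r\<close> times the
  first plus \<open>s\<close> times the second rotated mode. Moving the annihilators in the
  recursion past \<open>creation (Suc d) r s\<close> leaves a scalar part, which sums to the desired
  right-hand side, and a part in which the assumption and commutativity of the creators pull the
  rotated creator to the left. What it then multiplies is the recursion one level below, which gives
  \<open>d\<close> more copies of the right-hand side.\<close>

lemma mode_rot_intertwine_aux:
  assumes I: "\<And>r s. mode_rot p q (Suc d) * creation d r s = creation d (r * p - s * cnj q) (r * q + s * cnj p) * mode_rot p q d"
  shows "mode_rot p q (Suc (Suc d)) * creation (Suc d) r s =
    creation (Suc d) (r * p - s * cnj q) (r * q + s * cnj p) * mode_rot p q (Suc d)"
proof -
  let ?R = "mode_rot p q (Suc d)" and ?B1 = "creation (Suc d) p q" and ?B2 = "creation (Suc d) (- cnj q) (cnj p)"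
  let ?B = "\<lambda>d. creation d (r * p - s * cnj q) (r * q + s * cnj p)"
  have I': "?R * (creation d r s * Y) = ?B d * (mode_rot p q d * Y)" if "dim_row Y = d" for Y
    using I[of r s] that by (metis assoc_mult_mat_dim creation_dim(1,2) mode_rot_dim(1,2))
  have comm: "?B1 * (?B d * Y) = ?B (Suc d) * (creation d p q * Y)"
    "?B2 * (?B d * Y) = ?B (Suc d) * (creation d (- cnj q) (cnj p) * Y)" if "dim_row Y = d" for Y
    using creation_commute[of d] that by (metis assoc_mult_mat_dim creation_dim(1,2))+
  have "mode_rot p q (Suc (Suc d)) * creation (Suc d) r s = (1 / of_nat (Suc d)) \<cdot>\<^sub>m
      (?B1 * (?R * (mat_adjoint (creation1 (Suc d)) * creation (Suc d) r s)) +
       ?B2 * (?R * (mat_adjoint (creation2 (Suc d)) * creation (Suc d) r s)))"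
    by (subst mode_rot.simps(2)) (simp add: mat_alg)
  also have "\<dots> = (1 / of_nat (Suc d)) \<cdot>\<^sub>m
      ((r \<cdot>\<^sub>m (?B1 * ?R) + ?B1 * (?R * (creation d r s * mat_adjoint (creation1 d)))) +
       (s \<cdot>\<^sub>m (?B2 * ?R) + ?B2 * (?R * (creation d r s * mat_adjoint (creation2 d)))))"
    unfolding ccr by (simp add: mat_alg)
  also have "\<dots> = (1 / of_nat (Suc d)) \<cdot>\<^sub>m
      ((r \<cdot>\<^sub>m (?B1 * ?R) + ?B (Suc d) * (creation d p q * mode_rot p q d * mat_adjoint (creation1 d))) +
       (s \<cdot>\<^sub>m (?B2 * ?R) + ?B (Suc d) * (creation d (- cnj q) (cnj p) * mode_rot p q d * mat_adjoint (creation2 d))))"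
    by (simp add: I' comm mat_alg)
  also have "\<dots> = (1 / of_nat (Suc d)) \<cdot>\<^sub>m
      ((r \<cdot>\<^sub>m (?B1 * ?R) + s \<cdot>\<^sub>m (?B2 * ?R)) + ?B (Suc d) *
       (creation d p q * mode_rot p q d * mat_adjoint (creation1 d) + creation d (- cnj q) (cnj p) * mode_rot p q d * mat_adjoint (creation2 d)))"
    by (subst mult_add_distrib_mat_dim) (auto simp del: index_mult_mat(1) intro!: eq_matI)
  also have "\<dots> = (1 / of_nat (Suc d)) \<cdot>\<^sub>m (?B (Suc d) * ?R + of_nat d \<cdot>\<^sub>m (?B (Suc d) * ?R))"
  proof -
    have "r \<cdot>\<^sub>m ?B1 + s \<cdot>\<^sub>m ?B2 = ?B (Suc d)"
      by (intro eq_matI) (auto simp: creation_def algebra_simps)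
    moreover have "r \<cdot>\<^sub>m (?B1 * ?R) + s \<cdot>\<^sub>m (?B2 * ?R) = (r \<cdot>\<^sub>m ?B1 + s \<cdot>\<^sub>m ?B2) * ?R"
      by (simp add: mat_alg)
    ultimately show ?thesis unfolding mode_rot_step by (simp add: mat_alg)
  qed
  also have "\<dots> = ?B (Suc d) * ?R"
    by (rule average_mat)
  finally show ?thesis .
qed

lemma mode_rot_intertwine:
  "mode_rot p q (Suc d) * creation d r s = creation d (r * p - s * cnj q) (r * q + s * cnj p) * mode_rot p q d"
proof (induction d arbitrary: r s)
  case 0
  then show ?case by (intro eq_matI) auto
next
  case (Suc d)
  show ?case by (rule mode_rot_intertwine_aux) (rule Suc)
qed

text \<open>Passing to this form from \<open>mode_rot_intertwine\<close> would use unitarity of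
  \<open>mode_rot\<close>, which is itself derived from the present lemma; so it has its own
  induction. Normalisation of \<open>(p, q)\<close> enters through \<open>e1\<close> and
  \<open>e2\<close>, the inner products of the rotated spinors.\<close>

lemma adj_mode_rot_intertwine:
  assumes pq: "p * cnj p + q * cnj q = 1"
  shows "mat_adjoint (creation d (r * p - s * cnj q) (r * q + s * cnj p)) * mode_rot p q (Suc d) = mode_rot p q d * mat_adjoint (creation d r s)"
proof (induction d arbitrary: r s)
  case 0
  then show ?case by (intro eq_matI) auto
next
  case (Suc d)
  let ?R = "mode_rot p q (Suc d)" and ?B1 = "creation d p q" and ?B2 = "creation d (- cnj q) (cnj p)"
  let ?B = "\<lambda>d. creation d (r * p - s * cnj q) (r * q + s * cnj p)"
  let ?c = "creation d r s"
  have I': "mat_adjoint (?B d) * (?R * Y) = mode_rot p q d * (mat_adjoint ?c * Y)" if "dim_row Y = Suc d" for Y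
    using Suc.IH[of r s] that by (metis assoc_mult_mat_dim creation_dim(1,2) dim_mat_adjoint mode_rot_dim(1,2))
  have e1: "cnj (r * p - s * cnj q) * p + cnj (r * q + s * cnj p) * q = cnj r"
  proof -
    have "cnj (r * p - s * cnj q) * p + cnj (r * q + s * cnj p) * q = cnj r * (p * cnj p + q * cnj q)"
      by (simp add: algebra_simps)
    then show ?thesis using pq by simp
  qed
  have e2: "cnj (r * p - s * cnj q) * (- cnj q) + cnj (r * q + s * cnj p) * cnj p = cnj s"
  proof -
    have "cnj (r * p - s * cnj q) * (- cnj q) + cnj (r * q + s * cnj p) * cnj p = cnj s * (p * cnj p + q * cnj q)"
      by (simp add: algebra_simps)
    then show ?thesis using pq by simp
  qed
  have cc: "mat_adjoint ?c * mat_adjoint (creation1 (Suc d)) = mat_adjoint (creation1 d) * mat_adjoint (creation (Suc d) r s)"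
    "mat_adjoint ?c * mat_adjoint (creation2 (Suc d)) = mat_adjoint (creation2 d) * mat_adjoint (creation (Suc d) r s)"
    using arg_cong[OF creation_commute[of d 1 0 r s], of mat_adjoint] arg_cong[OF creation_commute[of d 0 1 r s], of mat_adjoint]
    by (simp_all add: adjoint_mult_dim)
  have "mat_adjoint (?B (Suc d)) * mode_rot p q (Suc (Suc d)) = (1 / of_nat (Suc d)) \<cdot>\<^sub>m
      ((mat_adjoint (?B (Suc d)) * creation (Suc d) p q) * (?R * mat_adjoint (creation1 (Suc d))) +
       (mat_adjoint (?B (Suc d)) * creation (Suc d) (- cnj q) (cnj p)) * (?R * mat_adjoint (creation2 (Suc d))))"
    by (subst mode_rot.simps(2)) (simp add: mat_alg)
  also have "\<dots> = (1 / of_nat (Suc d)) \<cdot>\<^sub>m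
      ((cnj r \<cdot>\<^sub>m (?R * mat_adjoint (creation1 (Suc d))) + ?B1 * (mat_adjoint (?B d) * (?R * mat_adjoint (creation1 (Suc d))))) +
       (cnj s \<cdot>\<^sub>m (?R * mat_adjoint (creation2 (Suc d))) + ?B2 * (mat_adjoint (?B d) * (?R * mat_adjoint (creation2 (Suc d))))))"
    unfolding ccr e1 e2 by (simp add: mat_alg)
  also have "\<dots> = (1 / of_nat (Suc d)) \<cdot>\<^sub>m
      ((cnj r \<cdot>\<^sub>m (?R * mat_adjoint (creation1 (Suc d))) + ?B1 * mode_rot p q d * mat_adjoint (creation1 d) * mat_adjoint (creation (Suc d) r s)) +
       (cnj s \<cdot>\<^sub>m (?R * mat_adjoint (creation2 (Suc d))) + ?B2 * mode_rot p q d * mat_adjoint (creation2 d) * mat_adjoint (creation (Suc d) r s)))"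
    by (simp add: I' cc mat_alg)
  also have "\<dots> = (1 / of_nat (Suc d)) \<cdot>\<^sub>m
      ((cnj r \<cdot>\<^sub>m (?R * mat_adjoint (creation1 (Suc d))) + cnj s \<cdot>\<^sub>m (?R * mat_adjoint (creation2 (Suc d)))) +
       (?B1 * mode_rot p q d * mat_adjoint (creation1 d) + ?B2 * mode_rot p q d * mat_adjoint (creation2 d)) * mat_adjoint (creation (Suc d) r s))"
    by (subst add_mult_distrib_mat_dim) (auto simp del: index_mult_mat(1) intro!: eq_matI)
  also have "\<dots> = (1 / of_nat (Suc d)) \<cdot>\<^sub>m
      (?R * mat_adjoint (creation (Suc d) r s) + of_nat d \<cdot>\<^sub>m (?R * mat_adjoint (creation (Suc d) r s)))"
  proof -
    have "cnj r \<cdot>\<^sub>m mat_adjoint (creation1 (Suc d)) + cnj s \<cdot>\<^sub>m mat_adjoint (creation2 (Suc d)) = mat_adjoint (creation (Suc d) r s)"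
      by (intro eq_matI) (auto simp: creation_def algebra_simps)
    moreover have "cnj r \<cdot>\<^sub>m (?R * mat_adjoint (creation1 (Suc d))) + cnj s \<cdot>\<^sub>m (?R * mat_adjoint (creation2 (Suc d)))
        = ?R * (cnj r \<cdot>\<^sub>m mat_adjoint (creation1 (Suc d)) + cnj s \<cdot>\<^sub>m mat_adjoint (creation2 (Suc d)))"
      by (simp add: mat_alg)
    ultimately show ?thesis unfolding mode_rot_step by (simp add: mat_alg)
  qed
  also have "\<dots> = ?R * mat_adjoint (creation (Suc d) r s)"
    by (rule average_mat)
  finally show ?case .
qed

lemmas mode_rot_intertwine12 =
  mode_rot_intertwine[of _ _ _ 1 0, simplified] mode_rot_intertwine[of _ _ _ 0 1, simplified]

lemmas adj_mode_rot_intertwine12 =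
  adj_mode_rot_intertwine[of _ _ _ 1 0, simplified] adj_mode_rot_intertwine[of _ _ _ 0 1, simplified]

text \<open>Expanding only the left factor of \<open>mat_adjoint ?R * ?R\<close> by the recursion
  lets the rotated annihilators act on \<open>?R\<close>; they pass through it as the original ones.
  With unitarity one level below, what is left is the number operator divided by
  \<open>d\<close>.\<close>

lemma unitary_mode_rot:
  assumes pq: "p * cnj p + q * cnj q = 1"
  shows "unitary_mat d (mode_rot p q d)"
proof (induction d)
  case 0
  then show ?case by (simp add: unitary_mat_one)
next
  case (Suc d)
  let ?R = "mode_rot p q (Suc d)" and ?Q = "mode_rot p q d"
  show ?case
  proof (cases "d = 0")
    case True
    then show ?thesis by (simp add: unitary_mat_one mode_rot.simps(2))
  next
    case False
    have U: "mat_adjoint ?Q * (?Q * Y) = Y" if "dim_row Y = d" for Y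
      using unitary_matD(2)[OF Suc.IH] that
      by (metis assoc_mult_mat_dim carrier_matI dim_mat_adjoint(2) left_mult_one_mat mode_rot_dim(1,2))
    have R: "?R = (1 / of_nat d) \<cdot>\<^sub>m (creation d p q * ?Q * mat_adjoint (creation1 d) + creation d (- cnj q) (cnj p) * ?Q * mat_adjoint (creation2 d))"
      using False by (simp add: mode_rot.simps(2))
    have "mat_adjoint ?R * ?R = (1 / of_nat d) \<cdot>\<^sub>m (creation1 d * (mat_adjoint ?Q * (mat_adjoint (creation d p q) * ?R)) +
        creation2 d * (mat_adjoint ?Q * (mat_adjoint (creation d (- cnj q) (cnj p)) * ?R)))"
      by (subst (1) R) (simp add: mat_alg)
    also have "\<dots> = (1 / of_nat d) \<cdot>\<^sub>m (creation1 d * mat_adjoint (creation1 d) + creation2 d * mat_adjoint (creation2 d))"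
      by (simp add: adj_mode_rot_intertwine12[OF pq] U)
    also have "\<dots> = 1\<^sub>m (Suc d)"
      using False by (simp add: number_op smult_smult_mat smult_one_mat)
    finally show ?thesis unfolding unitary_mat_def using mode_rot_dim by (metis carrier_matI)
  qed
qed

text \<open>Covariance: the map may be written with the rotated Kraus operators, and each of them is
  carried to an original one by the intertwining relation.\<close>

lemma up_mode_rot:
  assumes pq: "p * cnj p + q * cnj q = 1" and X: "X \<in> carrier_mat d d"
  shows "up d (mode_rot p q d * X * mat_adjoint (mode_rot p q d)) =
    mode_rot p q (Suc d) * up d X * mat_adjoint (mode_rot p q (Suc d))"
proof -
  let ?R = "mode_rot p q (Suc d)" and ?Q = "mode_rot p q d"
  note dims = carrier_matD[OF X]
  have A: "creation d p q * ?Q * X * mat_adjoint (creation d p q * ?Q) = ?R * (creation1 d * X * mat_adjoint (creation1 d)) * mat_adjoint ?R"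
    unfolding mode_rot_intertwine12(1)[symmetric] using dims by (simp add: mat_alg)
  have B: "creation d (- cnj q) (cnj p) * ?Q * X * mat_adjoint (creation d (- cnj q) (cnj p) * ?Q) = ?R * (creation2 d * X * mat_adjoint (creation2 d)) * mat_adjoint ?R"
    unfolding mode_rot_intertwine12(2)[symmetric] using dims by (simp add: mat_alg)
  have Y: "?Q * X * mat_adjoint ?Q \<in> carrier_mat d d" by (intro carrier_matI) auto
  have "up d (?Q * X * mat_adjoint ?Q) = (1 / of_nat (Suc d)) \<cdot>\<^sub>m
     (creation d p q * ?Q * X * mat_adjoint (creation d p q * ?Q) +
      creation d (- cnj q) (cnj p) * ?Q * X * mat_adjoint (creation d (- cnj q) (cnj p) * ?Q))"
    unfolding up_def creation_kraus_rotate[OF Y pq, symmetric] using dims by (simp add: mat_alg)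
  then show ?thesis unfolding A B up_def using dims by (simp add: mat_alg)
qed

lemma down_mode_rot:
  assumes pq: "p * cnj p + q * cnj q = 1" and X: "X \<in> carrier_mat (Suc d) (Suc d)"
  shows "down d (mode_rot p q (Suc d) * X * mat_adjoint (mode_rot p q (Suc d))) =
    mode_rot p q d * down d X * mat_adjoint (mode_rot p q d)"
proof -
  let ?R = "mode_rot p q (Suc d)" and ?Q = "mode_rot p q d"
  note dims = carrier_matD[OF X]
  note I = adj_mode_rot_intertwine12[OF pq, of d]
  have A: "mat_adjoint (creation d p q) * ?R * X * mat_adjoint (mat_adjoint (creation d p q) * ?R) = ?Q * (mat_adjoint (creation1 d) * X * creation1 d) * mat_adjoint ?Q"
    unfolding I using dims by (simp add: mat_alg)
  have B: "mat_adjoint (creation d (- cnj q) (cnj p)) * ?R * X * mat_adjoint (mat_adjoint (creation d (- cnj q) (cnj p)) * ?R) = ?Q * (mat_adjoint (creation2 d) * X * creation2 d) * mat_adjoint ?Q"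
    unfolding I using dims by (simp add: mat_alg)
  have Y: "?R * X * mat_adjoint ?R \<in> carrier_mat (Suc d) (Suc d)"
    using mode_rot_dim by (intro carrier_matI) auto
  have "down d (?R * X * mat_adjoint ?R) = (1 / of_nat d) \<cdot>\<^sub>m
     (mat_adjoint (creation d p q) * ?R * X * mat_adjoint (mat_adjoint (creation d p q) * ?R) +
      mat_adjoint (creation d (- cnj q) (cnj p)) * ?R * X * mat_adjoint (mat_adjoint (creation d (- cnj q) (cnj p)) * ?R))"
    unfolding down_def adj_creation_kraus_rotate[OF Y pq, symmetric] using dims by (simp add: mat_alg)
  then show ?thesis unfolding A B down_def using dims by (simp add: mat_alg)
qed

section \<open>Majorization along the channels\<close>

lemma mat_mult_diag_adj_index:
  assumes A: "A \<in> carrier_mat m n" and j: "j < m"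
  shows "(A * mat_diag n (\<lambda>i. complex_of_real (x i)) * mat_adjoint A) $$ (j, j) =
    complex_of_real (\<Sum>i<n. (cmod (A $$ (j, i)))\<^sup>2 * x i)"
proof -
  have "(A * mat_diag n (\<lambda>i. complex_of_real (x i)) * mat_adjoint A) $$ (j, j) =
      (\<Sum>i<n. A $$ (j, i) * x i * cnj (A $$ (j, i)))"
    using assms by (auto simp: mat_diag_mult_right[OF A] scalar_prod_def atLeast0LessThan)
  also have "\<dots> = (\<Sum>i<n. complex_of_real ((cmod (A $$ (j, i)))\<^sup>2 * x i))"
    by (intro sum.cong refl) (simp only: of_real_mult complex_norm_square ac_simps)
  finally show ?thesis by simp
qed

lemma mat_mult_adj_index:
  assumes A: "A \<in> carrier_mat m n" and j: "j < m"
  shows "(A * mat_adjoint A) $$ (j, j) = complex_of_real (\<Sum>i<n. (cmod (A $$ (j, i)))\<^sup>2)"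
  using mat_mult_diag_adj_index[OF assms, of "\<lambda>_. 1"] A by simp

lemma adj_mult_mat_index:
  assumes A: "A \<in> carrier_mat m n" and i: "i < n"
  shows "(mat_adjoint A * A) $$ (i, i) = complex_of_real (\<Sum>j<m. (cmod (A $$ (j, i)))\<^sup>2)"
proof -
  have "(mat_adjoint A * mat_adjoint (mat_adjoint A)) $$ (i, i) =
      complex_of_real (\<Sum>j<m. (cmod (mat_adjoint A $$ (i, j)))\<^sup>2)"
    by (rule mat_mult_adj_index[OF mat_adjoint_carrier[OF A] i])
  also have "(\<Sum>j<m. (cmod (mat_adjoint A $$ (i, j)))\<^sup>2) = (\<Sum>j<m. (cmod (A $$ (j, i)))\<^sup>2)"
    using A i by (intro sum.cong) auto
  finally show ?thesis by simp
qed

lemma hermitian_add: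
  "hermitian_mat n A \<Longrightarrow> hermitian_mat n B \<Longrightarrow> hermitian_mat n (A + B)"
  by (auto simp: hermitian_mat_def mat_adjoint_add)

lemma hermitian_smult:
  "hermitian_mat n A \<Longrightarrow> hermitian_mat n (complex_of_real c \<cdot>\<^sub>m A)"
  by (auto simp: hermitian_mat_def mat_adjoint_smult)

lemma hermitian_up: 
  assumes "hermitian_mat d X" shows "hermitian_mat (Suc d) (up d X)"
  using hermitian_conj[OF assms, of "mat_adjoint (creation1 d)" "Suc d"] hermitian_conj[OF assms, of "mat_adjoint (creation2 d)" "Suc d"]
    hermitian_smult[OF hermitian_add, of "Suc d" _ _ "1 / real (Suc d)"]
  by (simp add: up_def)

lemma hermitian_down: 
  assumes "hermitian_mat (Suc d) X" shows "hermitian_mat d (down d X)"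
  using hermitian_conj[OF assms, of "creation1 d" d] hermitian_conj[OF assms, of "creation2 d" d]
    hermitian_smult[OF hermitian_add, of d _ _ "1 / real d"]
  by (simp add: down_def)

lemma index_diag: "j < n \<Longrightarrow> mat_diag n f $$ (j, j) = f j"
  by (simp add: mat_diag_def)

text \<open>\<open>Y1\<close> and \<open>Y2\<close> are the two Kraus operators between the
  eigenbases of input and output, and \<open>M j i\<close> is the normalised sum of the squared
  moduli of their entries. Row sums are diagonal entries of \<open>number_op\<close> and column sums
  are diagonal entries of \<open>number_op'\<close>, both unchanged by the change of basis because
  these operators are scalars.\<close>

lemma up_spectrum:
  assumes X: "spectral_dec d X W \<alpha>" and Y: "spectral_dec (Suc d) (up d X) V \<beta>"
  shows "\<exists>M. (\<forall>i j. 0 \<le> M j i) \<and> (\<forall>j<Suc d. (\<Sum>i<d. M j i) = real d / real (d + 1)) \<and>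
    (\<forall>i<d. (\<Sum>j<Suc d. M j i) = 1) \<and> (\<forall>j<Suc d. \<beta> j = (\<Sum>i<d. M j i * \<alpha> i))"
proof -
  note x = spectral_decD[OF X] and y = spectral_decD[OF Y]
  note w = unitary_matD[OF x(1)] and v = unitary_matD[OF y(1)]
  note dims = carrier_matD[OF w(1)] carrier_matD[OF v(1)]
  let ?D = "mat_diag d (\<lambda>i. complex_of_real (\<alpha> i))"
  have dD: "dim_row ?D = d" "dim_col ?D = d" by (simp_all add: mat_diag_def)
  have wd: "W * (mat_adjoint W * Z) = Z" if "dim_row Z = d" for Z
    using that w(3) by (metis assoc_mult_mat_dim carrier_matI dim_mat_adjoint dims(1,2) left_mult_one_mat)
  have vd: "V * (mat_adjoint V * Z) = Z" if "dim_row Z = Suc d" for Z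
    using that v(3) by (metis assoc_mult_mat_dim carrier_matI dim_mat_adjoint dims(3,4) left_mult_one_mat)
  define Y1 where "Y1 = mat_adjoint V * creation1 d * W"
  define Y2 where "Y2 = mat_adjoint V * creation2 d * W"
  have Yc: "Y1 \<in> carrier_mat (Suc d) d" "Y2 \<in> carrier_mat (Suc d) d"
    unfolding Y1_def Y2_def using dims by (auto intro!: carrier_matI)
  define M where "M j i = ((cmod (Y1 $$ (j, i)))\<^sup>2 + (cmod (Y2 $$ (j, i)))\<^sup>2) / real (d + 1)" for j i
  have "0 \<le> M j i" for i j by (simp add: M_def)
  moreover have "(\<Sum>i<d. M j i) = real d / real (d + 1)" if j: "j < Suc d" for j
  proof -
    have "Y1 * mat_adjoint Y1 + Y2 * mat_adjoint Y2 =
        mat_adjoint V * (creation1 d * mat_adjoint (creation1 d) + creation2 d * mat_adjoint (creation2 d)) * V"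
      unfolding Y1_def Y2_def using dims by (simp add: mat_alg wd)
    also have "\<dots> = of_nat d \<cdot>\<^sub>m 1\<^sub>m (Suc d)"
      unfolding number_op using dims by (simp add: mat_alg v(2))
    finally have "(Y1 * mat_adjoint Y1 + Y2 * mat_adjoint Y2) $$ (j, j) = (of_nat d \<cdot>\<^sub>m 1\<^sub>m (Suc d)) $$ (j, j)" by (rule arg_cong)
    moreover have "(Y1 * mat_adjoint Y1 + Y2 * mat_adjoint Y2) $$ (j, j) =
        (Y1 * mat_adjoint Y1) $$ (j, j) + (Y2 * mat_adjoint Y2) $$ (j, j)"
      using Yc j by (subst index_add_mat(1)) auto
    ultimately have "complex_of_real ((\<Sum>i<d. (cmod (Y1 $$ (j, i)))\<^sup>2) + (\<Sum>i<d. (cmod (Y2 $$ (j, i)))\<^sup>2)) = complex_of_real (real d)"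
      using j by (simp only: mat_mult_adj_index[OF Yc(1) j] mat_mult_adj_index[OF Yc(2) j] of_real_add) simp
    then have "(\<Sum>i<d. (cmod (Y1 $$ (j, i)))\<^sup>2) + (\<Sum>i<d. (cmod (Y2 $$ (j, i)))\<^sup>2) = real d"
      by (simp only: of_real_eq_iff)
    then show ?thesis by (simp add: M_def sum.distrib flip: sum_divide_distrib)
  qed
  moreover have "(\<Sum>j<Suc d. M j i) = 1" if i: "i < d" for i
  proof -
    have "mat_adjoint Y1 * Y1 + mat_adjoint Y2 * Y2 =
        mat_adjoint W * (mat_adjoint (creation1 d) * creation1 d + mat_adjoint (creation2 d) * creation2 d) * W"
      unfolding Y1_def Y2_def using dims by (simp add: mat_alg vd)
    also have "\<dots> = of_nat (Suc d) \<cdot>\<^sub>m 1\<^sub>m d"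
      unfolding number_op' using dims by (simp add: mat_alg w(2))
    finally have "(mat_adjoint Y1 * Y1 + mat_adjoint Y2 * Y2) $$ (i, i) = (of_nat (Suc d) \<cdot>\<^sub>m 1\<^sub>m d) $$ (i, i)" by (rule arg_cong)
    moreover have "(mat_adjoint Y1 * Y1 + mat_adjoint Y2 * Y2) $$ (i, i) =
        (mat_adjoint Y1 * Y1) $$ (i, i) + (mat_adjoint Y2 * Y2) $$ (i, i)"
      using Yc i by (subst index_add_mat(1)) auto
    ultimately have "complex_of_real ((\<Sum>j<Suc d. (cmod (Y1 $$ (j, i)))\<^sup>2) + (\<Sum>j<Suc d. (cmod (Y2 $$ (j, i)))\<^sup>2)) = complex_of_real (real (Suc d))"
      using i by (simp only: adj_mult_mat_index[OF Yc(1) i] adj_mult_mat_index[OF Yc(2) i] of_real_add) simp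
    then have "(\<Sum>j<Suc d. (cmod (Y1 $$ (j, i)))\<^sup>2) + (\<Sum>j<Suc d. (cmod (Y2 $$ (j, i)))\<^sup>2) = real (Suc d)"
      by (simp only: of_real_eq_iff)
    then show ?thesis unfolding M_def sum_divide_distrib[symmetric] sum.distrib by simp
  qed
  moreover have "\<beta> j = (\<Sum>i<d. M j i * \<alpha> i)" if j: "j < Suc d" for j
  proof -
    have "mat_diag (Suc d) (\<lambda>i. complex_of_real (\<beta> i)) =
        (1 / of_nat (Suc d)) \<cdot>\<^sub>m (Y1 * ?D * mat_adjoint Y1 + Y2 * ?D * mat_adjoint Y2)"
      unfolding y(5)[symmetric] up_def unfolding Y1_def Y2_def x(4) using dims dD by (simp add: mat_alg)
    from arg_cong[OF this, of "\<lambda>A. A $$ (j, j)"]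
    have "complex_of_real (\<beta> j) = ((1 / of_nat (Suc d)) \<cdot>\<^sub>m (Y1 * ?D * mat_adjoint Y1 + Y2 * ?D * mat_adjoint Y2)) $$ (j, j)"
      using j by (simp only: index_diag)
    also have "\<dots> = (1 / of_nat (Suc d)) * ((Y1 * ?D * mat_adjoint Y1) $$ (j, j) + (Y2 * ?D * mat_adjoint Y2) $$ (j, j))"
      using j Yc by (simp del: index_mult_mat(1))
    also have "\<dots> = complex_of_real (1 / real (d + 1) * ((\<Sum>i<d. (cmod (Y1 $$ (j, i)))\<^sup>2 * \<alpha> i) + (\<Sum>i<d. (cmod (Y2 $$ (j, i)))\<^sup>2 * \<alpha> i)))"
      by (simp add: mat_mult_diag_adj_index[OF Yc(1) j] mat_mult_diag_adj_index[OF Yc(2) j] del: index_mult_mat(1))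
    finally have "\<beta> j = 1 / real (d + 1) * ((\<Sum>i<d. (cmod (Y1 $$ (j, i)))\<^sup>2 * \<alpha> i) + (\<Sum>i<d. (cmod (Y2 $$ (j, i)))\<^sup>2 * \<alpha> i))"
      by (simp only: of_real_eq_iff)
    then show ?thesis
      unfolding sum.distrib[symmetric] sum_distrib_left M_def
      by (elim ssubst) (intro sum.cong refl, simp add: distrib_right add_divide_distrib)
  qed
  ultimately show ?thesis by blast
qed

section \<open>Iterated channels and the spectrum for a coherent state\<close>

fun up_iter :: "nat \<Rightarrow> nat \<Rightarrow> complex mat \<Rightarrow> complex mat" where
  "up_iter d 0 X = X"
| "up_iter d (Suc k) X = up (d + k) (up_iter d k X)"

text \<open>The argument \<open>d\<close> is the dimension that is reached, so that
  \<open>down_iter d k\<close> undoes the change of dimension of \<open>up_iter d k\<close>; the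
  step from the largest dimension is applied first.\<close>

fun down_iter :: "nat \<Rightarrow> nat \<Rightarrow> complex mat \<Rightarrow> complex mat" where
  "down_iter d 0 X = X"
| "down_iter d (Suc k) X = down_iter d k (down (d + k) X)"

definition pure :: "nat \<Rightarrow> real" where
  "pure i = (if i = 0 then 1 else 0)"

text \<open>The output spectrum for a coherent input, listed in decreasing order; see
  \<open>up_iter_pure\<close> and \<open>decreasing_coherent_spec\<close>.\<close>

fun coherent_spec :: "nat \<Rightarrow> nat \<Rightarrow> nat \<Rightarrow> real" where
  "coherent_spec d 0 = pure"
| "coherent_spec d (Suc k) = raise (d + k) (coherent_spec d k)"

lemma decreasing_coherent_spec: "0 < d \<Longrightarrow> decreasing (d + k) (coherent_spec d k)"
proof (induction k)
  case 0
  then show ?case by (auto simp: decreasing_def antimono_def pure_def)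
qed (simp add: decreasing_raise)

lemma sum_coherent_spec: "0 < d \<Longrightarrow> (\<Sum>i<d + k. coherent_spec d k i) = 1"
proof (induction k)
  case 0
  then show ?case by (simp add: pure_def)
next
  case (Suc k)
  have "(\<Sum>i<Suc (d + k). raise (d + k) (coherent_spec d k) i) = (\<Sum>i<d + k. coherent_spec d k i)"
    using sum_raise[OF decreasing_coherent_spec[OF Suc.prems, of k], of "d + k"] by simp
  then show ?case using Suc by simp
qed

text \<open>The induction carries the bounds for all thresholds \<open>t\<close>, since one step
  evaluates the bound on the input at a threshold that depends on the number of output eigenvalues
  above \<open>t\<close>.\<close>

lemma up_iter_majorization:
  assumes "density_mat d X" "0 < d"
  shows "\<exists>V \<beta>. spectral_dec (d + k) (up_iter d k X) V \<beta> \<and> (\<forall>j<d + k. 0 \<le> \<beta> j) \<and> (\<Sum>j<d + k. \<beta> j) = 1 \<and>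
    (\<forall>t. excess (d + k) \<beta> t \<le> excess (d + k) (coherent_spec d k) t)"
proof (induction k)
  case 0
  have "hermitian_mat d X" using assms by (simp add: density_mat_def)
  then obtain V \<beta> where V: "spectral_dec d X V \<beta>" using spectral_theorem by blast
  note p = spectral_dec_pos[OF assms(1) V]
  have "excess d \<beta> t \<le> excess d pure t" for t
    using excess_le_pure[OF p assms(2), of t] by (simp add: pure_def[abs_def])
  then show ?case using V p by auto
next
  case (Suc k)
  then obtain W \<alpha> where W: "spectral_dec (d + k) (up_iter d k X) W \<alpha>"
    and pos: "\<And>i. i < d + k \<Longrightarrow> 0 \<le> \<alpha> i" and sum: "(\<Sum>j<d + k. \<alpha> j) = 1"
    and maj: "\<And>t. excess (d + k) \<alpha> t \<le> excess (d + k) (coherent_spec d k) t" by blast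
  have "hermitian_mat (Suc (d + k)) (up (d + k) (up_iter d k X))"
    by (rule hermitian_up) (rule spectral_decD[OF W])
  then obtain V \<beta> where V: "spectral_dec (Suc (d + k)) (up (d + k) (up_iter d k X)) V \<beta>"
    using spectral_theorem by blast
  obtain M where M: "\<And>i j. 0 \<le> M j i"
    and row: "\<And>j. j < Suc (d + k) \<Longrightarrow> (\<Sum>i<d + k. M j i) = real (d + k) / real (d + k + 1)"
    and col: "\<And>i. i < d + k \<Longrightarrow> (\<Sum>j<Suc (d + k). M j i) = 1"
    and \<beta>: "\<And>j. j < Suc (d + k) \<Longrightarrow> \<beta> j = (\<Sum>i<d + k. M j i * \<alpha> i)"
    using up_spectrum[OF W V] by blast
  have "0 \<le> \<beta> j" if "j < Suc (d + k)" for j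
    unfolding \<beta>[OF that] using M pos by (intro sum_nonneg mult_nonneg_nonneg) auto
  moreover have "(\<Sum>j<Suc (d + k). \<beta> j) = 1"
  proof -
    have "(\<Sum>j<Suc (d + k). \<beta> j) = (\<Sum>j<Suc (d + k). \<Sum>i<d + k. M j i * \<alpha> i)"
      using \<beta> by (intro sum.cong) auto
    also have "\<dots> = (\<Sum>i<d + k. (\<Sum>j<Suc (d + k). M j i) * \<alpha> i)"
      by (subst sum.swap) (simp only: sum_distrib_right)
    also have "\<dots> = (\<Sum>i<d + k. \<alpha> i)" using col by (intro sum.cong) auto
    finally show ?thesis using sum by simp
  qed
  moreover have "excess (Suc (d + k)) \<beta> t \<le> excess (Suc (d + k)) (raise (d + k) (coherent_spec d k)) t" for t
    by (rule excess_raise[OF decreasing_coherent_spec[OF assms(2)] M row col \<beta> maj])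
  ultimately show ?case using V by auto
qed

lemma up_iter_carrier: "X \<in> carrier_mat d d \<Longrightarrow> up_iter d k X \<in> carrier_mat (d + k) (d + k)"
  by (induction k) auto

lemma up_iter_mode_rot:
  assumes "p * cnj p + q * cnj q = 1" "X \<in> carrier_mat d d"
  shows "up_iter d k (mode_rot p q d * X * mat_adjoint (mode_rot p q d)) =
    mode_rot p q (d + k) * up_iter d k X * mat_adjoint (mode_rot p q (d + k))"
  by (induction k) (simp_all add: up_mode_rot[OF assms(1) up_iter_carrier[OF assms(2)]])

lemma down_iter_mode_rot:
  assumes "p * cnj p + q * cnj q = 1" "X \<in> carrier_mat (d + k) (d + k)"
  shows "down_iter d k (mode_rot p q (d + k) * X * mat_adjoint (mode_rot p q (d + k))) =
    mode_rot p q d * down_iter d k X * mat_adjoint (mode_rot p q d)"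
  using assms(2)
  by (induction k arbitrary: X) (simp_all add: down_mode_rot[OF assms(1)])

lemma up_diag:
  "up d (mat_diag d (\<lambda>i. complex_of_real (l i))) = mat_diag (Suc d) (\<lambda>i. complex_of_real (raise d l i))"
proof (rule eq_matI)
  fix i j assume "i < dim_row (mat_diag (Suc d) (\<lambda>i. complex_of_real (raise d l i)))"
    "j < dim_col (mat_diag (Suc d) (\<lambda>i. complex_of_real (raise d l i)))"
  then have ij: "i < Suc d" "j < Suc d" by (auto simp: mat_diag_def)
  have "(if i < d \<and> j < d then nsqrt (d - i) * nsqrt (d - j) * mat_diag d (\<lambda>i. complex_of_real (l i)) $$ (i, j) else 0) +
     nsqrt i * nsqrt j * mat_diag d (\<lambda>i. complex_of_real (l i)) $$ (i - 1, j - 1) =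
     (if i = j then of_nat (d - i) * complex_of_real (l i) + of_nat i * complex_of_real (l (i - 1)) else 0)"
  proof (cases "i < d \<or> i \<noteq> j")
    case True
    then show ?thesis using ij by (cases i; cases j; auto simp: mat_diag_def)
  next
    \<comment> \<open>Only the corner \<open>i = j = d\<close> is left, where the unshifted term is
      absent.\<close>
    case False
    then show ?thesis using ij by (cases d; auto simp: mat_diag_def)
  qed
  then show "up d (mat_diag d (\<lambda>i. complex_of_real (l i))) $$ (i, j) =
      mat_diag (Suc d) (\<lambda>i. complex_of_real (raise d l i)) $$ (i, j)"
    using ij by (simp add: up_index raise_def) (simp add: mat_diag_def)
qed (auto simp: mat_diag_def)

lemma up_iter_pure:
  "up_iter d k (mat_diag d (\<lambda>i. complex_of_real (pure i))) = mat_diag (d + k) (\<lambda>i. complex_of_real (coherent_spec d k i))"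
  by (induction k) (simp_all add: up_diag)

text \<open>The vector with all \<open>d\<close> particles in the first mode is annihilated by the
  second annihilator, and the first one keeps its form and multiplies its projection by
  \<open>d\<close>, which the normalisation cancels.\<close>

lemma down_pure:
  assumes "0 < d"
  shows "down d (mat_diag (Suc d) (\<lambda>i. complex_of_real (pure i))) = mat_diag d (\<lambda>i. complex_of_real (pure i))"
proof (rule eq_matI)
  fix i j assume "i < dim_row (mat_diag d (\<lambda>i. complex_of_real (pure i)))"
    "j < dim_col (mat_diag d (\<lambda>i. complex_of_real (pure i)))"
  then have ij: "i < d" "j < d" by (auto simp: mat_diag_def)
  then show "down d (mat_diag (Suc d) (\<lambda>i. complex_of_real (pure i))) $$ (i, j) =
      mat_diag d (\<lambda>i. complex_of_real (pure i)) $$ (i, j)"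
    by (simp add: down_index) (auto simp: mat_diag_def pure_def)
qed (auto simp: mat_diag_def)

lemma down_iter_pure:
  assumes "0 < d"
  shows "down_iter d k (mat_diag (d + k) (\<lambda>i. complex_of_real (pure i))) = mat_diag d (\<lambda>i. complex_of_real (pure i))"
  using assms by (induction k) (simp_all add: down_pure)

lemma adjoint_inner:
  fixes A :: "complex mat"
  assumes A: "A \<in> carrier_mat m n" and u: "u \<in> carrier_vec m" and v: "v \<in> carrier_vec n"
  shows "(mat_adjoint A *\<^sub>v u) \<bullet>c v = u \<bullet>c (A *\<^sub>v v)"
proof -
  have "(mat_adjoint A *\<^sub>v u) \<bullet>c v = (\<Sum>i<n. \<Sum>j<m. cnj (A $$ (j, i)) * u $ j * cnj (v $ i))"
    using assms by (auto simp: scalar_prod_def atLeast0LessThan sum_distrib_right intro!: sum.cong)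
  also have "\<dots> = (\<Sum>j<m. \<Sum>i<n. u $ j * cnj (A $$ (j, i) * v $ i))"
    by (subst sum.swap) (simp add: ac_simps)
  also have "\<dots> = u \<bullet>c (A *\<^sub>v v)"
    using assms by (auto simp: scalar_prod_def atLeast0LessThan sum_distrib_left cnj_sum intro!: sum.cong)
  finally show ?thesis .
qed

lemma smult_mult_mat_vec_dim:
  "dim_vec v = dim_col A \<Longrightarrow> (c \<cdot>\<^sub>m A) *\<^sub>v v = c \<cdot>\<^sub>v (A *\<^sub>v v)"
  for A :: "'a::comm_semiring_0 mat"
  by (intro eq_vecI) (auto simp: scalar_prod_def sum_distrib_left mult.assoc)

text \<open>Positivity comes from the Kraus form, which evaluates \<open>X\<close> on the vectors
  \<open>creation d p q *\<^sub>v v\<close>; the trace comes from cyclicity and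
  \<open>number_op\<close>.\<close>

lemma down_density:
  assumes X: "density_mat (Suc d) X" and "0 < d"
  shows "density_mat d (down d X)"
proof -
  have h: "hermitian_mat (Suc d) X" and Xc: "X \<in> carrier_mat (Suc d) (Suc d)" and tr: "mat_trace X = 1"
    using X by (auto simp: density_mat_def hermitian_mat_def)
  note dims = carrier_matD[OF Xc]
  have tr_add: "mat_trace (A + B) = mat_trace A + mat_trace B" if "dim_row A = dim_row B" "dim_col B = dim_row B" for A B
    using that by (simp add: mat_trace_def sum.distrib)
  have tr_smult: "mat_trace (c \<cdot>\<^sub>m A) = c * mat_trace A" if "dim_col A = dim_row A" for A c
    using that by (simp add: mat_trace_def sum_distrib_left)
  have cyc: "mat_trace (mat_adjoint (creation d p q) * X * creation d p q) = mat_trace (X * (creation d p q * mat_adjoint (creation d p q)))" for p q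
  proof -
    have "mat_trace ((mat_adjoint (creation d p q)) * (X * creation d p q)) = mat_trace ((X * creation d p q) * mat_adjoint (creation d p q))"
      using dims by (intro mat_trace_mult_comm[of _ d "Suc d"] carrier_matI) auto
    then show ?thesis using dims by (simp add: mat_alg)
  qed
  have "mat_trace (mat_adjoint (creation1 d) * X * creation1 d + mat_adjoint (creation2 d) * X * creation2 d) =
      mat_trace (X * (creation1 d * mat_adjoint (creation1 d) + creation2 d * mat_adjoint (creation2 d)))"
    using dims by (simp add: tr_add cyc mult_add_distrib_mat_dim)
  also have "\<dots> = of_nat d" unfolding number_op using Xc dims by (simp add: mat_alg tr_smult tr)
  finally have "mat_trace (down d X) = 1" using dims \<open>0 < d\<close> by (simp add: down_def tr_smult)
  moreover have "0 \<le> (down d X *\<^sub>v v) \<bullet>c v" if v: "v \<in> carrier_vec d" for v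
  proof -
    have K: "((mat_adjoint (creation d p q) * X * creation d p q) *\<^sub>v v) \<bullet>c v = (X *\<^sub>v (creation d p q *\<^sub>v v)) \<bullet>c (creation d p q *\<^sub>v v)" for p q
    proof -
      have u: "X *\<^sub>v (creation d p q *\<^sub>v v) \<in> carrier_vec (Suc d)"
        using Xc v by (intro mult_mat_vec_carrier[of _ "Suc d" "Suc d"] mult_mat_vec_carrier[of _ "Suc d" d]) auto
      have "(mat_adjoint (creation d p q) * X * creation d p q) *\<^sub>v v = mat_adjoint (creation d p q) *\<^sub>v (X *\<^sub>v (creation d p q *\<^sub>v v))"
        using v Xc by (simp add: assoc_mult_mat_vec[of _ d "Suc d" _ d] assoc_mult_mat_vec[of _ d "Suc d" _ "Suc d"]
            mult_carrier_mat[of _ d "Suc d" _ "Suc d"] mult_mat_vec_carrier[of _ "Suc d" d])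
      then show ?thesis using adjoint_inner[OF creation_carrier u v] by simp
    qed
    have pos: "0 \<le> ((mat_adjoint (creation d p q) * X * creation d p q) *\<^sub>v v) \<bullet>c v" for p q
      unfolding K using X v mult_mat_vec_carrier[OF creation_carrier v] by (auto simp: density_mat_def)
    have "(down d X *\<^sub>v v) \<bullet>c v = (1 / of_nat d) *
        (((mat_adjoint (creation1 d) * X * creation1 d) *\<^sub>v v) \<bullet>c v + ((mat_adjoint (creation2 d) * X * creation2 d) *\<^sub>v v) \<bullet>c v)"
    proof -
      have c: "mat_adjoint (creation d p q) * X * creation d p q \<in> carrier_mat d d" for p q by (intro carrier_matI) auto
      have "down d X *\<^sub>v v = (1 / of_nat d) \<cdot>\<^sub>v ((mat_adjoint (creation1 d) * X * creation1 d) *\<^sub>v v + (mat_adjoint (creation2 d) * X * creation2 d) *\<^sub>v v)"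
        unfolding down_def using c[of 1 0] c[of 0 1] v
        by (simp add: smult_mult_mat_vec_dim add_mult_distrib_mat_vec[of _ d d])
      then show ?thesis using v c[of 1 0] c[of 0 1]
        by (simp add: add_scalar_prod_distrib[of _ d] mult_mat_vec_carrier[of _ d d])
    qed
    also have "\<dots> \<ge> 0"
      using pos[of 1 0] pos[of 0 1] by (auto simp: less_eq_complex_def)
    finally show ?thesis .
  qed
  ultimately show ?thesis using hermitian_down[OF h] by (simp add: density_mat_def)
qed

lemma down_iter_density: "density_mat (d + k) X \<Longrightarrow> 0 < d \<Longrightarrow> density_mat d (down_iter d k X)"
  by (induction k arbitrary: X) (simp_all add: down_density)

text \<open>\<open>w\<close> is annihilated by \<open>p a\<^sub>2 - q a\<^sub>1\<close>, the annihilator of the spinor orthogonal to \<open>(p, q)\<close>.\<close>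

definition coherent :: "nat \<Rightarrow> complex \<Rightarrow> complex \<Rightarrow> complex vec \<Rightarrow> bool" where
  "coherent d p q w \<longleftrightarrow> w \<in> carrier_vec (Suc d) \<and> w \<bullet>c w = 1 \<and>
     (\<forall>i<d. p * nsqrt (Suc i) * w $ Suc i = q * nsqrt (d - i) * w $ i)"

lemma mult_mat_vec_eq_col:
  "dim_vec v = dim_col A \<Longrightarrow> A *\<^sub>v v = col (A * Matrix.mat (dim_vec v) 1 (\<lambda>(i, j). v $ i)) 0"
  for A :: "'a::semiring_0 mat"
  by (intro eq_vecI) (auto simp: scalar_prod_def)

lemma adj_creation_mult_vec:
  assumes "dim_vec v = Suc d" "i < d"
  shows "(mat_adjoint (creation d p q) *\<^sub>v v) $ i = cnj p * nsqrt (d - i) * v $ i + cnj q * nsqrt (Suc i) * v $ Suc i"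
proof -
  have "(mat_adjoint (creation d p q) *\<^sub>v v) $ i =
      (mat_adjoint (creation d p q) * Matrix.mat (Suc d) 1 (\<lambda>(i, j). v $ i)) $$ (i, 0)"
    using assms by (subst mult_mat_vec_eq_col) (auto simp del: index_mult_mat(1))
  then show ?thesis using assms by (simp add: adj_creation_mult_index del: index_mult_mat(1))
qed

text \<open>Rotate \<open>w\<close> back to \<open>x\<close>. The annihilator of the spinor
  orthogonal to \<open>(p, q)\<close> kills \<open>w\<close>, and by intertwining the second
  annihilator kills \<open>x\<close>. So \<open>x\<close> has all particles in the first mode, that
  is, it is a unit multiple of the first basis vector, and the phase drops out of the
  projection.\<close>

lemma coherent_mode_rot:
  assumes w: "coherent d p q w" and pq: "p * cnj p + q * cnj q = 1"
  shows "ket_bra w = mode_rot p q (Suc d) * mat_diag (Suc d) (\<lambda>i. complex_of_real (pure i)) * mat_adjoint (mode_rot p q (Suc d))"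
proof -
  let ?R = "mode_rot p q (Suc d)"
  note R = unitary_matD[OF unitary_mode_rot[OF pq, of "Suc d"]]
  have wc: "w \<in> carrier_vec (Suc d)" and w1: "w \<bullet>c w = 1"
    and wa: "\<And>i. i < d \<Longrightarrow> p * nsqrt (Suc i) * w $ Suc i = q * nsqrt (d - i) * w $ i"
    using w by (auto simp: coherent_def)
  define x where "x = mat_adjoint ?R *\<^sub>v w"
  have xc: "x \<in> carrier_vec (Suc d)" unfolding x_def using wc R(1) by (intro mult_mat_vec_carrier[of _ "Suc d" "Suc d"]) auto
  have wx: "w = ?R *\<^sub>v x"
    using assoc_mult_mat_vec[OF R(1) mat_adjoint_carrier[OF R(1)] wc] wc by (simp add: x_def R(3))
  have "mat_adjoint (creation d (- cnj q) (cnj p)) *\<^sub>v w = 0\<^sub>v d"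
    using wc wa by (intro eq_vecI) (simp_all add: adj_creation_mult_vec del: index_mult_mat_vec)
  then have "mode_rot p q d *\<^sub>v (mat_adjoint (creation2 d) *\<^sub>v x) = 0\<^sub>v d"
    unfolding wx using adj_mode_rot_intertwine12(2)[OF pq, of d] xc R(1)
    by (metis assoc_mult_mat_vec carrier_matI creation_carrier mat_adjoint_carrier mode_rot_dim)
  then have z: "mat_adjoint (mode_rot p q d) *\<^sub>v (mode_rot p q d *\<^sub>v (mat_adjoint (creation2 d) *\<^sub>v x)) = 0\<^sub>v d"
    by (auto simp: scalar_prod_def)
  have yc: "mat_adjoint (creation2 d) *\<^sub>v x \<in> carrier_vec d"
    using xc by (intro mult_mat_vec_carrier[of _ d "Suc d"]) auto
  note Q = unitary_matD[OF unitary_mode_rot[OF pq, of d]]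
  have y0: "mat_adjoint (creation2 d) *\<^sub>v x = 0\<^sub>v d"
  proof -
    have "mat_adjoint (creation2 d) *\<^sub>v x = (mat_adjoint (mode_rot p q d) * mode_rot p q d) *\<^sub>v (mat_adjoint (creation2 d) *\<^sub>v x)"
      unfolding Q(2) by (rule one_mult_mat_vec[OF yc, symmetric])
    also have "\<dots> = mat_adjoint (mode_rot p q d) *\<^sub>v (mode_rot p q d *\<^sub>v (mat_adjoint (creation2 d) *\<^sub>v x))"
      by (rule assoc_mult_mat_vec[OF mat_adjoint_carrier[OF Q(1)] Q(1) yc])
    also have "\<dots> = 0\<^sub>v d" by (rule z)
    finally show ?thesis .
  qed
  have x0: "x $ Suc i = 0" if "i < d" for i
  proof -
    have "nsqrt (Suc i) * x $ Suc i = 0"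
      using arg_cong[OF y0, of "\<lambda>v. v $ i"] that xc by (simp add: adj_creation_mult_vec del: index_mult_mat_vec)
    then show ?thesis by (simp add: nsqrt_def)
  qed
  have s: "(\<Sum>k = 0..<Suc d. g k) = g 0 + (\<Sum>k = 0..<d. g (Suc k))" for g :: "nat \<Rightarrow> complex"
    by (simp add: sum.atLeast0_lessThan_Suc_shift del: sum.op_ivl_Suc)
  have wi: "w $ i = ?R $$ (i, 0) * x $ 0" if i: "i < Suc d" for i
    using i xc R(1) by (subst wx) (simp add: scalar_prod_def s x0 del: sum.op_ivl_Suc)
  have "x \<bullet>c x = w \<bullet>c (?R *\<^sub>v x)"
    using adjoint_inner[OF R(1) wc xc] by (simp add: x_def)
  then have "x \<bullet>c x = 1" using wx w1 by simp
  then have x1: "x $ 0 * cnj (x $ 0) = 1" using xc by (simp add: scalar_prod_def s x0 del: sum.op_ivl_Suc)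
  show ?thesis
  proof (rule eq_matI)
    fix i j assume "i < dim_row (?R * mat_diag (Suc d) (\<lambda>i. complex_of_real (pure i)) * mat_adjoint ?R)"
      "j < dim_col (?R * mat_diag (Suc d) (\<lambda>i. complex_of_real (pure i)) * mat_adjoint ?R)"
    then have i: "i < Suc d" and j: "j < Suc d" by auto
    have "ket_bra w $$ (i, j) = ?R $$ (i, 0) * cnj (?R $$ (j, 0)) * (x $ 0 * cnj (x $ 0))"
      using i j wc by (simp add: ket_bra_def wi)
    also have "\<dots> = ?R $$ (i, 0) * cnj (?R $$ (j, 0))" by (simp add: x1)
    also have "\<dots> = (?R * mat_diag (Suc d) (\<lambda>i. complex_of_real (pure i)) * mat_adjoint ?R) $$ (i, j)"
      using i j R(1) by (simp add: mat_diag_mult_right[OF R(1)] scalar_prod_def s pure_def del: sum.op_ivl_Suc)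
    finally show "ket_bra w $$ (i, j) = (?R * mat_diag (Suc d) (\<lambda>i. complex_of_real (pure i)) * mat_adjoint ?R) $$ (i, j)" .
  qed (use wc in \<open>auto simp: ket_bra_def\<close>)
qed

lemma unit_interval_of_sum:
  fixes x :: "nat \<Rightarrow> real"
  assumes "\<And>i. i < n \<Longrightarrow> 0 \<le> x i" "(\<Sum>i<n. x i) = 1" "i < n"
  shows "x i \<in> {0..1}"
  using member_le_sum[of i "{..<n}" x] assms by auto

lemma up_iter_coherent_minimizes:
  assumes f: "concave_on {0..1} f" and X: "density_mat (Suc d) X"
    and w: "coherent d p q w" and pq: "p * cnj p + q * cnj q = 1"
  shows "mat_trace (mat_fun f (up_iter (Suc d) k (ket_bra w))) \<le> mat_trace (mat_fun f (up_iter (Suc d) k X))"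
proof -
  let ?n = "Suc d + k"
  obtain V \<beta> where V: "spectral_dec ?n (up_iter (Suc d) k X) V \<beta>"
    and b: "\<And>j. j < ?n \<Longrightarrow> 0 \<le> \<beta> j" "(\<Sum>j<?n. \<beta> j) = 1"
    and maj: "\<And>t. excess ?n \<beta> t \<le> excess ?n (coherent_spec (Suc d) k) t"
    using up_iter_majorization[OF X, of k] by auto
  have c: "0 \<le> coherent_spec (Suc d) k j" "(\<Sum>j<?n. coherent_spec (Suc d) k j) = 1" for j
    using decreasing_nonneg[OF decreasing_coherent_spec[of "Suc d" k]] sum_coherent_spec[of "Suc d" k] by auto
  have "spectral_dec ?n (up_iter (Suc d) k (ket_bra w)) (mode_rot p q ?n) (coherent_spec (Suc d) k)"
    using unitary_mode_rot[OF pq]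
    by (simp add: spectral_dec_def coherent_mode_rot[OF w pq] up_iter_mode_rot[OF pq] up_iter_pure del: up_iter.simps)
  moreover have "(\<Sum>i<?n. f (coherent_spec (Suc d) k i)) \<le> (\<Sum>i<?n. f (\<beta> i))"
    by (rule concave_sum_antimono[OF f])
      (use unit_interval_of_sum[OF b] unit_interval_of_sum[OF c] b c maj in auto)
  ultimately show ?thesis
    using mat_trace_mat_fun[OF V, of f] mat_trace_mat_fun[of ?n _ _ "coherent_spec (Suc d) k" f]
    by (simp add: less_eq_complex_def)
qed

text \<open>The output eigenvalues lie between 0 and 1, where \<open>f\<close> is above its chord.
  As they add up to 1, the chord values add up to \<open>f 1 + (n - 1) * f 0\<close>, with
  \<open>n\<close> the output dimension; this is the value for a pure state.\<close>

lemma down_iter_coherent_minimizes: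
  assumes f: "concave_on {0..1} f" and X: "density_mat (Suc d + k) X"
    and w: "coherent (d + k) p q w" and pq: "p * cnj p + q * cnj q = 1"
  shows "mat_trace (mat_fun f (down_iter (Suc d) k (ket_bra w))) \<le> mat_trace (mat_fun f (down_iter (Suc d) k X))"
proof -
  let ?n = "Suc d"
  have D: "density_mat ?n (down_iter ?n k X)" using down_iter_density[OF X] by simp
  then obtain V \<beta> where V: "spectral_dec ?n (down_iter ?n k X) V \<beta>"
    using spectral_theorem[of ?n "down_iter ?n k X"] by (auto simp: density_mat_def)
  note b = spectral_dec_pos[OF D V]
  have "spectral_dec ?n (down_iter ?n k (ket_bra w)) (mode_rot p q ?n) pure"
    using unitary_mode_rot[OF pq] down_iter_mode_rot[OF pq, of _ ?n k] down_iter_pure[of ?n k] coherent_mode_rot[OF w pq]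
    by (simp add: spectral_dec_def del: down_iter.simps)
  moreover have "(\<Sum>i<?n. f (pure i)) \<le> (\<Sum>i<?n. f (\<beta> i))"
  proof -
    have "(\<Sum>i<?n. f (pure i)) = f 1 + (real ?n - 1) * f 0"
      unfolding sum.lessThan_Suc_shift by (simp add: pure_def)
    also have "\<dots> = (\<Sum>i<?n. \<beta> i * f 1 + (1 - \<beta> i) * f 0)"
      using b(2) by (simp only: sum.distrib sum_subtractf flip: sum_distrib_right) simp
    also have "\<dots> \<le> (\<Sum>i<?n. f (\<beta> i))"
      using concave_on_chord[OF f unit_interval_of_sum[OF b]] by (intro sum_mono) auto
    finally show ?thesis .
  qed
  ultimately show ?thesis
    using mat_trace_mat_fun[OF V, of f] mat_trace_mat_fun[of ?n _ _ pure f]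
    by (simp add: less_eq_complex_def)
qed

section \<open>The Casimir operator of two spins\<close>

lemma sum_lessThan_mult:
  "(\<Sum>i<M * N. g i) = (\<Sum>a<M. \<Sum>b<N. g (a * N + b))" for g :: "nat \<Rightarrow> 'a::comm_monoid_add"
proof -
  have "(\<Sum>i<M * N. g i) = (\<Sum>a<M. sum g {a * N..<a * N + N})" by (rule sum.nat_group[symmetric])
  also have "\<dots> = (\<Sum>a<M. \<Sum>b<N. g (a * N + b))"
    by (rule sum.cong[OF refl])
      (subst sum.atLeastLessThan_shift_0, simp add: atLeast0LessThan)
  finally show ?thesis .
qed

lemma tensor_index_less: "a < M \<Longrightarrow> b < N \<Longrightarrow> a * N + b < M * N" for a b M N :: nat
  using mult_le_mono1[of "Suc a" M N] by simp

lemma tensor_mult_vec_index: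
  assumes A: "A \<in> carrier_mat M M" and B: "B \<in> carrier_mat N N" and x: "x \<in> carrier_vec (M * N)"
    and a: "a < M" and b: "b < N"
  shows "((A \<otimes>\<^sub>m B) *\<^sub>v x) $ (a * N + b) = (\<Sum>a'<M. \<Sum>b'<N. A $$ (a, a') * B $$ (b, b') * x $ (a' * N + b'))"
proof -
  have "((A \<otimes>\<^sub>m B) *\<^sub>v x) $ (a * N + b) = (\<Sum>i<M * N. (A \<otimes>\<^sub>m B) $$ (a * N + b, i) * x $ i)"
    using A B x tensor_index_less[OF a b] by (simp add: tensor_mat_def scalar_prod_def atLeast0LessThan)
  also have "\<dots> = (\<Sum>a'<M. \<Sum>b'<N. A $$ (a, a') * B $$ (b, b') * x $ (a' * N + b'))"
    unfolding sum_lessThan_mult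
    using A B a b tensor_index_less by (intro sum.cong refl) (auto simp: tensor_mat_def)
  finally show ?thesis .
qed

definition tensor_coeff :: "nat \<Rightarrow> complex vec \<Rightarrow> nat \<Rightarrow> nat \<Rightarrow> complex" where
  "tensor_coeff N x a b = x $ (a * N + b)"

text \<open>With \<open>n\<close> twice the spin, the matrix element of the raising operator from
  \<open>a\<close> to \<open>a - 1\<close>, and of the lowering operator back. It vanishes at
  \<open>a = 0\<close> and \<open>a = Suc n\<close>, so that later formulas may refer to neighbours
  outside the index range.\<close>

definition ladder :: "nat \<Rightarrow> nat \<Rightarrow> complex" where
  "ladder n a = nsqrt a * nsqrt (Suc n - a)"

lemma ladder_0 [simp]: "ladder n 0 = 0"
  by (simp add: ladder_def)

lemma ladder_Suc_self [simp]: "ladder n (Suc n) = 0"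
  by (simp add: ladder_def)

lemma ladder_mult_self: "a \<le> Suc n \<Longrightarrow> ladder n a * ladder n a = of_nat a * (of_nat n + 1 - of_nat a)"
  "a \<le> Suc n \<Longrightarrow> ladder n a * (ladder n a * z) = of_nat a * (of_nat n + 1 - of_nat a) * z"
proof -
  assume a: "a \<le> Suc n"
  have "ladder n a * ladder n a = of_nat a * of_nat (Suc n - a)"
    by (simp add: ladder_def mult.left_commute mult.assoc)
  then show 1: "ladder n a * ladder n a = of_nat a * (of_nat n + 1 - of_nat a)"
    using a by (simp add: of_nat_diff)
  show "ladder n a * (ladder n a * z) = of_nat a * (of_nat n + 1 - of_nat a) * z"
    by (simp add: 1[symmetric])
qed

text \<open>\<open>n\<close> is twice the spin, which lets all index computations run over natural
  numbers.\<close>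

locale spin =
  fixes L :: real and n :: nat
  assumes L: "2 * L = real n"
begin

lemma dim: "spin_dim L = Suc n"
  by (simp add: spin_dim_def L)

lemma plus_index:
  assumes "i < Suc n" "j < Suc n"
  shows "spin_plus L $$ (i, j) = (if j = Suc i then ladder n j else 0)"
proof -
  have "complex_of_real (sqrt (real j * (2 * L + 1 - real j))) = ladder n j"
    using assms by (simp add: L ladder_def nsqrt_def real_sqrt_mult Suc_diff_le of_nat_diff)
  then show ?thesis using assms by (cases "j = Suc i") (simp_all add: spin_plus_def dim)
qed

lemma plus_carrier: "spin_plus L \<in> carrier_mat (Suc n) (Suc n)"
  by (simp add: spin_plus_def dim)

lemma carriers: "spin_x L \<in> carrier_mat (Suc n) (Suc n)" "spin_y L \<in> carrier_mat (Suc n) (Suc n)"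
  "spin_z L \<in> carrier_mat (Suc n) (Suc n)"
  using plus_carrier by (auto simp: spin_x_def spin_y_def spin_z_def dim)

lemma plus_sum:
  assumes "a < Suc n"
  shows "(\<Sum>i<Suc n. spin_plus L $$ (a, i) * g i) = ladder n (Suc a) * g (Suc a)"
proof -
  have "(\<Sum>i<Suc n. spin_plus L $$ (a, i) * g i) = (\<Sum>i<Suc n. if i = Suc a then ladder n i * g i else 0)"
    using assms by (intro sum.cong) (auto simp: plus_index)
  then show ?thesis using assms by (cases "a = n") (auto simp del: sum.lessThan_Suc)
qed

lemma minus_sum:
  assumes "a < Suc n"
  shows "(\<Sum>i<Suc n. mat_adjoint (spin_plus L) $$ (a, i) * g i) = ladder n a * g (a - 1)"
proof -
  have "(\<Sum>i<Suc n. mat_adjoint (spin_plus L) $$ (a, i) * g i) = (\<Sum>i<Suc n. if a = Suc i then ladder n a * g i else 0)"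
    using assms plus_carrier by (intro sum.cong) (auto simp: plus_index ladder_def)
  also have "\<dots> = ladder n a * g (a - 1)" using assms by (cases a) (auto simp del: sum.lessThan_Suc)
  finally show ?thesis .
qed

lemma x_sum:
  assumes "a < Suc n"
  shows "(\<Sum>i<Suc n. spin_x L $$ (a, i) * g i) = (ladder n (Suc a) * g (Suc a) + ladder n a * g (a - 1)) / 2"
proof -
  have "(\<Sum>i<Suc n. spin_x L $$ (a, i) * g i) =
    (\<Sum>i<Suc n. (spin_plus L $$ (a, i) * g i + mat_adjoint (spin_plus L) $$ (a, i) * g i) / 2)"
    using assms carrier_matD[OF plus_carrier] by (intro sum.cong) (auto simp: spin_x_def distrib_right)
  then show ?thesis unfolding sum_divide_distrib[symmetric] sum.distrib plus_sum[OF assms] minus_sum[OF assms] .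
qed

lemma y_sum:
  assumes "a < Suc n"
  shows "(\<Sum>i<Suc n. spin_y L $$ (a, i) * g i) = (ladder n (Suc a) * g (Suc a) - ladder n a * g (a - 1)) / (2 * \<i>)"
proof -
  have "(\<Sum>i<Suc n. spin_y L $$ (a, i) * g i) =
    (\<Sum>i<Suc n. (spin_plus L $$ (a, i) * g i - mat_adjoint (spin_plus L) $$ (a, i) * g i) / (2 * \<i>))"
    using assms carrier_matD[OF plus_carrier] by (intro sum.cong) (auto simp: spin_y_def left_diff_distrib diff_divide_distrib)
  then show ?thesis unfolding sum_divide_distrib[symmetric] sum_subtractf plus_sum[OF assms] minus_sum[OF assms] .
qed

lemma z_sum:
  assumes "a < Suc n"
  shows "(\<Sum>i<Suc n. spin_z L $$ (a, i) * g i) = (of_nat n / 2 - of_nat a) * g a"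
proof -
  have l: "complex_of_real L = of_nat n / 2" using L by (simp add: complex_eq_iff)
  have "(\<Sum>i<Suc n. spin_z L $$ (a, i) * g i) = (\<Sum>i<Suc n. if i = a then (of_nat n / 2 - of_nat a) * g i else 0)"
    using assms by (intro sum.cong) (auto simp: spin_z_def dim mat_diag_def l)
  then show ?thesis using assms by (simp del: sum.lessThan_Suc)
qed

end

text \<open>The total spin squared acting on coefficients: the Casimir values
  \<open>J (J + 1)\<close> and \<open>K (K + 1)\<close> with \<open>n = 2J\<close> and
  \<open>m = 2K\<close>, twice the product of the z-components, and the two mixed products of a
  raising and a lowering operator. Terms that leave the index range have a vanishing
  \<open>ladder\<close> factor.\<close>

definition casimir :: "nat \<Rightarrow> nat \<Rightarrow> (nat \<Rightarrow> nat \<Rightarrow> complex) \<Rightarrow> nat \<Rightarrow> nat \<Rightarrow> complex" where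
  "casimir n m v a b =
     (of_nat n * (of_nat n + 2) / 4 + of_nat m * (of_nat m + 2) / 4 +
       (of_nat n - 2 * of_nat a) * (of_nat m - 2 * of_nat b) / 2) * v a b +
     ladder n (Suc a) * ladder m b * v (Suc a) (b - 1) + ladder n a * ladder m (Suc b) * v (a - 1) (Suc b)"

locale two_spins = J: spin J n + K: spin K m for J n K m
begin

lemma total_spin_carrier:
  assumes "S J \<in> carrier_mat (Suc n) (Suc n)" "S K \<in> carrier_mat (Suc m) (Suc m)"
  shows "total_spin S J K \<in> carrier_mat (Suc n * Suc m) (Suc n * Suc m)"
  using assms by (auto simp: total_spin_def tensor_mat_def J.dim K.dim intro!: carrier_matI)

lemma total_spin_mult_vec:
  assumes S: "S J \<in> carrier_mat (Suc n) (Suc n)" "S K \<in> carrier_mat (Suc m) (Suc m)"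
    and x: "x \<in> carrier_vec (Suc n * Suc m)" and ab: "a < Suc n" "b < Suc m"
  shows "tensor_coeff (Suc m) (total_spin S J K *\<^sub>v x) a b =
    (\<Sum>i<Suc n. S J $$ (a, i) * tensor_coeff (Suc m) x i b) + (\<Sum>i<Suc m. S K $$ (b, i) * tensor_coeff (Suc m) x a i)"
proof -
  let ?i = "a * Suc m + b"
  have i: "?i < Suc n * Suc m" using tensor_index_less[OF ab] .
  have c: "S J \<otimes>\<^sub>m 1\<^sub>m (Suc m) \<in> carrier_mat (Suc n * Suc m) (Suc n * Suc m)"
    "1\<^sub>m (Suc n) \<otimes>\<^sub>m S K \<in> carrier_mat (Suc n * Suc m) (Suc n * Suc m)"
    using S by (auto simp: tensor_mat_def)
  have "(total_spin S J K *\<^sub>v x) $ ?i = ((S J \<otimes>\<^sub>m 1\<^sub>m (Suc m)) *\<^sub>v x) $ ?i + ((1\<^sub>m (Suc n) \<otimes>\<^sub>m S K) *\<^sub>v x) $ ?i"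
    unfolding total_spin_def J.dim K.dim
    using i carrier_matD[OF c(1)] carrier_matD[OF c(2)]
    by (subst add_mult_distrib_mat_vec[OF c x]) simp
  also have "((S J \<otimes>\<^sub>m 1\<^sub>m (Suc m)) *\<^sub>v x) $ ?i =
      (\<Sum>a'<Suc n. \<Sum>b'<Suc m. if b' = b then S J $$ (a, a') * x $ (a' * Suc m + b') else 0)"
    unfolding tensor_mult_vec_index[OF S(1) one_carrier_mat x ab]
    using ab by (intro sum.cong refl) auto
  also have "\<dots> = (\<Sum>a'<Suc n. S J $$ (a, a') * x $ (a' * Suc m + b))"
    using ab by (simp del: sum.lessThan_Suc)
  also have "((1\<^sub>m (Suc n) \<otimes>\<^sub>m S K) *\<^sub>v x) $ ?i =
      (\<Sum>a'<Suc n. if a' = a then \<Sum>b'<Suc m. S K $$ (b, b') * x $ (a' * Suc m + b') else 0)"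
    unfolding tensor_mult_vec_index[OF one_carrier_mat S(2) x ab]
    using ab by (intro sum.cong refl) auto
  also have "\<dots> = (\<Sum>b'<Suc m. S K $$ (b, b') * x $ (a * Suc m + b'))"
    using ab by (simp del: sum.lessThan_Suc)
  finally show ?thesis by (simp add: tensor_coeff_def del: sum.lessThan_Suc)
qed

lemma total_spin_sq_mult_vec:
  assumes x: "x \<in> carrier_vec (Suc n * Suc m)" and ab: "a < Suc n" "b < Suc m"
  shows "tensor_coeff (Suc m) (total_spin_sq J K *\<^sub>v x) a b = casimir n m (tensor_coeff (Suc m) x) a b"
proof -
  define v where "v = tensor_coeff (Suc m) x"
  define tx where "tx v a b = (ladder n (Suc a) * v (Suc a) b + ladder n a * v (a - 1) b) / 2 +
    (ladder m (Suc b) * v a (Suc b) + ladder m b * v a (b - 1)) / 2" for v a b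
  define ty where "ty v a b = (ladder n (Suc a) * v (Suc a) b - ladder n a * v (a - 1) b) / (2 * \<i>) +
    (ladder m (Suc b) * v a (Suc b) - ladder m b * v a (b - 1)) / (2 * \<i>)" for v a b
  define tz where "tz v a b = (of_nat n / 2 - of_nat a) * v a b + (of_nat m / 2 - of_nat b) * v a b" for v :: "nat \<Rightarrow> nat \<Rightarrow> complex" and a b
  let ?X = "total_spin spin_x J K" and ?Y = "total_spin spin_y J K" and ?Z = "total_spin spin_z J K"
  let ?N = "Suc n * Suc m"
  have c: "?X \<in> carrier_mat ?N ?N" "?Y \<in> carrier_mat ?N ?N" "?Z \<in> carrier_mat ?N ?N"
    by (intro total_spin_carrier J.carriers K.carriers)+
  have twice: "tensor_coeff (Suc m) (total_spin S J K *\<^sub>v (total_spin S J K *\<^sub>v x)) a b = t (t v) a b"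
    if S: "S J \<in> carrier_mat (Suc n) (Suc n)" "S K \<in> carrier_mat (Suc m) (Suc m)"
      and t: "\<And>u a b. a < Suc n \<Longrightarrow> b < Suc m \<Longrightarrow>
        (\<Sum>i<Suc n. S J $$ (a, i) * u i b) + (\<Sum>i<Suc m. S K $$ (b, i) * u a i) = t u a b" for S t
  proof -
    have y: "total_spin S J K *\<^sub>v x \<in> carrier_vec ?N"
      using total_spin_carrier[of S] S x by (intro mult_mat_vec_carrier[of _ ?N ?N]) auto
    have "tensor_coeff (Suc m) (total_spin S J K *\<^sub>v (total_spin S J K *\<^sub>v x)) a b =
        (\<Sum>i<Suc n. S J $$ (a, i) * t v i b) + (\<Sum>i<Suc m. S K $$ (b, i) * t v a i)"
      unfolding total_spin_mult_vec[of S, OF S y ab]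
      using ab total_spin_mult_vec[of S, OF S x] t[of _ _ v]
      by (intro arg_cong2[where f = "(+)"] sum.cong refl) (simp_all add: v_def del: sum.lessThan_Suc)
    then show ?thesis using t[OF ab] by simp
  qed
  have "total_spin_sq J K *\<^sub>v x = ?X *\<^sub>v (?X *\<^sub>v x) + ?Y *\<^sub>v (?Y *\<^sub>v x) + ?Z *\<^sub>v (?Z *\<^sub>v x)"
  proof -
    have cc: "?X * ?X \<in> carrier_mat ?N ?N" "?Y * ?Y \<in> carrier_mat ?N ?N" "?Z * ?Z \<in> carrier_mat ?N ?N"
      using c by (auto intro: mult_carrier_mat)
    show ?thesis unfolding total_spin_sq_def
      using c cc x add_carrier_mat[OF cc(2), of "?X * ?X"]
      by (simp add: add_mult_distrib_mat_vec[of _ ?N ?N] assoc_mult_mat_vec[of _ ?N ?N])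
  qed
  then have "tensor_coeff (Suc m) (total_spin_sq J K *\<^sub>v x) a b = tensor_coeff (Suc m) (?X *\<^sub>v (?X *\<^sub>v x)) a b +
      tensor_coeff (Suc m) (?Y *\<^sub>v (?Y *\<^sub>v x)) a b + tensor_coeff (Suc m) (?Z *\<^sub>v (?Z *\<^sub>v x)) a b"
    using carrier_matD[OF c(1)] carrier_matD[OF c(2)] carrier_matD[OF c(3)] tensor_index_less[OF ab]
    by (simp add: tensor_coeff_def del: index_mult_mat_vec)
  also have "\<dots> = tx (tx v) a b + ty (ty v) a b + tz (tz v) a b"
  proof (intro arg_cong2[where f = "(+)"] twice J.carriers K.carriers)
    fix u :: "nat \<Rightarrow> nat \<Rightarrow> complex" and a b assume ab: "a < Suc n" "b < Suc m"
    show "(\<Sum>i<Suc n. spin_x J $$ (a, i) * u i b) + (\<Sum>i<Suc m. spin_x K $$ (b, i) * u a i) = tx u a b"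
      using ab by (simp add: J.x_sum K.x_sum tx_def del: sum.lessThan_Suc)
    show "(\<Sum>i<Suc n. spin_y J $$ (a, i) * u i b) + (\<Sum>i<Suc m. spin_y K $$ (b, i) * u a i) = ty u a b"
      using ab by (simp add: J.y_sum K.y_sum ty_def del: sum.lessThan_Suc)
    show "(\<Sum>i<Suc n. spin_z J $$ (a, i) * u i b) + (\<Sum>i<Suc m. spin_z K $$ (b, i) * u a i) = tz u a b"
      using ab by (simp add: J.z_sum K.z_sum tz_def del: sum.lessThan_Suc)
  qed
  also have "\<dots> = casimir n m v a b"
  proof -
    let ?S = "(ladder n (Suc a) * ladder n (Suc a) + ladder n a * ladder n a +
      ladder m (Suc b) * ladder m (Suc b) + ladder m b * ladder m b) / 2"
    have xy: "tx (tx v) a b + ty (ty v) a b =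
      ?S * v a b +
      ladder n (Suc a) * ladder m b * v (Suc a) (b - 1) + ladder n a * ladder m (Suc b) * v (a - 1) (Suc b)"
    proof -
      \<comment> \<open>The total raising and lowering operators. The squares of the x- and
        y-components add up to \<open>(P Q + Q P) / 2\<close>, in which the terms with two raisings
        or two lowerings have already cancelled.\<close>
      define P where "P v a b = ladder n (Suc a) * v (Suc a) b + ladder m (Suc b) * v a (Suc b)" for v :: "nat \<Rightarrow> nat \<Rightarrow> complex" and a b
      define Q where "Q v a b = ladder n a * v (a - 1) b + ladder m b * v a (b - 1)" for v :: "nat \<Rightarrow> nat \<Rightarrow> complex" and a b
      have lin: "P (\<lambda>a b. c * (u a b + e * u' a b)) a b = c * (P u a b + e * P u' a b)"
        "Q (\<lambda>a b. c * (u a b + e * u' a b)) a b = c * (Q u a b + e * Q u' a b)" for c e u u' a b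
        by (simp_all add: P_def Q_def algebra_simps)
      have x: "tx u = (\<lambda>a b. (1 / 2) * (P u a b + 1 * Q u a b))" for u
        by (intro ext) (simp add: tx_def P_def Q_def field_simps)
      have y: "ty u = (\<lambda>a b. (1 / (2 * \<i>)) * (P u a b + (- 1) * Q u a b))" for u
        by (intro ext) (simp add: ty_def P_def Q_def field_simps)
      have "tx (tx v) a b + ty (ty v) a b = (P (Q v) a b + Q (P v) a b) / 2"
        unfolding x y lin by (simp add: field_simps)
      also have "\<dots> = ?S * v a b +
      ladder n (Suc a) * ladder m b * v (Suc a) (b - 1) + ladder n a * ladder m (Suc b) * v (a - 1) (Suc b)"
        by (cases a; cases b) (simp_all add: P_def Q_def algebra_simps add_divide_distrib)
      finally show ?thesis .
    qed
    have "?S * v a b + tz (tz v) a b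
      = (of_nat n * (of_nat n + 2) / 4 + of_nat m * (of_nat m + 2) / 4 +
       (of_nat n - 2 * of_nat a) * (of_nat m - 2 * of_nat b) / 2) * v a b"
    proof -
      \<comment> \<open>The total z-component on the basis vector with indices \<open>a\<close> and
        \<open>b\<close>.\<close>
      let ?W = "of_nat n / 2 - of_nat a + (of_nat m / 2 - of_nat b) :: complex"
      have e: "?S
        + ?W * ?W
        = of_nat n * (of_nat n + 2) / 4 + of_nat m * (of_nat m + 2) / 4 +
       (of_nat n - 2 * of_nat a) * (of_nat m - 2 * of_nat b) / 2"
        using ab by (simp add: ladder_mult_self) (simp add: field_simps)
      have "tz (tz v) a b = ?W * ?W * v a b"
        by (simp only: tz_def distrib_right[symmetric] mult.assoc)
      then show ?thesis by (simp only: e distrib_right[symmetric])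
    qed
    then show ?thesis unfolding xy casimir_def by (simp add: algebra_simps)
  qed
  finally show ?thesis by (simp add: v_def)
qed

end

section \<open>The subspace of minimal total spin\<close>

text \<open>The norm of the monomial \<open>z\<^sub>1\<^bsup>n-a\<^esup> z\<^sub>2\<^bsup>a\<^esup>\<close> in Bargmann space.\<close>

definition mnorm :: "nat \<Rightarrow> nat \<Rightarrow> real" where
  "mnorm n a = sqrt (fact a * fact (n - a))"

lemma mnorm_pos: "0 < mnorm n a"
  by (simp add: mnorm_def)

lemma mnorm_square: "mnorm n a * mnorm n a = fact a * fact (n - a)"
  by (simp add: mnorm_def)

lemma mnorm_reflect: "a \<le> n \<Longrightarrow> mnorm n (n - a) = mnorm n a"
  by (simp add: mnorm_def mult.commute)

lemma mnorm_Suc_left: "a \<le> n \<Longrightarrow> mnorm (Suc n) a = sqrt (real (Suc n - a)) * mnorm n a"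
  by (simp add: mnorm_def Suc_diff_le flip: real_sqrt_mult)

lemma mnorm_Suc_Suc: "mnorm (Suc n) (Suc a) = sqrt (real (Suc a)) * mnorm n a"
  by (simp add: mnorm_def mult.assoc flip: real_sqrt_mult)

lemma mnorm_ratio: "a < n \<Longrightarrow> sqrt (real (n - a)) * mnorm n (Suc a) = sqrt (real (Suc a)) * mnorm n a"
proof -
  assume "a < n"
  then obtain k where n: "n = Suc (a + k)" using less_imp_Suc_add by blast
  show ?thesis by (simp add: n mnorm_def algebra_simps flip: real_sqrt_mult)
qed

text \<open>The basis vector \<open>a\<close> of the smaller spin is paired, up to the sign, with
  the product of the reflected basis vector \<open>n - a\<close> and a monomial with
  \<open>i\<close> factors of the second mode. This product is the monomial of index
  \<open>b = n - a + i\<close>; dividing by \<open>mnorm n a\<close> and multiplying by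
  \<open>mnorm m b\<close> accounts for the normalisations, and \<open>a + b = n + i\<close> is
  constant along the vector.\<close>

definition min_weight :: "nat \<Rightarrow> nat \<Rightarrow> nat \<Rightarrow> nat \<Rightarrow> real" where
  "min_weight n m a b = (- 1) ^ a * mnorm m b / mnorm n a"

text \<open>The coefficients of \<open>D v\<close>, where \<open>D\<close> sums over the two modes
  the product of the annihilator on the smaller spin and the creator on the larger. The result is
  indexed by \<open>a < n\<close> and \<open>b \<le> Suc m\<close>.\<close>

definition two_term :: "nat \<Rightarrow> nat \<Rightarrow> (nat \<Rightarrow> nat \<Rightarrow> complex) \<Rightarrow> nat \<Rightarrow> nat \<Rightarrow> complex" where
  "two_term n m v a b = nsqrt (n - a) * nsqrt (Suc m - b) * v a b + nsqrt (Suc a) * nsqrt b * v (Suc a) (b - 1)"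

text \<open>Division by \<open>min_weight\<close> turns the recurrence into constancy along the
  antidiagonals \<open>a + b = c\<close>, and \<open>\<kappa> c\<close> is the constant.\<close>

lemma two_term_solution:
  fixes v :: "nat \<Rightarrow> nat \<Rightarrow> complex"
  assumes nm: "n \<le> m"
    and y: "\<And>a b. a < n \<Longrightarrow> b \<le> Suc m \<Longrightarrow> two_term n m v a b = 0"
  shows "\<exists>\<kappa>. (\<forall>c. c < n \<or> m < c \<longrightarrow> \<kappa> c = 0) \<and>
    (\<forall>a\<le>n. \<forall>b\<le>m. v a b = complex_of_real (min_weight n m a b) * \<kappa> (a + b))"
proof -
  define u where "u a b = v a b / complex_of_real (min_weight n m a b)" for a b
  have hh0: "complex_of_real (min_weight n m a b) \<noteq> 0" for a b
    using mnorm_pos[of m b] mnorm_pos[of n a] by (simp add: min_weight_def)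
  have v0: "v a b = 0" if "u a b = 0" for a b using that hh0 by (simp add: u_def)
  have step: "u (Suc a) b = u a (Suc b)" if a: "a < n" and b: "b < m" for a b
  proof -
    have e: "nsqrt (n - a) * nsqrt (Suc m - Suc b) * v a (Suc b) = - (nsqrt (Suc a) * nsqrt (Suc b) * v (Suc a) b)"
      using y[OF a, of "Suc b"] b by (simp add: two_term_def eq_neg_iff_add_eq_0)
    have h: "nsqrt (n - a) * nsqrt (m - b) * complex_of_real (min_weight n m a (Suc b)) =
        - (nsqrt (Suc a) * nsqrt (Suc b) * complex_of_real (min_weight n m (Suc a) b))"
    proof -
      have "sqrt (real (n - a)) * sqrt (real (m - b)) * min_weight n m a (Suc b) =
          - (sqrt (real (Suc a)) * sqrt (real (Suc b)) * min_weight n m (Suc a) b)"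
        using arg_cong2[OF mnorm_ratio[OF a] mnorm_ratio[OF b], of "\<lambda>x y. x * y"] mnorm_pos[of n a] mnorm_pos[of n "Suc a"]
        by (simp add: min_weight_def field_simps)
      then show ?thesis by (simp add: nsqrt_def flip: of_real_mult of_real_minus)
    qed
    have cancel: "w * h' = v' * h"
      if "A * v' = - (B * w)" "A * h' = - (B * h)" "A \<noteq> 0" "B \<noteq> 0" for A B h h' v' w :: complex
    proof -
      have "(A * B) * (w * h') = (A * h') * (B * w)" by (simp only: ac_simps)
      also have "\<dots> = (B * h) * (- (B * w))" unfolding that(2) by simp
      also have "\<dots> = (A * B) * (v' * h)" unfolding that(1)[symmetric] by (simp only: ac_simps)
      finally show ?thesis using that(3,4) by simp
    qed
    have "nsqrt (n - a) * nsqrt (m - b) \<noteq> 0" "nsqrt (Suc a) * nsqrt (Suc b) \<noteq> 0" using a b by (simp_all add: nsqrt_def)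
    from cancel[OF _ h this, of "v a (Suc b)" "v (Suc a) b"] e show ?thesis
      using hh0[of "Suc a" b] hh0[of a "Suc b"] unfolding u_def by (simp add: frac_eq_eq)
  qed
  have up: "u a b = u (a + j) (b - j)" if "a + j \<le> n" "j \<le> b" "b \<le> m" for a b j
    using that
  proof (induction j)
    case (Suc j)
    then show ?case using step[of "a + j" "b - Suc j"] by (simp add: Suc_diff_Suc)
  qed simp
  \<comment> \<open>For \<open>b = 0\<close> and \<open>b = Suc m\<close> one of the two terms drops
    out and the other is forced to vanish. An antidiagonal meets one of these zeros exactly if
    \<open>a + b\<close> lies outside \<open>{n..m}\<close>.\<close>
  have b0: "u a 0 = 0" if "a < n" for a
    using y[OF that, of 0] that by (simp add: two_term_def u_def nsqrt_def)
  have bm: "u (Suc a) m = 0" if "a < n" for a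
    using y[OF that, of "Suc m"] by (simp add: two_term_def u_def nsqrt_def)
  define \<kappa> where "\<kappa> c = (if n \<le> c \<and> c \<le> m then u 0 c else 0)" for c
  have U: "u a b = \<kappa> (a + b)" if ab: "a \<le> n" "b \<le> m" for a b
  proof -
    consider "a + b < n" | "m < a + b" | "n \<le> a + b" "a + b \<le> m" by linarith
    then show ?thesis
    proof cases
      case 1
      then show ?thesis using up[of a b b] b0[of "a + b"] ab by (simp add: \<kappa>_def)
    next
      case 2
      have "u (a - (m - b)) m = u a b" using up[of "a - (m - b)" "m - b" m] ab 2 by simp
      moreover have "u (a - (m - b)) m = 0" 
      proof -
        have "a - (m - b) = Suc (a + b - Suc m)" "a + b - Suc m < n" using ab 2 by auto
        then show ?thesis using bm by simp
      qed
      ultimately show ?thesis using 2 by (simp add: \<kappa>_def)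
    next
      case 3
      then show ?thesis using up[of 0 a "a + b"] ab by (simp add: \<kappa>_def)
    qed
  qed
  have "v a b = complex_of_real (min_weight n m a b) * \<kappa> (a + b)" if "a \<le> n" "b \<le> m" for a b
    using U[OF that] hh0[of a b] unfolding u_def by (simp add: divide_eq_eq mult.commute)
  moreover have "\<forall>c. c < n \<or> m < c \<longrightarrow> \<kappa> c = 0" by (auto simp: \<kappa>_def)
  ultimately show ?thesis by blast
qed

text \<open>In the interior the two terms cancel by the ratios of norms. At \<open>b = 0\<close> and
  \<open>b = Suc m\<close> the surviving term lies on an antidiagonal where \<open>\<kappa>\<close>
  vanishes.\<close>

lemma solution_two_term:
  assumes \<kappa>: "\<And>c. c < n \<or> m < c \<Longrightarrow> \<kappa> c = 0"
    and v: "\<And>a b. a \<le> n \<Longrightarrow> b \<le> m \<Longrightarrow> v a b = complex_of_real (min_weight n m a b) * \<kappa> (a + b)"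
    and a: "a < n" and b: "b \<le> Suc m"
  shows "two_term n m v a b = 0"
proof -
  consider "b = 0" | "b = Suc m" | b' where "b = Suc b'" "b' < m" using b by (metis le_less not0_implies_Suc Suc_less_eq)
  then show ?thesis
  proof cases
    case 1
    then show ?thesis using v[of a 0] \<kappa>[of a] a by (simp add: two_term_def)
  next
    case 2
    then show ?thesis using v[of "Suc a" m] \<kappa>[of "Suc a + m"] a by (simp add: two_term_def)
  next
    case 3
    have "sqrt (real (n - a)) * sqrt (real (m - b')) * min_weight n m a (Suc b') =
        - (sqrt (real (Suc a)) * sqrt (real (Suc b')) * min_weight n m (Suc a) b')"
      using arg_cong2[OF mnorm_ratio[OF a] mnorm_ratio[OF 3(2)], of "\<lambda>x y. x * y"] mnorm_pos[of n a] mnorm_pos[of n "Suc a"]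
      by (simp add: min_weight_def field_simps)
    then have "nsqrt (n - a) * nsqrt (m - b') * complex_of_real (min_weight n m a (Suc b')) =
        - (nsqrt (Suc a) * nsqrt (Suc b') * complex_of_real (min_weight n m (Suc a) b'))"
      by (simp add: nsqrt_def flip: of_real_mult of_real_minus)
    then show ?thesis using a 3 v[of a "Suc b'"] v[of "Suc a" b'] by (simp add: two_term_def flip: mult.assoc)
  qed
qed

text \<open>The recurrence is solved upwards from \<open>a = 0\<close> if \<open>a + b \<le> m\<close> and downwards from \<open>a = n\<close>
  otherwise.\<close>

lemma two_term_adjoint_injective:
  assumes nm: "n \<le> m"
    and E: "\<And>a b. a \<le> n \<Longrightarrow> b \<le> m \<Longrightarrow>
      nsqrt (n - a) * nsqrt (Suc m - b) * y a b + nsqrt a * nsqrt (Suc b) * y (a - 1) (Suc b) = 0"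
    and a: "a < n" and b: "b \<le> Suc m"
  shows "y a b = 0"
proof (cases "a + b \<le> m")
  case True
  then show ?thesis using a
  proof (induction a arbitrary: b)
    case 0
    then show ?case using E[of 0 b] by (simp add: nsqrt_def)
  next
    case (Suc a)
    then have "y a (Suc b) = 0" by simp
    then show ?case using E[of "Suc a" b] Suc.prems by (simp add: nsqrt_def)
  qed
next
  case False
  have "y a b = 0" if "n = Suc (a + j)" "b \<le> Suc m" "m < a + b" for j
    using that
  proof (induction j arbitrary: a b)
    case 0
    then obtain b' where "b = Suc b'" using nm by (cases b) auto
    then show ?case using E[of n b'] 0 by (simp add: nsqrt_def)
  next
    case (Suc j)
    then obtain b' where b': "b = Suc b'" using nm by (cases b) auto
    then have "y (Suc a) b' = 0" using Suc by simp
    then show ?case using E[of "Suc a" b'] Suc.prems b' by (simp add: nsqrt_def)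
  qed
  then show ?thesis using a b False less_imp_Suc_add by (metis not_le)
qed

text \<open>The coefficient of \<open>x ^ n\<close> in the product of \<open>(1 - x)\<close> to the
  powers \<open>-(i + 1)\<close> and \<open>-(l + 1)\<close>, here proved by Pascal's rule in a
  double induction.\<close>

lemma choose_convolution:
  "(\<Sum>j\<le>n. (i + j choose j) * (l + (n - j) choose (n - j))) = (Suc (i + l + n) choose n)"
proof (induction n arbitrary: l)
  case 0
  then show ?case by simp
next
  case (Suc n)
  note IHn = Suc.IH
  show ?case
  proof (induction l)
    case 0
    have "(\<Sum>j\<le>Suc n. (i + j choose j) * (0 + (Suc n - j) choose (Suc n - j))) = (\<Sum>j\<le>Suc n. i + j choose j)"
      by (intro sum.cong) auto
    also have "\<dots> = Suc (i + Suc n) choose Suc n" by (rule sum_choose_lower)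
    finally show ?case by simp
  next
    case (Suc l)
    have "(\<Sum>j\<le>Suc n. (i + j choose j) * (Suc l + (Suc n - j) choose (Suc n - j))) =
       (\<Sum>j\<le>n. (i + j choose j) * (Suc l + (Suc n - j) choose (Suc n - j))) + (i + Suc n choose Suc n)"
      by simp
    also have "(\<Sum>j\<le>n. (i + j choose j) * (Suc l + (Suc n - j) choose (Suc n - j))) =
        (\<Sum>j\<le>n. (i + j choose j) * (Suc l + (n - j) choose (n - j)) + (i + j choose j) * (l + (Suc n - j) choose (Suc n - j)))"
      by (intro sum.cong) (auto simp: Suc_diff_le algebra_simps)
    also have "\<dots> + (i + Suc n choose Suc n) = (\<Sum>j\<le>n. (i + j choose j) * (Suc l + (n - j) choose (n - j))) +
        (\<Sum>j\<le>Suc n. (i + j choose j) * (l + (Suc n - j) choose (Suc n - j)))"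
      by (simp add: sum.distrib)
    also have "\<dots> = Suc (i + Suc l + Suc n) choose Suc n"
      unfolding IHn Suc by simp
    finally show ?case .
  qed
qed

text \<open>With \<open>i\<close> and \<open>l\<close> bosons in the two modes of spin
  \<open>(m - n) / 2\<close>, the factor \<open>fact i * fact l\<close> is the squared norm of their
  monomial. The binomial coefficient does not depend on \<open>i\<close>, as it should be for an
  intertwiner of irreducible representations.\<close>

lemma min_weight_norm:
  assumes "i + l = m - n" "n \<le> m"
  shows "(\<Sum>a\<le>n. (min_weight n m a (n + i - a))\<^sup>2) = fact i * fact l * real (Suc m choose n)"
proof -
  have "(min_weight n m a (n + i - a))\<^sup>2 = fact i * fact l * real ((l + a choose a) * (i + (n - a) choose (n - a)))" if a: "a \<le> n" for a
  proof -
    have m: "m - (n + i - a) = l + a" "n + i - a = i + (n - a)" using assms a by auto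
    have "(min_weight n m a (n + i - a))\<^sup>2 = (fact (i + (n - a)) * fact (l + a)) / (fact a * fact (n - a))"
    proof -
      have "(min_weight n m a (n + i - a))\<^sup>2 = (mnorm m (n + i - a))\<^sup>2 / (mnorm n a)\<^sup>2"
        by (simp add: min_weight_def power_divide power_mult_distrib flip: power_mult)
      then show ?thesis using mnorm_square[of m "n + i - a"] mnorm_square[of n a] m by (simp add: power2_eq_square)
    qed
    also have "\<dots> = fact i * fact l * (real (l + a choose a) * real (i + (n - a) choose (n - a)))"
      using binomial_fact[of a "l + a", where 'a = real] binomial_fact[of "n - a" "i + (n - a)", where 'a = real]
      by simp
    finally show ?thesis by simp
  qed
  then have "(\<Sum>a\<le>n. (min_weight n m a (n + i - a))\<^sup>2) = (\<Sum>a\<le>n. fact i * fact l * real ((l + a choose a) * (i + (n - a) choose (n - a))))"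
    by (intro sum.cong) auto
  also have "\<dots> = fact i * fact l * real (\<Sum>a\<le>n. (l + a choose a) * (i + (n - a) choose (n - a)))"
    by (simp add: sum_distrib_left)
  also have "(\<Sum>a\<le>n. (l + a choose a) * (i + (n - a) choose (n - a))) = (Suc m choose n)"
    unfolding choose_convolution using assms by (simp add: add.commute)
  finally show ?thesis .
qed

lemma casimir_swap: "casimir n m v a b = casimir m n (\<lambda>b a. v a b) b a"
  by (simp add: casimir_def algebra_simps)

text \<open>The outer coefficients are those of the adjoint of \<open>D\<close>, applied to
  \<open>D v\<close>. The diagonal parts agree as polynomials in \<open>a\<close>, \<open>b\<close>,
  \<open>n\<close>, \<open>m\<close>, and the off-diagonal parts are regroupings of the same square
  roots.\<close>

lemma casimir_factor:
  assumes a: "a \<le> n" and b: "b \<le> m"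
  defines "s \<equiv> (of_nat m - of_nat n) / 2"
  shows "casimir n m v a b - s * (s + 1) * v a b =
    nsqrt (n - a) * nsqrt (Suc m - b) * two_term n m v a b + nsqrt a * nsqrt (Suc b) * two_term n m v (a - 1) (Suc b)"
proof -
  have r: "nsqrt (n - a) * nsqrt (Suc m - b) * two_term n m v a b =
      (of_nat n - of_nat a) * (of_nat m + 1 - of_nat b) * v a b + ladder n (Suc a) * ladder m b * v (Suc a) (b - 1)"
  proof -
    have "nsqrt (n - a) * nsqrt (Suc m - b) * two_term n m v a b =
      (nsqrt (n - a) * nsqrt (n - a)) * (nsqrt (Suc m - b) * nsqrt (Suc m - b)) * v a b +
      (nsqrt (Suc a) * nsqrt (n - a)) * (nsqrt b * nsqrt (Suc m - b)) * v (Suc a) (b - 1)"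
      unfolding two_term_def by (simp only: algebra_simps)
    then show ?thesis using a b by (simp add: ladder_def of_nat_diff)
  qed
  have l: "nsqrt a * nsqrt (Suc b) * two_term n m v (a - 1) (Suc b) =
      of_nat a * (of_nat b + 1) * v a b + ladder n a * ladder m (Suc b) * v (a - 1) (Suc b)"
  proof (cases a)
    case (Suc a')
    have "nsqrt (Suc a') * nsqrt (Suc b) * two_term n m v a' (Suc b) =
      (nsqrt (Suc a') * nsqrt (Suc a')) * (nsqrt (Suc b) * nsqrt (Suc b)) * v (Suc a') b +
      (nsqrt (Suc a') * nsqrt (n - a')) * (nsqrt (Suc b) * nsqrt (Suc m - Suc b)) * v a' (Suc b)"
      unfolding two_term_def by (simp add: algebra_simps del: nsqrt_mult_self)
    then show ?thesis by (simp add: Suc ladder_def add.commute)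
  qed simp
  have "of_nat n * (of_nat n + 2) / 4 + of_nat m * (of_nat m + 2) / 4 +
       (of_nat n - 2 * of_nat a) * (of_nat m - 2 * of_nat b) / 2 - s * (s + 1) =
      (of_nat n - of_nat a) * (of_nat m + 1 - of_nat b) + of_nat a * (of_nat b + 1)"
    unfolding s_def by (simp add: field_simps)
  then have "(of_nat n * (of_nat n + 2) / 4 + of_nat m * (of_nat m + 2) / 4 +
       (of_nat n - 2 * of_nat a) * (of_nat m - 2 * of_nat b) / 2) =
      (of_nat n - of_nat a) * (of_nat m + 1 - of_nat b) + of_nat a * (of_nat b + 1) + s * (s + 1)"
    by (simp only: diff_eq_eq)
  then show ?thesis unfolding r l casimir_def by (simp only: distrib_right) simp
qed

text \<open>By \<open>casimir_factor\<close> the eigenvalue equation says that the adjoint of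
  \<open>D\<close> kills \<open>D v\<close>; injectivity of this adjoint gives
  \<open>D v = 0\<close>, which is then solved explicitly.\<close>

lemma casimir_eigen_iff:
  assumes nm: "n \<le> m"
  defines "s \<equiv> (of_nat m - of_nat n) / 2"
  shows "(\<forall>a\<le>n. \<forall>b\<le>m. casimir n m v a b = s * (s + 1) * v a b) \<longleftrightarrow>
    (\<exists>\<kappa>. (\<forall>c. c < n \<or> m < c \<longrightarrow> \<kappa> c = 0) \<and>
      (\<forall>a\<le>n. \<forall>b\<le>m. v a b = complex_of_real (min_weight n m a b) * \<kappa> (a + b)))" (is "?L \<longleftrightarrow> ?R")
proof
  assume L: ?L
  have E: "nsqrt (n - a) * nsqrt (Suc m - b) * two_term n m v a b + nsqrt a * nsqrt (Suc b) * two_term n m v (a - 1) (Suc b) = 0"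
    if "a \<le> n" "b \<le> m" for a b
  proof -
    have c: "casimir n m v a b = s * (s + 1) * v a b" using L that by blast
    from casimir_factor[OF that, of v, folded s_def] show ?thesis
      unfolding c diff_self by (rule sym)
  qed
  show ?R
    by (rule two_term_solution[OF nm]) (rule two_term_adjoint_injective[OF nm E])
next
  assume ?R
  then obtain \<kappa> where \<kappa>: "\<And>c. c < n \<or> m < c \<Longrightarrow> \<kappa> c = 0"
    and v: "\<And>a b. a \<le> n \<Longrightarrow> b \<le> m \<Longrightarrow> v a b = complex_of_real (min_weight n m a b) * \<kappa> (a + b)" by blast
  note y = solution_two_term[of n m \<kappa> v, OF \<kappa> v]
  show ?L
  proof (intro allI impI)
    fix a b assume ab: "a \<le> n" "b \<le> m"
    have z1: "nsqrt (n - a) * nsqrt (Suc m - b) * two_term n m v a b = 0"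
      using y[of a b] ab by (cases "a = n") auto
    have z2: "nsqrt a * nsqrt (Suc b) * two_term n m v (a - 1) (Suc b) = 0"
      using y[of "a - 1" "Suc b"] ab by (cases "a = 0") auto
    from casimir_factor[OF ab, of v, folded s_def] show "casimir n m v a b = s * (s + 1) * v a b"
      unfolding z1 z2 by simp
  qed
qed

section \<open>Explicit orthogonal projections\<close>

lemma mult_unit_vec_eq_col:
  "A \<in> carrier_mat m n \<Longrightarrow> j < n \<Longrightarrow> A *\<^sub>v unit_vec n j = col A j" for A :: "'a::semiring_1 mat"
  by (intro eq_vecI) auto

text \<open>An orthogonal sum of lines, one for each antidiagonal \<open>a + b = c\<close> with
  \<open>c\<close> from \<open>lo\<close> to \<open>hi\<close>. Hence its projection has the closed
  form \<open>wproj\<close>, where \<open>nc c\<close> is the squared norm of the vector spanning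
  the line. The weights are left general so that either tensor factor can be the smaller
  one.\<close>

definition wspace :: "nat \<Rightarrow> nat \<Rightarrow> (nat \<Rightarrow> nat \<Rightarrow> real) \<Rightarrow> nat \<Rightarrow> nat \<Rightarrow> complex vec set" where
  "wspace n m w lo hi = {x \<in> carrier_vec (Suc n * Suc m).
     \<exists>\<kappa>. (\<forall>c. c < lo \<or> hi < c \<longrightarrow> \<kappa> c = 0) \<and>
       (\<forall>a\<le>n. \<forall>b\<le>m. tensor_coeff (Suc m) x a b = complex_of_real (w a b) * \<kappa> (a + b))}"

definition wproj :: "nat \<Rightarrow> nat \<Rightarrow> (nat \<Rightarrow> nat \<Rightarrow> real) \<Rightarrow> nat \<Rightarrow> nat \<Rightarrow> (nat \<Rightarrow> real) \<Rightarrow> complex mat" where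
  "wproj n m w lo hi nc = Matrix.mat (Suc n * Suc m) (Suc n * Suc m) (\<lambda>(i, j).
     let a = i div Suc m; b = i mod Suc m; a' = j div Suc m; b' = j mod Suc m in
     if a + b = a' + b' \<and> lo \<le> a + b \<and> a + b \<le> hi
     then complex_of_real (w a b * w a' b' / nc (a + b)) else 0)"

lemma wproj_carrier [simp]: "wproj n m w lo hi nc \<in> carrier_mat (Suc n * Suc m) (Suc n * Suc m)"
  by (simp add: wproj_def)

lemma wproj_dim [simp]: "dim_row (wproj n m w lo hi nc) = Suc n * Suc m" "dim_col (wproj n m w lo hi nc) = Suc n * Suc m"
  by (simp_all add: wproj_def)

lemma wproj_index:
  assumes "a \<le> n" "b \<le> m" "a' \<le> n" "b' \<le> m"
  shows "wproj n m w lo hi nc $$ (a * Suc m + b, a' * Suc m + b') =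
    (if a + b = a' + b' \<and> lo \<le> a + b \<and> a + b \<le> hi
     then complex_of_real (w a b * w a' b' / nc (a + b)) else 0)"
proof -
  have "(a * Suc m + b) div Suc m = a" "(a * Suc m + b) mod Suc m = b"
    "(a' * Suc m + b') div Suc m = a'" "(a' * Suc m + b') mod Suc m = b'"
    using assms by (simp_all del: mult_Suc_right)
  then show ?thesis
    using tensor_index_less[of a "Suc n" b "Suc m"] tensor_index_less[of a' "Suc n" b' "Suc m"] assms
    by (simp add: wproj_def Let_def del: mult_Suc_right mult_Suc)
qed

lemma vec_eq_tensor_coeff:
  assumes "x \<in> carrier_vec (M * N)" "y \<in> carrier_vec (M * N)"
    and "\<And>a b. a < M \<Longrightarrow> b < N \<Longrightarrow> tensor_coeff N x a b = tensor_coeff N y a b"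
  shows "x = y"
proof (rule eq_vecI)
  fix i assume "i < dim_vec y"
  then have i: "i < M * N" using assms by simp
  then have "i div N < M" "i mod N < N"
    by (auto simp: less_mult_imp_div_less) (metis mod_less_divisor mult_0_right not_gr_zero not_less_zero)
  from assms(3)[OF this] show "x $ i = y $ i" by (simp add: tensor_coeff_def)
qed (use assms in auto)

context
  fixes n m lo hi :: nat and w :: "nat \<Rightarrow> nat \<Rightarrow> real" and nc :: "nat \<Rightarrow> real"
  assumes nc: "\<And>c. lo \<le> c \<Longrightarrow> c \<le> hi \<Longrightarrow> nc c = (\<Sum>a\<le>n. \<Sum>b\<le>m. if a + b = c then (w a b)\<^sup>2 else 0)"
    and nc0: "\<And>c. lo \<le> c \<Longrightarrow> c \<le> hi \<Longrightarrow> nc c \<noteq> 0"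
begin

lemma wproj_mult_vec:
  assumes x: "x \<in> carrier_vec (Suc n * Suc m)" and ab: "a \<le> n" "b \<le> m"
  shows "tensor_coeff (Suc m) (wproj n m w lo hi nc *\<^sub>v x) a b = complex_of_real (w a b) *
    (if lo \<le> a + b \<and> a + b \<le> hi
     then (\<Sum>a'\<le>n. \<Sum>b'\<le>m. if a' + b' = a + b then complex_of_real (w a' b') * tensor_coeff (Suc m) x a' b' else 0) / complex_of_real (nc (a + b))
     else 0)"
proof -
  let ?P = "wproj n m w lo hi nc"
  have "tensor_coeff (Suc m) (?P *\<^sub>v x) a b = (\<Sum>i<Suc n * Suc m. ?P $$ (a * Suc m + b, i) * x $ i)"
    using x tensor_index_less[of a "Suc n" b "Suc m"] ab
    by (simp add: tensor_coeff_def scalar_prod_def atLeast0LessThan del: mult_Suc_right mult_Suc)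
  also have "\<dots> = (\<Sum>a'\<le>n. \<Sum>b'\<le>m. ?P $$ (a * Suc m + b, a' * Suc m + b') * tensor_coeff (Suc m) x a' b')"
    unfolding sum_lessThan_mult lessThan_Suc_atMost tensor_coeff_def ..
  also have "\<dots> = (\<Sum>a'\<le>n. \<Sum>b'\<le>m. complex_of_real (w a b) *
      (if lo \<le> a + b \<and> a + b \<le> hi then (if a' + b' = a + b then complex_of_real (w a' b') * tensor_coeff (Suc m) x a' b' else 0) / complex_of_real (nc (a + b)) else 0))"
    using ab by (intro sum.cong refl) (auto simp: wproj_index simp del: mult_Suc_right mult_Suc)
  finally show ?thesis
    by (cases "lo \<le> a + b \<and> a + b \<le> hi") (auto simp: sum_distrib_left sum_divide_distrib)
qed

lemma wproj_mult_vec_in: "x \<in> carrier_vec (Suc n * Suc m) \<Longrightarrow> wproj n m w lo hi nc *\<^sub>v x \<in> wspace n m w lo hi"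
  unfolding wspace_def
  by (intro CollectI conjI exI[of _ "\<lambda>c. if lo \<le> c \<and> c \<le> hi
      then (\<Sum>a'\<le>n. \<Sum>b'\<le>m. if a' + b' = c then complex_of_real (w a' b') * tensor_coeff (Suc m) x a' b' else 0) / complex_of_real (nc c)
      else 0"] mult_mat_vec_carrier[OF wproj_carrier]) (auto simp: wproj_mult_vec)

lemma wproj_fixes:
  assumes "x \<in> wspace n m w lo hi"
  shows "wproj n m w lo hi nc *\<^sub>v x = x"
proof -
  obtain \<kappa> where x: "x \<in> carrier_vec (Suc n * Suc m)" and \<kappa>: "\<And>c. c < lo \<or> hi < c \<Longrightarrow> \<kappa> c = 0"
    and xk: "\<And>a b. a \<le> n \<Longrightarrow> b \<le> m \<Longrightarrow> tensor_coeff (Suc m) x a b = complex_of_real (w a b) * \<kappa> (a + b)"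
    using assms by (auto simp: wspace_def)
  have s: "(\<Sum>a'\<le>n. \<Sum>b'\<le>m. if a' + b' = c then complex_of_real (w a' b') * tensor_coeff (Suc m) x a' b' else 0)
      = complex_of_real (nc c) * \<kappa> c" if c: "lo \<le> c" "c \<le> hi" for c
  proof -
    have "(\<Sum>a'\<le>n. \<Sum>b'\<le>m. if a' + b' = c then complex_of_real (w a' b') * tensor_coeff (Suc m) x a' b' else 0)
      = (\<Sum>a'\<le>n. \<Sum>b'\<le>m. complex_of_real (if a' + b' = c then (w a' b')\<^sup>2 else 0) * \<kappa> c)"
      by (intro sum.cong refl) (auto simp: xk power2_eq_square)
    then show ?thesis unfolding nc[OF c] by (simp only: of_real_sum sum_distrib_right)
  qed
  show ?thesis
  proof (rule vec_eq_tensor_coeff[of _ "Suc n" "Suc m"])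
    fix a b assume "a < Suc n" "b < Suc m"
    then have ab: "a \<le> n" "b \<le> m" by auto
    show "tensor_coeff (Suc m) (wproj n m w lo hi nc *\<^sub>v x) a b = tensor_coeff (Suc m) x a b"
      unfolding wproj_mult_vec[OF x ab] xk[OF ab]
      using s[of "a + b"] nc0[of "a + b"] \<kappa>[of "a + b"] by (auto simp: not_le)
  qed (use x mult_mat_vec_carrier[OF wproj_carrier] in blast)+
qed

lemma is_orth_proj_wproj: "is_orth_proj (Suc n * Suc m) (wspace n m w lo hi) (wproj n m w lo hi nc)"
proof -
  let ?P = "wproj n m w lo hi nc" and ?N = "Suc n * Suc m"
  have "mat_adjoint ?P = ?P"
  proof (rule eq_matI)
    fix i j assume "i < dim_row ?P" "j < dim_col ?P"
    then have ij: "i < ?N" "j < ?N" by (simp_all del: mult_Suc_right mult_Suc)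
    have "mat_adjoint ?P $$ (i, j) = cnj (?P $$ (j, i))"
      using ij by (intro index_mat_adjoint) (simp_all del: mult_Suc_right mult_Suc)
    also have "\<dots> = ?P $$ (i, j)" using ij
      by (auto simp: wproj_def Let_def mult.commute simp del: mult_Suc_right mult_Suc)
    finally show "mat_adjoint ?P $$ (i, j) = ?P $$ (i, j)" .
  qed simp_all
  moreover have "?P * ?P = ?P"
  proof (rule eq_matI)
    fix i j assume "i < dim_row ?P" "j < dim_col ?P"
    then have ij: "i < ?N" "j < ?N" by (simp_all del: mult_Suc_right mult_Suc)
    have "?P *\<^sub>v unit_vec ?N j = col ?P j"
      using ij(2) by (intro mult_unit_vec_eq_col[OF wproj_carrier]) 
    then have "col ?P j \<in> wspace n m w lo hi"
      using wproj_mult_vec_in[of "unit_vec ?N j"] by (metis unit_vec_carrier)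
    from wproj_fixes[OF this] have "(?P *\<^sub>v col ?P j) $ i = col ?P j $ i" by simp
    then show "(?P * ?P) $$ (i, j) = ?P $$ (i, j)"
      using ij by (simp del: mult_Suc_right mult_Suc)
  qed simp_all
  moreover have "(\<lambda>v. ?P *\<^sub>v v) ` carrier_vec ?N = wspace n m w lo hi"
  proof
    show "wspace n m w lo hi \<subseteq> (\<lambda>v. ?P *\<^sub>v v) ` carrier_vec ?N"
    proof
      fix x assume x: "x \<in> wspace n m w lo hi"
      then have "x \<in> carrier_vec ?N" unfolding wspace_def by blast
      with wproj_fixes[OF x] show "x \<in> (\<lambda>v. ?P *\<^sub>v v) ` carrier_vec ?N" by (metis imageI)
    qed
  qed (rule image_subsetI, rule wproj_mult_vec_in)
  ultimately show ?thesis by (simp add: is_orth_proj_def hermitian_mat_def del: mult_Suc_right mult_Suc)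
qed

end

text \<open>Each of two projections with the same range fixes the columns of the other, so
  \<open>P * Q = Q\<close> and \<open>Q * P = P\<close>; taking adjoints of the first shows that
  they are equal.\<close>

lemma orth_proj_eq:
  assumes P: "is_orth_proj N V P"
  shows "orth_proj N V = P"
proof -
  have fixed: "Q * R = R" if Q: "is_orth_proj N V Q" and R: "is_orth_proj N V R" for Q R
  proof -
    have c: "Q \<in> carrier_mat N N" "R \<in> carrier_mat N N" using Q R by (auto simp: is_orth_proj_def hermitian_mat_def)
    have "Q *\<^sub>v v = v" if "v \<in> V" for v
    proof -
      have "v \<in> (\<lambda>u. Q *\<^sub>v u) ` carrier_vec N" using Q that by (simp add: is_orth_proj_def)
      then obtain u where u: "u \<in> carrier_vec N" "v = Q *\<^sub>v u" by blast
      have "Q *\<^sub>v v = (Q * Q) *\<^sub>v u" unfolding u(2) by (rule assoc_mult_mat_vec[OF c(1) c(1) u(1), symmetric])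
      then show ?thesis using Q u by (simp add: is_orth_proj_def)
    qed
    moreover have "col R j \<in> V" if "j < N" for j
      using R that mult_unit_vec_eq_col[OF c(2) that] by (auto simp: is_orth_proj_def) (metis image_eqI unit_vec_carrier)
    ultimately have col: "Q *\<^sub>v col R j = col R j" if "j < N" for j using that by blast
    show ?thesis
    proof (rule eq_matI)
      fix i j assume "i < dim_row R" "j < dim_col R"
      then show "(Q * R) $$ (i, j) = R $$ (i, j)"
        using c arg_cong[OF col[of j], of "\<lambda>v. v $ i"] by simp
    qed (use c in auto)
  qed
  show ?thesis
    unfolding orth_proj_def
  proof (rule the_equality)
    show "is_orth_proj N V P" by (rule P)
  next
    fix Q assume Q: "is_orth_proj N V Q"
    have h: "mat_adjoint P = P" "mat_adjoint Q = Q" "P \<in> carrier_mat N N" "Q \<in> carrier_mat N N"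
      using P Q by (auto simp: is_orth_proj_def hermitian_mat_def)
    have "Q = mat_adjoint (P * Q)" using fixed[OF P Q] h by simp
    also have "\<dots> = Q * P" using h by (simp add: mat_adjoint_mult[OF h(3,4)])
    also have "\<dots> = P" by (rule fixed[OF Q P])
    finally show "Q = P" .
  qed
qed

section \<open>The channels in terms of creation operators\<close>

lemma sum_antidiagonal:
  fixes g :: "nat \<Rightarrow> nat \<Rightarrow> 'a::comm_monoid_add"
  assumes "\<And>a. a \<le> n \<Longrightarrow> a \<le> c \<and> c - a \<le> m"
  shows "(\<Sum>a\<le>n. \<Sum>b\<le>m. if a + b = c then g a b else 0) = (\<Sum>a\<le>n. g a (c - a))"
proof (rule sum.cong[OF refl])
  fix a assume "a \<in> {..n}"
  then have a: "a \<le> c" "c - a \<le> m" using assms by auto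
  have "(\<Sum>b\<le>m. if a + b = c then g a b else 0) = (\<Sum>b\<le>m. if b = c - a then g a b else 0)"
    using a by (intro sum.cong) auto
  then show "(\<Sum>b\<le>m. if a + b = c then g a b else 0) = g a (c - a)" using a by simp
qed

text \<open>The value from \<open>min_weight_norm\<close> on the antidiagonal \<open>c\<close>, with
  \<open>i = c - n\<close> and \<open>l = m - c\<close>.\<close>

definition weight_norm :: "nat \<Rightarrow> nat \<Rightarrow> nat \<Rightarrow> real" where
  "weight_norm n m c = fact (c - n) * fact (m - c) * real (Suc m choose n)"

lemma weight_norm_nonzero: "n \<le> m \<Longrightarrow> weight_norm n m c \<noteq> 0"
  by (simp add: weight_norm_def)

lemma weight_norm_eq:
  assumes "n \<le> c" "c \<le> m"
  shows "weight_norm n m c = (\<Sum>a\<le>n. \<Sum>b\<le>m. if a + b = c then (min_weight n m a b)\<^sup>2 else 0)"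
proof -
  have "(\<Sum>a\<le>n. \<Sum>b\<le>m. if a + b = c then (min_weight n m a b)\<^sup>2 else 0) = (\<Sum>a\<le>n. (min_weight n m a (n + (c - n) - a))\<^sup>2)"
    using assms by (subst sum_antidiagonal) auto
  also have "\<dots> = weight_norm n m c"
    using assms by (subst min_weight_norm[of "c - n" "m - c"]) (simp_all add: weight_norm_def)
  finally show ?thesis ..
qed

context two_spins
begin

lemma total_spin_space_iff:
  assumes x: "x \<in> carrier_vec (Suc n * Suc m)"
  shows "x \<in> total_spin_space J K s \<longleftrightarrow>
    (\<forall>a\<le>n. \<forall>b\<le>m. casimir n m (tensor_coeff (Suc m) x) a b = complex_of_real (s * (s + 1)) * tensor_coeff (Suc m) x a b)"
proof -
  let ?N = "Suc n * Suc m" and ?y = "total_spin_sq J K *\<^sub>v x" and ?z = "complex_of_real (s * (s + 1)) \<cdot>\<^sub>v x"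
  have c: "total_spin spin_x J K \<in> carrier_mat ?N ?N" "total_spin spin_y J K \<in> carrier_mat ?N ?N" "total_spin spin_z J K \<in> carrier_mat ?N ?N"
    by (intro total_spin_carrier J.carriers K.carriers)+
  have "total_spin_sq J K \<in> carrier_mat ?N ?N"
    unfolding total_spin_sq_def using c by (intro add_carrier_mat mult_carrier_mat)
  then have y: "?y \<in> carrier_vec ?N" using x by (rule mult_mat_vec_carrier)
  have z: "?z \<in> carrier_vec ?N" using x by (simp del: mult_Suc mult_Suc_right)
  have zi: "tensor_coeff (Suc m) ?z a b = complex_of_real (s * (s + 1)) * tensor_coeff (Suc m) x a b" if "a \<le> n" "b \<le> m" for a b
    using that x tensor_index_less[of a "Suc n" b "Suc m"] by (simp add: tensor_coeff_def del: mult_Suc mult_Suc_right)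
  have yi: "tensor_coeff (Suc m) ?y a b = casimir n m (tensor_coeff (Suc m) x) a b" if "a \<le> n" "b \<le> m" for a b
    using total_spin_sq_mult_vec[OF x, of a b] that by simp
  have "x \<in> total_spin_space J K s \<longleftrightarrow> ?y = ?z"
    using x by (simp add: total_spin_space_def J.dim K.dim del: mult_Suc mult_Suc_right)
  also have "\<dots> \<longleftrightarrow> (\<forall>a\<le>n. \<forall>b\<le>m. tensor_coeff (Suc m) ?y a b = tensor_coeff (Suc m) ?z a b)"
    using vec_eq_tensor_coeff[OF y z] by (auto simp: less_Suc_eq_le simp del: index_mult_mat_vec)
  finally show ?thesis using yi zi by simp
qed

lemma total_spin_space_carrier: "total_spin_space J K s \<subseteq> carrier_vec (Suc n * Suc m)"
  unfolding total_spin_space_def J.dim K.dim by blast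

lemma P_minus_le:
  assumes nm: "n \<le> m"
  shows "P_minus J K = wproj n m (min_weight n m) n m (weight_norm n m)"
proof -
  let ?s = "\<bar>K - J\<bar>"
  have s: "complex_of_real (?s * (?s + 1)) = (of_nat m - of_nat n) / 2 * ((of_nat m - of_nat n) / 2 + 1)"
  proof -
    have e: "?s = (real m - real n) / 2" using J.L K.L nm by simp
    show ?thesis unfolding e by simp
  qed
  have "total_spin_space J K ?s = wspace n m (min_weight n m) n m"
  proof (rule Set.set_eqI)
    fix x
    show "x \<in> total_spin_space J K ?s \<longleftrightarrow> x \<in> wspace n m (min_weight n m) n m"
    proof (cases "x \<in> carrier_vec (Suc n * Suc m)")
      case True
      show ?thesis unfolding total_spin_space_iff[OF True] s casimir_eigen_iff[OF nm]
        unfolding wspace_def using True by blast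
    next
      case False
      then show ?thesis using total_spin_space_carrier unfolding wspace_def by blast
    qed
  qed
  moreover have "is_orth_proj (Suc n * Suc m) (wspace n m (min_weight n m) n m) (wproj n m (min_weight n m) n m (weight_norm n m))"
  proof (rule is_orth_proj_wproj)
    fix c assume c: "n \<le> c" "c \<le> m"
    show "weight_norm n m c = (\<Sum>a\<le>n. \<Sum>b\<le>m. if a + b = c then (min_weight n m a b)\<^sup>2 else 0)" by (rule weight_norm_eq[OF c])
    show "weight_norm n m c \<noteq> 0" by (rule weight_norm_nonzero[OF nm])
  qed
  ultimately show ?thesis unfolding P_minus_def J.dim K.dim by (simp only: orth_proj_eq)
qed

text \<open>The Casimir operator is symmetric under exchange of the tensor factors, so the solution
  is the one with the smaller spin first, read with \<open>a\<close> and \<open>b\<close>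
  exchanged.\<close>

lemma P_minus_ge:
  assumes mn: "m \<le> n"
  shows "P_minus J K = wproj n m (\<lambda>a b. min_weight m n b a) m n (weight_norm m n)"
proof -
  let ?s = "\<bar>K - J\<bar>"
  have s: "complex_of_real (?s * (?s + 1)) = (of_nat n - of_nat m) / 2 * ((of_nat n - of_nat m) / 2 + 1)"
  proof -
    have e: "?s = (real n - real m) / 2" using J.L K.L mn by simp
    show ?thesis unfolding e by simp
  qed
  have "total_spin_space J K ?s = wspace n m (\<lambda>a b. min_weight m n b a) m n"
  proof (rule Set.set_eqI)
    fix x
    show "x \<in> total_spin_space J K ?s \<longleftrightarrow> x \<in> wspace n m (\<lambda>a b. min_weight m n b a) m n"
    proof (cases "x \<in> carrier_vec (Suc n * Suc m)")
      case True
      have "x \<in> total_spin_space J K ?s \<longleftrightarrow> (\<forall>b\<le>m. \<forall>a\<le>n. casimir m n (\<lambda>b a. tensor_coeff (Suc m) x a b) b a =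
        (of_nat n - of_nat m) / 2 * ((of_nat n - of_nat m) / 2 + 1) * tensor_coeff (Suc m) x a b)"
        unfolding total_spin_space_iff[OF True] s using casimir_swap[of n m "tensor_coeff (Suc m) x"] by metis
      also have "\<dots> \<longleftrightarrow> (\<exists>\<kappa>. (\<forall>c. c < m \<or> n < c \<longrightarrow> \<kappa> c = 0) \<and>
          (\<forall>b\<le>m. \<forall>a\<le>n. tensor_coeff (Suc m) x a b = complex_of_real (min_weight m n b a) * \<kappa> (b + a)))"
        by (rule casimir_eigen_iff[OF mn])
      also have "\<dots> \<longleftrightarrow> (\<exists>\<kappa>. (\<forall>c. c < m \<or> n < c \<longrightarrow> \<kappa> c = 0) \<and>
          (\<forall>a\<le>n. \<forall>b\<le>m. tensor_coeff (Suc m) x a b = complex_of_real (min_weight m n b a) * \<kappa> (a + b)))"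
      proof -
        have "(\<forall>b\<le>m. \<forall>a\<le>n. tensor_coeff (Suc m) x a b = complex_of_real (min_weight m n b a) * \<kappa> (b + a)) \<longleftrightarrow>
          (\<forall>a\<le>n. \<forall>b\<le>m. tensor_coeff (Suc m) x a b = complex_of_real (min_weight m n b a) * \<kappa> (a + b))" for \<kappa>
          by (auto simp: add.commute)
        then show ?thesis by (simp only:)
      qed
      also have "\<dots> \<longleftrightarrow> x \<in> wspace n m (\<lambda>a b. min_weight m n b a) m n"
        unfolding wspace_def using True by blast
      finally show ?thesis .
    next
      case False
      then show ?thesis using total_spin_space_carrier unfolding wspace_def by blast
    qed
  qed
  moreover have "is_orth_proj (Suc n * Suc m) (wspace n m (\<lambda>a b. min_weight m n b a) m n) (wproj n m (\<lambda>a b. min_weight m n b a) m n (weight_norm m n))"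
  proof (rule is_orth_proj_wproj)
    fix c assume "m \<le> c" "c \<le> n"
    then show "weight_norm m n c = (\<Sum>a\<le>n. \<Sum>b\<le>m. if a + b = c then (min_weight m n b a)\<^sup>2 else 0)"
      by (subst sum.swap) (simp add: weight_norm_eq add.commute)
    show "weight_norm m n c \<noteq> 0" by (rule weight_norm_nonzero[OF mn])
  qed
  ultimately show ?thesis unfolding P_minus_def J.dim K.dim by (simp only: orth_proj_eq)
qed

text \<open>The projection preserves the sum of the indices, so only entries with
  \<open>a - a' = b' - b\<close> contribute. The entry of \<open>\<rho>\<close> is at
  \<open>(a', a)\<close>, opposite to the order of \<open>b\<close> and \<open>b'\<close>; this is
  the transposition in \<open>trev\<close>.\<close>

lemma partial_trace_wproj_index:
  assumes \<rho>: "\<rho> \<in> carrier_mat (Suc n) (Suc n)" and b: "b \<le> m" "b' \<le> m"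
  shows "partial_trace1 (Suc n) (Suc m) (wproj n m w lo hi nc * (\<rho> \<otimes>\<^sub>m 1\<^sub>m (Suc m))) $$ (b, b') =
    (\<Sum>a\<le>n. \<Sum>a'\<le>n. if a + b = a' + b' \<and> lo \<le> a + b \<and> a + b \<le> hi
       then complex_of_real (w a b * w a' b' / nc (a + b)) * \<rho> $$ (a', a) else 0)"
proof -
  let ?P = "wproj n m w lo hi nc" and ?T = "\<rho> \<otimes>\<^sub>m 1\<^sub>m (Suc m)" and ?N = "Suc n * Suc m"
  have T: "?T \<in> carrier_mat ?N ?N" using \<rho> by (auto simp: tensor_mat_def)
  have Ti: "?T $$ (a' * Suc m + c, a * Suc m + b') = (if c = b' then \<rho> $$ (a', a) else 0)"
    if "a' < Suc n" "a < Suc n" "c < Suc m" for a a' c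
    using that \<rho> b tensor_index_less[of a' "Suc n" c "Suc m"] tensor_index_less[of a "Suc n" b' "Suc m"]
    by (simp add: tensor_mat_def del: mult_Suc mult_Suc_right)
  have "(?P * ?T) $$ (a * Suc m + b, a * Suc m + b') =
      (\<Sum>a'\<le>n. if a + b = a' + b' \<and> lo \<le> a + b \<and> a + b \<le> hi
       then complex_of_real (w a b * w a' b' / nc (a + b)) * \<rho> $$ (a', a) else 0)" if a: "a \<le> n" for a
  proof -
    have "(?P * ?T) $$ (a * Suc m + b, a * Suc m + b') =
        (\<Sum>i<?N. ?P $$ (a * Suc m + b, i) * ?T $$ (i, a * Suc m + b'))"
      using T a b tensor_index_less[of a "Suc n" b "Suc m"] tensor_index_less[of a "Suc n" b' "Suc m"]
      by (simp add: scalar_prod_def atLeast0LessThan del: mult_Suc mult_Suc_right)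
    also have "\<dots> = (\<Sum>a'<Suc n. \<Sum>c<Suc m. if c = b' then ?P $$ (a * Suc m + b, a' * Suc m + c) * \<rho> $$ (a', a) else 0)"
      unfolding sum_lessThan_mult using a by (intro sum.cong refl) (auto simp: Ti simp del: mult_Suc mult_Suc_right)
    also have "\<dots> = (\<Sum>a'<Suc n. ?P $$ (a * Suc m + b, a' * Suc m + b') * \<rho> $$ (a', a))"
      using b by (intro sum.cong refl) (simp del: mult_Suc mult_Suc_right sum.lessThan_Suc)
    also have "\<dots> = (\<Sum>a'\<le>n. if a + b = a' + b' \<and> lo \<le> a + b \<and> a + b \<le> hi
       then complex_of_real (w a b * w a' b' / nc (a + b)) * \<rho> $$ (a', a) else 0)"
      unfolding lessThan_Suc_atMost using a b
      by (intro sum.cong refl) (auto simp: wproj_index simp del: mult_Suc mult_Suc_right)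
    finally show ?thesis .
  qed
  then show ?thesis using b by (simp add: partial_trace1_def lessThan_Suc_atMost del: mult_Suc mult_Suc_right)
qed

end

section \<open>Matrix entries of the iterated channels\<close>

lemma sum_choose_Suc:
  fixes g :: "nat \<Rightarrow> complex"
  shows "(\<Sum>i\<le>Suc k. of_nat (Suc k choose i) * g i) = (\<Sum>i\<le>k. of_nat (k choose i) * (g i + g (Suc i)))"
proof -
  have "(\<Sum>i\<le>Suc k. of_nat (Suc k choose i) * g i) = g 0 + (\<Sum>i\<le>k. of_nat (Suc k choose Suc i) * g (Suc i))"
    by (subst sum.atMost_Suc_shift) simp
  also have "\<dots> = (g 0 + (\<Sum>i\<le>k. of_nat (k choose Suc i) * g (Suc i))) + (\<Sum>i\<le>k. of_nat (k choose i) * g (Suc i))"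
    by (simp add: distrib_right sum.distrib algebra_simps)
  also have "g 0 + (\<Sum>i\<le>k. of_nat (k choose Suc i) * g (Suc i)) = (\<Sum>i\<le>Suc k. of_nat (k choose i) * g i)"
    by (subst sum.atMost_Suc_shift) simp
  also have "\<dots> = (\<Sum>i\<le>k. of_nat (k choose i) * g i)" by simp
  finally show ?thesis by (simp add: distrib_left sum.distrib)
qed

lemma down_iter_carrier: "X \<in> carrier_mat (d + k) (d + k) \<Longrightarrow> down_iter d k X \<in> carrier_mat d d"
  by (induction k arbitrary: X) auto

definition cmnorm :: "nat \<Rightarrow> nat \<Rightarrow> complex" where
  "cmnorm n a = complex_of_real (mnorm n a)"

lemma cmnorm_nonzero [simp]: "cmnorm n a \<noteq> 0"
  using mnorm_pos[of n a] by (simp add: cmnorm_def)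

lemma nsqrt_cmnorm: "a \<le> n \<Longrightarrow> nsqrt (Suc n - a) * cmnorm n a = cmnorm (Suc n) a" "nsqrt (Suc a) * cmnorm n a = cmnorm (Suc n) (Suc a)"
  by (simp_all add: cmnorm_def nsqrt_def mnorm_Suc_left mnorm_Suc_Suc)

text \<open>Division by the norms passes from the orthonormal basis to monomials, on which creation
  is multiplication by a variable. The shift by \<open>i\<close> is multiplication by the
  \<open>i\<close>-th power of the second variable on both sides.\<close>

definition shifted :: "nat \<Rightarrow> complex mat \<Rightarrow> nat \<Rightarrow> nat \<Rightarrow> nat \<Rightarrow> complex" where
  "shifted n X b b' i = (if i \<le> b \<and> i \<le> b' \<and> b - i \<le> n \<and> b' - i \<le> n
     then X $$ (b - i, b' - i) / (cmnorm n (b - i) * cmnorm n (b' - i)) else 0)"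

text \<open>Creators commute, so the \<open>k\<close>-fold products with \<open>i\<close> factors
  from the second mode all agree and are counted by \<open>k choose i\<close>. The quotient of
  factorials collects the normalisations of the single steps, and Pascal's rule carries the
  induction.\<close>

lemma up_iter_index:
  assumes X: "X \<in> carrier_mat (Suc n) (Suc n)" and b: "b \<le> n + k" "b' \<le> n + k"
  shows "up_iter (Suc n) k X $$ (b, b') = fact (Suc n) / fact (Suc n + k) * cmnorm (n + k) b * cmnorm (n + k) b' *
    (\<Sum>i\<le>k. of_nat (k choose i) * shifted n X b b' i)"
  using b
proof (induction k arbitrary: b b')
  case 0
  then show ?case by (simp add: shifted_def del: fact_Suc)
next
  case (Suc k)
  let ?d = "Suc n + k" and ?c = "fact (Suc n) / fact (Suc n + k) :: complex"
  let ?G = "\<lambda>b b'. \<Sum>i\<le>k. of_nat (k choose i) * shifted n X b b' i"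
  define C where "C = cmnorm (Suc (n + k)) b * cmnorm (Suc (n + k)) b'"
  have A: "(if b < ?d \<and> b' < ?d then nsqrt (?d - b) * nsqrt (?d - b') * up_iter (Suc n) k X $$ (b, b') else 0) = ?c * C * ?G b b'"
  proof (cases "b < ?d \<and> b' < ?d")
    case True
    then have le: "b \<le> n + k" "b' \<le> n + k" by auto
    then have e: "nsqrt (?d - b) * nsqrt (?d - b') * up_iter (Suc n) k X $$ (b, b') =
        ?c * ((nsqrt (Suc (n + k) - b) * cmnorm (n + k) b) * (nsqrt (Suc (n + k) - b') * cmnorm (n + k) b')) * ?G b b'"
      using Suc.IH[of b b'] by (simp add: mult_ac)
    show ?thesis using True unfolding e C_def nsqrt_cmnorm(1)[OF le(1)] nsqrt_cmnorm(1)[OF le(2)] by simp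
  next
    case False
    \<comment> \<open>An index equal to \<open>Suc n + k\<close> cannot be brought down to
      \<open>n\<close> by a shift of at most \<open>k\<close>.\<close>
    then have "shifted n X b b' i = 0" if "i \<le> k" for i using that Suc.prems by (auto simp: shifted_def)
    then show ?thesis using False by auto
  qed
  have B: "nsqrt b * nsqrt b' * up_iter (Suc n) k X $$ (b - 1, b' - 1) = ?c * C * (\<Sum>i\<le>k. of_nat (k choose i) * shifted n X b b' (Suc i))"
  proof (cases "b = 0 \<or> b' = 0")
    case True
    then show ?thesis by (auto simp: shifted_def)
  next
    case False
    then obtain a a' where ab: "b = Suc a" "b' = Suc a'" by (metis not0_implies_Suc)
    have "shifted n X b b' (Suc i) = shifted n X a a' i" for i by (simp add: shifted_def ab)
    moreover have "nsqrt b * nsqrt b' * up_iter (Suc n) k X $$ (b - 1, b' - 1) =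
        ?c * ((nsqrt (Suc a) * cmnorm (n + k) a) * (nsqrt (Suc a') * cmnorm (n + k) a')) * ?G a a'"
      using Suc.IH[of a a'] Suc.prems by (simp add: ab mult_ac)
    ultimately show ?thesis unfolding C_def ab by (simp only: nsqrt_cmnorm)
  qed
  have "up_iter (Suc n) (Suc k) X $$ (b, b') = (?c * C * ?G b b' + ?c * C * (\<Sum>i\<le>k. of_nat (k choose i) * shifted n X b b' (Suc i))) / of_nat (Suc ?d)"
    unfolding A[symmetric] B[symmetric] using up_index[OF up_iter_carrier[OF X], of b k b'] Suc.prems by simp
  also have "\<dots> = ?c / of_nat (Suc ?d) * C * (\<Sum>i\<le>Suc k. of_nat (Suc k choose i) * shifted n X b b' i)"
    unfolding sum_choose_Suc by (simp add: distrib_left sum.distrib add_divide_distrib)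
  also have "?c / of_nat (Suc ?d) = fact (Suc n) / fact (Suc n + Suc k)"
    by (simp only: divide_divide_eq_left fact_Suc[of ?d] add_Suc_right mult.commute)
  finally show ?case unfolding C_def by (simp add: mult_ac del: fact_Suc)
qed

text \<open>The adjoint of the situation in \<open>up_iter_index\<close>: annihilators are adjoint
  to multiplications, so the norms appear as factors in place of divisors.\<close>

lemma down_iter_index:
  assumes X: "X \<in> carrier_mat (Suc m + k) (Suc m + k)" and b: "b \<le> m" "b' \<le> m"
  shows "down_iter (Suc m) k X $$ (b, b') * (cmnorm m b * cmnorm m b') = fact m / fact (m + k) *
    (\<Sum>i\<le>k. of_nat (k choose i) * (cmnorm (m + k) (b + i) * cmnorm (m + k) (b' + i) * X $$ (b + i, b' + i)))"
  using X
proof (induction k arbitrary: X)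
  case 0
  then show ?case by simp
next
  case (Suc k)
  let ?d = "Suc m + k"
  define g where "g i = cmnorm (m + Suc k) (b + i) * cmnorm (m + Suc k) (b' + i) * X $$ (b + i, b' + i)" for i
  have "cmnorm (m + k) (b + i) * cmnorm (m + k) (b' + i) * down ?d X $$ (b + i, b' + i) = (g i + g (Suc i)) / of_nat ?d" if "i \<le> k" for i
  proof -
    have le: "b + i \<le> m + k" "b' + i \<le> m + k" using that b by auto
    have "cmnorm (m + k) (b + i) * cmnorm (m + k) (b' + i) * down ?d X $$ (b + i, b' + i) =
        ((nsqrt (Suc (m + k) - (b + i)) * cmnorm (m + k) (b + i)) * (nsqrt (Suc (m + k) - (b' + i)) * cmnorm (m + k) (b' + i)) * X $$ (b + i, b' + i) +
         (nsqrt (Suc (b + i)) * cmnorm (m + k) (b + i)) * (nsqrt (Suc (b' + i)) * cmnorm (m + k) (b' + i)) * X $$ (Suc (b + i), Suc (b' + i))) / of_nat ?d"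
      using le Suc.prems down_index[of X ?d "b + i" "b' + i"] by (simp add: algebra_simps add_divide_distrib)
    also have "\<dots> = (g i + g (Suc i)) / of_nat ?d"
      unfolding nsqrt_cmnorm(2) nsqrt_cmnorm(1)[OF le(1)] nsqrt_cmnorm(1)[OF le(2)] g_def by simp
    finally show ?thesis .
  qed
  then have "down_iter (Suc m) (Suc k) X $$ (b, b') * (cmnorm m b * cmnorm m b') =
      fact m / fact (m + k) * (\<Sum>i\<le>k. of_nat (k choose i) * ((g i + g (Suc i)) / of_nat ?d))"
    using Suc.IH[OF down_carrier[of ?d X]] by simp
  also have "\<dots> = fact m / fact (m + k) / of_nat ?d * (\<Sum>i\<le>Suc k. of_nat (Suc k choose i) * g i)"
    unfolding sum_choose_Suc by (simp add: sum_distrib_left sum_divide_distrib)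
  also have "fact m / fact (m + k) / of_nat ?d = (fact m / fact (m + Suc k) :: complex)"
    by (simp only: divide_divide_eq_left fact_Suc[of "m + k"] add_Suc_right add_Suc mult.commute)
  finally show ?case unfolding g_def .
qed

text \<open>Time reversal; it appears because the lowest total spin pairs a state with the reversed one.\<close>

definition trev :: "nat \<Rightarrow> complex mat \<Rightarrow> complex mat" where
  "trev n X = Matrix.mat (Suc n) (Suc n) (\<lambda>(x, x'). (- 1) ^ (x + x') * X $$ (n - x', n - x))"

lemma trev_carrier [simp]: "trev n X \<in> carrier_mat (Suc n) (Suc n)"
  by (simp add: trev_def)

section \<open>Identification of the channels\<close>

lemma cancel_common_factor:
  fixes K F c x y z :: real
  assumes "K \<noteq> 0" "F \<noteq> 0" "c \<noteq> 0" "x \<noteq> 0" "y \<noteq> 0" "z \<noteq> 0"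
  shows "(N / K) / (x * y * (F / (c * (K * z)))) = N * c / F * (z / (x * y))"
  using assms by (simp add: field_simps)

text \<open>On the left is the prefactor of the channel, with \<open>n = 2J\<close> and
  \<open>k = 2 (K - J)\<close>, over the squared norm on the antidiagonal \<open>n + i\<close>; on
  the right is the coefficient in \<open>up_iter_index\<close>. The factor \<open>n + 1\<close>
  completes \<open>fact n\<close>, and \<open>k + 1\<close> cancels against
  \<open>fact (Suc k)\<close> in the binomial coefficient.\<close>

lemma channel_const_up:
  assumes "i \<le> k"
  shows "(real n + 1) / (real k + 1) / weight_norm n (n + k) (n + i) = fact (Suc n) / fact (Suc n + k) * real (k choose i)"
proof -
  have "real (Suc (n + k) choose n) = fact (Suc n + k) / (fact n * fact (Suc k))"
    using binomial_fact[of n "Suc (n + k)", where 'a = real] by simp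
  moreover have "real (k choose i) = fact k / (fact i * fact (k - i))"
    by (rule binomial_fact[OF assms])
  ultimately have e: "(real n + 1) / (real k + 1) / weight_norm n (n + k) (n + i) =
    ((real n + 1) / (real k + 1)) / (fact i * fact (k - i) * (fact (Suc n + k) / (fact n * ((real k + 1) * fact k))))"
    "fact (Suc n) / fact (Suc n + k) * real (k choose i) = (real n + 1) * fact n / fact (Suc n + k) * (fact k / (fact i * fact (k - i)))"
    by (simp_all add: weight_norm_def add.commute del: binomial_Suc_Suc)
  have "real k + 1 \<noteq> 0" by linarith
  then show ?thesis unfolding e by (intro cancel_common_factor) simp_all
qed

text \<open>Here the antidiagonal is \<open>m + (k - i)\<close>, because in
  \<open>channel_eq_down_iter\<close> the summation index is \<open>n - a - b\<close>, which
  decreases along with growing \<open>a + b\<close>.\<close>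

lemma channel_const_down:
  assumes "i \<le> k"
  shows "(real (m + k) + 1) / (real k + 1) / weight_norm m (m + k) (m + (k - i)) = fact m / fact (m + k) * real (k choose i)"
proof -
  have nz: "real k + 1 \<noteq> 0" "real (m + k) + 1 \<noteq> 0" by linarith+
  have "real (Suc (m + k) choose m) = fact (Suc (m + k)) / (fact m * fact (Suc k))"
    using binomial_fact[of m "Suc (m + k)", where 'a = real] by simp
  moreover have "real (k choose i) = fact k / (fact i * fact (k - i))"
    by (rule binomial_fact[OF assms])
  ultimately have e: "(real (m + k) + 1) / (real k + 1) / weight_norm m (m + k) (m + (k - i)) =
    ((real (m + k) + 1) / (real k + 1)) / (fact i * fact (k - i) * ((real (m + k) + 1) * fact (m + k) / (fact m * ((real k + 1) * fact k))))"
    "fact m / fact (m + k) * real (k choose i) = (real (m + k) + 1) * fact m / ((real (m + k) + 1) * fact (m + k)) * (fact k / (fact i * fact (k - i)))"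
    using assms nz by (simp_all add: weight_norm_def add.commute mult.commute del: binomial_Suc_Suc)
  show ?thesis unfolding e using nz by (intro cancel_common_factor) simp_all
qed

lemma sum_pairs:
  fixes g :: "nat \<Rightarrow> nat \<Rightarrow> complex"
  shows "(\<Sum>a\<le>n. \<Sum>a'\<le>n. if P a a' then g a a' else 0) = (\<Sum>(a, a')\<in>{(a, a'). a \<le> n \<and> a' \<le> n \<and> P a a'}. g a a')"
proof -
  have "(\<Sum>a\<le>n. \<Sum>a'\<le>n. if P a a' then g a a' else 0) = (\<Sum>z\<in>{..n} \<times> {..n}. if P (fst z) (snd z) then g (fst z) (snd z) else 0)"
    by (simp add: sum.cartesian_product case_prod_beta)
  also have "\<dots> = (\<Sum>z\<in>{z \<in> {..n} \<times> {..n}. P (fst z) (snd z)}. g (fst z) (snd z))"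
    by (rule sum.inter_filter[symmetric]) simp
  also have "{z \<in> {..n} \<times> {..n}. P (fst z) (snd z)} = {(a, a'). a \<le> n \<and> a' \<le> n \<and> P a a'}" by auto
  finally show ?thesis by (simp add: case_prod_beta)
qed

context two_spins
begin

lemma channel_index:
  assumes k: "of_int k = 2 * (K - J)" and \<rho>: "\<rho> \<in> carrier_mat (Suc n) (Suc n)" and b: "b \<le> m" "b' \<le> m"
    and P: "P_minus J K = wproj n m w lo hi nc"
  shows "channel J k \<rho> $$ (b, b') = (\<Sum>(a, a')\<in>{(a, a'). a \<le> n \<and> a' \<le> n \<and> a + b = a' + b' \<and> lo \<le> a + b \<and> a + b \<le> hi}.
      complex_of_real ((2 * J + 1) / (2 * \<bar>K - J\<bar> + 1) / nc (a + b) * (w a b * w a' b')) * \<rho> $$ (a', a))"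
proof -
  have K: "J + of_int k / 2 = K" unfolding k by (simp add: field_simps)
  have "channel J k \<rho> $$ (b, b') = complex_of_real ((2 * J + 1) / (2 * \<bar>K - J\<bar> + 1)) *
      partial_trace1 (Suc n) (Suc m) (wproj n m w lo hi nc * (\<rho> \<otimes>\<^sub>m 1\<^sub>m (Suc m))) $$ (b, b')"
    using b by (simp add: channel_def K Let_def P J.dim K.dim partial_trace1_def)
  also have "\<dots> = (\<Sum>(a, a')\<in>{(a, a'). a \<le> n \<and> a' \<le> n \<and> a + b = a' + b' \<and> lo \<le> a + b \<and> a + b \<le> hi}.
      complex_of_real ((2 * J + 1) / (2 * \<bar>K - J\<bar> + 1) / nc (a + b) * (w a b * w a' b')) * \<rho> $$ (a', a))"
    unfolding partial_trace_wproj_index[OF \<rho> b] sum_pairs sum_distrib_left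
    by (intro sum.cong refl) (auto simp: mult_ac)
  finally show ?thesis .
qed

lemma channel_carrier: "of_int k = 2 * (K - J) \<Longrightarrow> channel J k \<rho> \<in> carrier_mat (Suc m) (Suc m)"
proof -
  assume "of_int k = 2 * (K - J)"
  then have "J + of_int k / 2 = K" by (simp add: field_simps)
  then show ?thesis by (simp add: channel_def Let_def K.dim partial_trace1_def)
qed

text \<open>Both sides are sums over shifts along a diagonal. The sign in \<open>min_weight\<close>,
  the reflection from \<open>a\<close> to \<open>n - a\<close> and the transposed position in
  \<open>\<rho>\<close> are exactly what \<open>trev\<close> does.\<close>

lemma channel_eq_up_iter:
  assumes k: "of_int k = 2 * (K - J)" and \<rho>: "\<rho> \<in> carrier_mat (Suc n) (Suc n)" and m: "m = n + l"
  shows "channel J k \<rho> = up_iter (Suc n) l (trev n \<rho>)"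
proof (rule eq_matI)
  have nm: "n \<le> m" using m by simp
  have u: "up_iter (Suc n) l (trev n \<rho>) \<in> carrier_mat (Suc m) (Suc m)"
    using up_iter_carrier[of "trev n \<rho>" "Suc n" l] m by simp
  show "dim_row (channel J k \<rho>) = dim_row (up_iter (Suc n) l (trev n \<rho>))"
    "dim_col (channel J k \<rho>) = dim_col (up_iter (Suc n) l (trev n \<rho>))"
    using u channel_carrier[OF k, of \<rho>] by auto
  fix b b' assume "b < dim_row (up_iter (Suc n) l (trev n \<rho>))" "b' < dim_col (up_iter (Suc n) l (trev n \<rho>))"
  then have b: "b \<le> m" "b' \<le> m" using u by auto
  have JK: "(2 * J + 1) / (2 * \<bar>K - J\<bar> + 1) = (real n + 1) / (real l + 1)"
  proof -
    have "2 * \<bar>K - J\<bar> = real l" using J.L K.L m by simp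
    then show ?thesis using J.L by simp
  qed
  let ?I = "{i \<in> {..l}. i \<le> b \<and> i \<le> b' \<and> b - i \<le> n \<and> b' - i \<le> n}"
  let ?A = "{(a, a'). a \<le> n \<and> a' \<le> n \<and> a + b = a' + b' \<and> n \<le> a + b \<and> a + b \<le> m}"
  let ?F = "fact (Suc n) / fact (Suc n + l) :: complex" and ?j = "\<lambda>(a, a'). a + b - n"
  have "channel J k \<rho> $$ (b, b') = (\<Sum>(a, a')\<in>?A.
      complex_of_real ((real n + 1) / (real l + 1) / weight_norm n m (a + b) * (min_weight n m a b * min_weight n m a' b')) * \<rho> $$ (a', a))"
    unfolding channel_index[OF k \<rho> b P_minus_le[OF nm]] JK ..
  also have "\<dots> = (\<Sum>i\<in>?I. ?F * cmnorm m b * cmnorm m b' * (of_nat (l choose i) * (trev n \<rho> $$ (b - i, b' - i) / (cmnorm n (b - i) * cmnorm n (b' - i)))))"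
  \<comment> \<open>The shift is \<open>i = a + b - n\<close>, so that \<open>b - i = n - a\<close>
    and \<open>b' - i = n - a'\<close>; the inverse recovers \<open>a\<close> as
    \<open>n + i - b\<close>.\<close>
  proof (rule sum.reindex_bij_witness[where i = "\<lambda>i. (n + i - b, n + i - b')" and j = ?j])
    fix z assume z: "z \<in> ?A"
    then obtain a a' where zz: "z = (a, a')" and a: "a \<le> n" "a' \<le> n" "a + b = a' + b'" "n \<le> a + b" "a + b \<le> m" by auto
    define i where "i = a + b - n"
    have i: "i \<le> l" "b - i = n - a" "b' - i = n - a'" "a + b = n + i" using a m by (auto simp: i_def)
    have h: "complex_of_real (min_weight n m a b * min_weight n m a' b') = (- 1) ^ (a + a') * (cmnorm m b * cmnorm m b') / (cmnorm n (n - a) * cmnorm n (n - a'))"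
      using a(1,2) by (simp add: min_weight_def cmnorm_def mnorm_reflect power_add)
    have c: "complex_of_real ((real n + 1) / (real l + 1) / weight_norm n m (a + b)) = ?F * of_nat (l choose i)"
      unfolding i(4) m channel_const_up[OF i(1)] by simp
    have t: "trev n \<rho> $$ (n - a, n - a') = (- 1) ^ (a + a') * \<rho> $$ (a', a)"
    proof -
      have "(- 1) ^ (n - a + (n - a')) = ((- 1) ^ (a + a') :: complex)"
        using a(1,2) by (auto simp: minus_one_power_iff)
      then show ?thesis using a by (simp add: trev_def add.commute)
    qed
    show "?F * cmnorm m b * cmnorm m b' * (of_nat (l choose (?j z)) * (trev n \<rho> $$ (b - ?j z, b' - ?j z) / (cmnorm n (b - ?j z) * cmnorm n (b' - ?j z)))) =
      (case z of (a, a') \<Rightarrow> complex_of_real ((real n + 1) / (real l + 1) / weight_norm n m (a + b) * (min_weight n m a b * min_weight n m a' b')) * \<rho> $$ (a', a))"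
      unfolding zz case_prod_conv i_def[symmetric] i(2,3) of_real_mult[of "(real n + 1) / (real l + 1) / weight_norm n m (a + b)"] h c t
      by (simp add: mult_ac add_ac)
  qed (use m in auto)
  also have "\<dots> = ?F * cmnorm m b * cmnorm m b' * (\<Sum>i\<le>l. of_nat (l choose i) * shifted n (trev n \<rho>) b b' i)"
    unfolding sum_distrib_left[symmetric]
    by (intro arg_cong2[where f = "(*)"] refl) (subst sum.inter_filter, auto simp: shifted_def intro!: sum.cong)
  also have "\<dots> = up_iter (Suc n) l (trev n \<rho>) $$ (b, b')"
    using up_iter_index[OF trev_carrier, of b n l b'] b m by simp
  finally show "channel J k \<rho> $$ (b, b') = up_iter (Suc n) l (trev n \<rho>) $$ (b, b')" .
qed

lemma channel_eq_down_iter: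
  assumes k: "of_int k = 2 * (K - J)" and \<rho>: "\<rho> \<in> carrier_mat (Suc n) (Suc n)" and n: "n = m + l"
  shows "channel J k \<rho> = down_iter (Suc m) l (trev n \<rho>)"
proof (rule eq_matI)
  have mn: "m \<le> n" using n by simp
  have u: "down_iter (Suc m) l (trev n \<rho>) \<in> carrier_mat (Suc m) (Suc m)"
    using down_iter_carrier[of "trev n \<rho>" "Suc m" l] n by simp
  show "dim_row (channel J k \<rho>) = dim_row (down_iter (Suc m) l (trev n \<rho>))"
    "dim_col (channel J k \<rho>) = dim_col (down_iter (Suc m) l (trev n \<rho>))"
    using u channel_carrier[OF k, of \<rho>] by auto
  fix b b' assume "b < dim_row (down_iter (Suc m) l (trev n \<rho>))" "b' < dim_col (down_iter (Suc m) l (trev n \<rho>))"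
  then have b: "b \<le> m" "b' \<le> m" using u by auto
  have JK: "(2 * J + 1) / (2 * \<bar>K - J\<bar> + 1) = (real n + 1) / (real l + 1)"
  proof -
    have "2 * \<bar>K - J\<bar> = real l" using J.L K.L n by simp
    then show ?thesis using J.L by simp
  qed
  let ?A = "{(a, a'). a \<le> n \<and> a' \<le> n \<and> a + b = a' + b' \<and> m \<le> a + b \<and> a + b \<le> n}"
  let ?F = "fact m / fact (m + l) :: complex" and ?j = "\<lambda>(a, a'). n - a - b"
  \<comment> \<open>Now \<open>b\<close> belongs to the smaller spin and \<open>min_weight\<close>
    has the norms of \<open>b\<close> and \<open>b'\<close> as divisors. They are cleared here,
    which also matches the form of \<open>down_iter_index\<close>, and cancelled at the end.\<close>
  have "channel J k \<rho> $$ (b, b') * (cmnorm m b * cmnorm m b') = (\<Sum>(a, a')\<in>?A.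
      complex_of_real ((real n + 1) / (real l + 1) / weight_norm m n (a + b) * (min_weight m n b a * min_weight m n b' a')) * \<rho> $$ (a', a) * (cmnorm m b * cmnorm m b'))"
    unfolding channel_index[OF k \<rho> b P_minus_ge[OF mn]] JK
    by (subst sum_distrib_right) (auto intro!: sum.cong)
  also have "\<dots> = (\<Sum>i\<le>l. ?F * (of_nat (l choose i) * (cmnorm (m + l) (b + i) * cmnorm (m + l) (b' + i) * trev n \<rho> $$ (b + i, b' + i))))"
  proof (rule sum.reindex_bij_witness[where i = "\<lambda>i. (n - (b + i), n - (b' + i))" and j = ?j])
    fix z assume z: "z \<in> ?A"
    then obtain a a' where zz: "z = (a, a')" and a: "a \<le> n" "a' \<le> n" "a + b = a' + b'" "m \<le> a + b" "a + b \<le> n" by auto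
    define i where "i = n - a - b"
    have i: "i \<le> l" "b + i = n - a" "b' + i = n - a'" "a + b = m + (l - i)" using a n by (auto simp: i_def)
    have h: "complex_of_real (min_weight m n b a * min_weight m n b' a') * (cmnorm m b * cmnorm m b') = (- 1) ^ (b + b') * (cmnorm n (n - a) * cmnorm n (n - a'))"
    proof -
      have "min_weight m n b a * min_weight m n b' a' * (mnorm m b * mnorm m b') = (- 1) ^ (b + b') * (mnorm n a * mnorm n a')"
        using mnorm_pos[of m b] mnorm_pos[of m b'] by (simp add: min_weight_def power_add)
      then have "complex_of_real (min_weight m n b a * min_weight m n b' a' * (mnorm m b * mnorm m b')) = complex_of_real ((- 1) ^ (b + b') * (mnorm n a * mnorm n a'))" by (rule arg_cong)
      then show ?thesis using a(1,2) by (simp add: cmnorm_def mnorm_reflect)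
    qed
    have c: "complex_of_real ((real n + 1) / (real l + 1) / weight_norm m n (a + b)) = ?F * of_nat (l choose i)"
      unfolding i(4) n channel_const_down[OF i(1)] by simp
    \<comment> \<open>The sign from \<open>min_weight\<close> depends on \<open>b\<close> and
      \<open>b'\<close>, that of \<open>trev\<close> on \<open>b + i\<close> and
      \<open>b' + i\<close>; the exponents differ by the even number \<open>2 * i\<close>.\<close>
    have t: "trev n \<rho> $$ (n - a, n - a') = (- 1) ^ (b + b') * \<rho> $$ (a', a)"
    proof -
      have e: "b + i + (b' + i) = b + b' + 2 * i" by simp
      have "(- 1) ^ (b + i + (b' + i)) = ((- 1) ^ (b + b') :: complex)"
        unfolding e power_add power_mult by simp
      then show ?thesis unfolding i(2,3) using a by (simp add: trev_def add.commute)
    qed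
    have "complex_of_real ((real n + 1) / (real l + 1) / weight_norm m n (a + b) * (min_weight m n b a * min_weight m n b' a')) * \<rho> $$ (a', a) * (cmnorm m b * cmnorm m b')
      = (?F * of_nat (l choose i)) * ((complex_of_real (min_weight m n b a * min_weight m n b' a') * (cmnorm m b * cmnorm m b')) * \<rho> $$ (a', a))"
      unfolding of_real_mult[of "(real n + 1) / (real l + 1) / weight_norm m n (a + b)"] c by (simp only: mult_ac)
    also have "\<dots> = ?F * (of_nat (l choose i) * (cmnorm (m + l) (b + i) * cmnorm (m + l) (b' + i) * trev n \<rho> $$ (b + i, b' + i)))"
      unfolding h i(2,3) t n[symmetric] by (simp only: mult_ac)
    finally show "?F * (of_nat (l choose (?j z)) * (cmnorm (m + l) (b + ?j z) * cmnorm (m + l) (b' + ?j z) * trev n \<rho> $$ (b + ?j z, b' + ?j z))) =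
      (case z of (a, a') \<Rightarrow> complex_of_real ((real n + 1) / (real l + 1) / weight_norm m n (a + b) * (min_weight m n b a * min_weight m n b' a')) * \<rho> $$ (a', a) * (cmnorm m b * cmnorm m b'))"
      unfolding zz case_prod_conv i_def[symmetric] by (rule sym)
  qed (use n b in auto)
  also have "\<dots> = down_iter (Suc m) l (trev n \<rho>) $$ (b, b') * (cmnorm m b * cmnorm m b')"
    using down_iter_index[of "trev n \<rho>" m l b b'] b n by (simp add: sum_distrib_left)
  finally show "channel J k \<rho> $$ (b, b') = down_iter (Suc m) l (trev n \<rho>) $$ (b, b')" by simp
qed

end

section \<open>Coherent states\<close>

text \<open>The antiunitary time reversal on vectors, of which \<open>trev\<close> is the
  counterpart on operators.\<close>

definition trev_vec :: "nat \<Rightarrow> complex vec \<Rightarrow> complex vec" where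
  "trev_vec n v = Matrix.vec (Suc n) (\<lambda>x. (- 1) ^ x * cnj (v $ (n - x)))"

lemma trev_ket_bra:
  assumes "v \<in> carrier_vec (Suc n)"
  shows "trev n (ket_bra v) = ket_bra (trev_vec n v)"
  using assms by (intro eq_matI) (auto simp: trev_def ket_bra_def trev_vec_def power_add)

lemma sum_lessThan_Suc_reflect: "(\<Sum>x<Suc n. g (n - x)) = (\<Sum>x<Suc n. g x)" for g :: "nat \<Rightarrow> 'a::comm_monoid_add"
  by (rule sum.reindex_bij_witness[where i = "\<lambda>x. n - x" and j = "\<lambda>x. n - x"]) auto

text \<open>Positivity is transported by the antiunitary: the quadratic form of
  \<open>trev n \<rho>\<close> at \<open>v\<close> is that of \<open>\<rho>\<close> at
  \<open>trev_vec n v\<close>.\<close>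

lemma trev_density:
  assumes "density_mat (Suc n) \<rho>"
  shows "density_mat (Suc n) (trev n \<rho>)"
proof -
  have h: "mat_adjoint \<rho> = \<rho>" and c: "\<rho> \<in> carrier_mat (Suc n) (Suc n)" and tr: "mat_trace \<rho> = 1"
    and pos: "\<And>v. v \<in> carrier_vec (Suc n) \<Longrightarrow> 0 \<le> (\<rho> *\<^sub>v v) \<bullet>c v"
    using assms by (auto simp: density_mat_def hermitian_mat_def)
  have hi: "cnj (\<rho> $$ (i, j)) = \<rho> $$ (j, i)" if "i < Suc n" "j < Suc n" for i j
    using index_mat_adjoint[of j \<rho> i] h c that by simp
  have "hermitian_mat (Suc n) (trev n \<rho>)"
    unfolding hermitian_mat_def
  proof (intro conjI eq_matI)
    fix i j assume "i < dim_row (trev n \<rho>)" "j < dim_col (trev n \<rho>)"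
    then have ij: "i < Suc n" "j < Suc n" by (simp_all add: trev_def)
    then show "mat_adjoint (trev n \<rho>) $$ (i, j) = trev n \<rho> $$ (i, j)"
      by (simp add: trev_def hi add.commute)
  qed (simp_all add: trev_def)
  moreover have "mat_trace (trev n \<rho>) = 1"
  proof -
    have "mat_trace (trev n \<rho>) = (\<Sum>x<Suc n. \<rho> $$ (n - x, n - x))"
      unfolding mat_trace_def by (intro sum.cong) (auto simp: trev_def)
    also have "\<dots> = mat_trace \<rho>"
      unfolding sum_lessThan_Suc_reflect[of "\<lambda>x. \<rho> $$ (x, x)"] using c by (simp add: mat_trace_def)
    finally show ?thesis using tr by simp
  qed
  moreover have "0 \<le> (trev n \<rho> *\<^sub>v v) \<bullet>c v" if v: "v \<in> carrier_vec (Suc n)" for v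
  proof -
    have quad: "(A *\<^sub>v u) \<bullet>c u = (\<Sum>x<Suc n. \<Sum>y<Suc n. A $$ (x, y) * u $ y * cnj (u $ x))"
      if "A \<in> carrier_mat (Suc n) (Suc n)" "u \<in> carrier_vec (Suc n)" for A u
      using that by (auto simp: scalar_prod_def atLeast0LessThan sum_distrib_right simp del: sum.lessThan_Suc intro!: sum.cong)
    define w where "w = trev_vec n v"
    have w: "w \<in> carrier_vec (Suc n)" by (simp add: w_def trev_vec_def)
    have "(trev n \<rho> *\<^sub>v v) \<bullet>c v = (\<Sum>x<Suc n. \<Sum>y<Suc n. \<rho> $$ (n - y, n - x) * w $ (n - x) * cnj (w $ (n - y)))"
      unfolding quad[OF trev_carrier v]
    proof (intro sum.cong refl)
      fix x y assume xy: "x \<in> {..<Suc n}" "y \<in> {..<Suc n}"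
      have "(- 1) ^ (x + y) = ((- 1) ^ (n - x) * (- 1) ^ (n - y) :: complex)"
        using xy by (auto simp: minus_one_power_iff)
      then show "trev n \<rho> $$ (x, y) * v $ y * cnj (v $ x) = \<rho> $$ (n - y, n - x) * w $ (n - x) * cnj (w $ (n - y))"
        using xy by (simp add: trev_def w_def trev_vec_def)
    qed
    also have "\<dots> = (\<Sum>x<Suc n. \<Sum>y<Suc n. \<rho> $$ (y, x) * w $ x * cnj (w $ y))"
      unfolding sum_lessThan_Suc_reflect[of "\<lambda>y. \<rho> $$ (y, n - _) * w $ (n - _) * cnj (w $ y)"]
        sum_lessThan_Suc_reflect[of "\<lambda>x. \<Sum>y<Suc n. \<rho> $$ (y, x) * w $ x * cnj (w $ y)"] ..
    also have "\<dots> = (\<rho> *\<^sub>v w) \<bullet>c w"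
      unfolding quad[OF c w] by (rule sum.swap)
    finally show ?thesis using pos[OF w] by simp
  qed
  ultimately show ?thesis by (simp add: density_mat_def)
qed

text \<open>\<open>(p, q)\<close> is the spinor of the direction opposite to
  \<open>(x, y, z)\<close>. Its phase is fixed by taking \<open>q\<close> real and positive, which
  makes \<open>q\<close> a divisor in the formula for \<open>p\<close> and singles out
  \<open>z = -1\<close>, where \<open>q = 0\<close>.\<close>

lemma spinor_exists:
  fixes x y z :: real
  assumes "x\<^sup>2 + y\<^sup>2 + z\<^sup>2 = 1"
  shows "\<exists>p q. p * cnj p = complex_of_real ((1 - z) / 2) \<and> q * cnj q = complex_of_real ((1 + z) / 2) \<and>
    2 * (p * cnj q) = - (complex_of_real x - \<i> * complex_of_real y)"
proof (cases "z = -1")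
  case True
  then have "x = 0" "y = 0" using assms by auto
  then show ?thesis using True by (intro exI[of _ 1] exI[of _ 0]) auto
next
  case False
  have "z\<^sup>2 \<le> 1" using assms zero_le_power2[of x] zero_le_power2[of y] by linarith
  then have "\<bar>z\<bar> \<le> 1" by (simp add: abs_square_le_1)
  then have z: "0 < (1 + z) / 2" using False by auto
  define r where "r = sqrt ((1 + z) / 2)"
  have r: "r * r = (1 + z) / 2" "0 < r" using z by (auto simp: r_def)
  define p where "p = - (complex_of_real x - \<i> * complex_of_real y) / (2 * complex_of_real r)"
  have "p * cnj p = complex_of_real ((x\<^sup>2 + y\<^sup>2) / (4 * (r * r)))"
    using r(2) by (simp add: p_def complex_eq_iff power2_eq_square field_simps)
  also have "(x\<^sup>2 + y\<^sup>2) / (4 * (r * r)) = (1 - z) / 2"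
  proof -
    have "x\<^sup>2 + y\<^sup>2 = (1 - z) * (1 + z)" using assms by (simp add: power2_eq_square algebra_simps)
    then show ?thesis unfolding r(1) using z by (simp add: field_simps)
  qed
  finally have "p * cnj p = complex_of_real ((1 - z) / 2)" .
  moreover have "complex_of_real r * cnj (complex_of_real r) = complex_of_real ((1 + z) / 2)"
    by (simp only: complex_cnj_complex_of_real of_real_mult[symmetric] r(1))
  moreover have "2 * (p * cnj (complex_of_real r)) = - (complex_of_real x - \<i> * complex_of_real y)"
    using r(2) by (simp add: p_def)
  ultimately show ?thesis by blast
qed

context spin
begin

lemma dir_sum:
  assumes "a < Suc n"
  shows "(\<Sum>i<Suc n. spin_dir L \<omega> $$ (a, i) * g i) =
    complex_of_real (vec_nth \<omega> 1) * ((ladder n (Suc a) * g (Suc a) + ladder n a * g (a - 1)) / 2) +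
    complex_of_real (vec_nth \<omega> 2) * ((ladder n (Suc a) * g (Suc a) - ladder n a * g (a - 1)) / (2 * \<i>)) +
    complex_of_real (vec_nth \<omega> 3) * ((of_nat n / 2 - of_nat a) * g a)"
proof -
  have "(\<Sum>i<Suc n. spin_dir L \<omega> $$ (a, i) * g i) = (\<Sum>i<Suc n.
      complex_of_real (vec_nth \<omega> 1) * (spin_x L $$ (a, i) * g i) +
      complex_of_real (vec_nth \<omega> 2) * (spin_y L $$ (a, i) * g i) +
      complex_of_real (vec_nth \<omega> 3) * (spin_z L $$ (a, i) * g i))"
    using assms carrier_matD[OF carriers(1)] carrier_matD[OF carriers(2)] carrier_matD[OF carriers(3)]
    by (intro sum.cong refl) (simp add: spin_dir_def algebra_simps)
  then show ?thesis
    unfolding sum.distrib sum_distrib_left[symmetric] x_sum[OF assms] y_sum[OF assms] z_sum[OF assms] .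
qed

text \<open>If \<open>(p, q)\<close> is the spinor opposite to \<open>\<omega>\<close>, then \<open>J - \<omega> \<cdot> S = b\<^sup>* b\<close> with
  \<open>b = p\<^sup>* a\<^sub>1 + q\<^sup>* a\<^sub>2\<close>, and \<open>b v = 0\<close> is read off from the first-order recurrence \<open>b\<^sup>* (b v) = 0\<close>.\<close>

lemma coherent_state_trev:
  assumes \<omega>: "\<omega> \<in> sphere 0 1" and v: "coherent_state L \<omega> v"
  shows "\<exists>p q. p * cnj p + q * cnj q = 1 \<and> coherent n p q (trev_vec n v)"
proof -
  define x y z where "x = vec_nth \<omega> 1" and "y = vec_nth \<omega> 2" and "z = vec_nth \<omega> 3"
  have "x\<^sup>2 + y\<^sup>2 + z\<^sup>2 = 1"
    using \<omega> by (simp add: x_def y_def z_def norm_eq_1 inner_vec_def sum_3 power2_eq_square)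
  then obtain p q where p: "p * cnj p = complex_of_real ((1 - z) / 2)" and q: "q * cnj q = complex_of_real ((1 + z) / 2)"
    and pq: "2 * (p * cnj q) = - (complex_of_real x - \<i> * complex_of_real y)"
    using spinor_exists by blast
  have qp: "2 * (q * cnj p) = - (complex_of_real x + \<i> * complex_of_real y)"
    using arg_cong[OF pq, of cnj] by (simp add: mult.commute)
  have vc: "v \<in> carrier_vec (Suc n)" and v1: "v \<bullet>c v = 1" and ev: "spin_dir L \<omega> *\<^sub>v v = complex_of_real L \<cdot>\<^sub>v v"
    using v by (auto simp: coherent_state_def dim)
  have l: "complex_of_real L = of_nat n / 2" using L by (simp add: complex_eq_iff)
  \<comment> \<open>The components of \<open>b v\<close>; the next fact is the vanishing of the
    components of its image under the adjoint of \<open>b\<close>. The value \<open>e n\<close>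
    reaches beyond the dimension of \<open>v\<close>, but there it occurs only with the factor
    \<open>nsqrt 0\<close>.\<close>
  define e where "e a = cnj p * nsqrt (n - a) * v $ a + cnj q * nsqrt (Suc a) * v $ Suc a" for a
  have E: "p * nsqrt (n - a) * e a + q * nsqrt a * e (a - 1) = 0" if a: "a \<le> n" for a
  proof -
    have "(spin_dir L \<omega> *\<^sub>v v) $ a = (\<Sum>i<Suc n. spin_dir L \<omega> $$ (a, i) * v $ i)"
      using a vc carrier_matD[OF carriers(1)] carrier_matD[OF carriers(2)] carrier_matD[OF carriers(3)]
      by (simp add: scalar_prod_def atLeast0LessThan spin_dir_def del: sum.lessThan_Suc)
    then have "of_nat n / 2 * v $ a = (\<Sum>i<Suc n. spin_dir L \<omega> $$ (a, i) * v $ i)"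
      unfolding ev using a vc l by simp
    also have "\<dots> = complex_of_real x * ((ladder n (Suc a) * v $ (Suc a) + ladder n a * v $ (a - 1)) / 2) +
      complex_of_real y * ((ladder n (Suc a) * v $ (Suc a) - ladder n a * v $ (a - 1)) / (2 * \<i>)) +
      complex_of_real z * ((of_nat n / 2 - of_nat a) * v $ a)"
      using dir_sum[of a \<omega> "\<lambda>i. v $ i"] a by (simp add: x_def y_def z_def del: sum.lessThan_Suc)
    also have "\<dots> = (complex_of_real x - \<i> * complex_of_real y) / 2 * (ladder n (Suc a) * v $ (Suc a)) +
      (complex_of_real x + \<i> * complex_of_real y) / 2 * (ladder n a * v $ (a - 1)) +
      complex_of_real z * ((of_nat n / 2 - of_nat a) * v $ a)"
      by (simp add: field_simps)
    finally have ev1: "of_nat n / 2 * v $ a = (complex_of_real x - \<i> * complex_of_real y) / 2 * (ladder n (Suc a) * v $ (Suc a)) +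
      (complex_of_real x + \<i> * complex_of_real y) / 2 * (ladder n a * v $ (a - 1)) +
      complex_of_real z * ((of_nat n / 2 - of_nat a) * v $ a)" .
    have "complex_of_real x - \<i> * complex_of_real y = - (2 * (p * cnj q))" unfolding pq by simp
    then have xy1: "(complex_of_real x - \<i> * complex_of_real y) / 2 = - (p * cnj q)" by simp
    have "complex_of_real x + \<i> * complex_of_real y = - (2 * (q * cnj p))" unfolding qp by simp
    then have xy2: "(complex_of_real x + \<i> * complex_of_real y) / 2 = - (q * cnj p)" by simp
    have ev': "of_nat n / 2 * v $ a = - (p * cnj q) * (ladder n (Suc a) * v $ (Suc a)) - (q * cnj p) * (ladder n a * v $ (a - 1)) +
      complex_of_real z * ((of_nat n / 2 - of_nat a) * v $ a)"
      unfolding ev1 xy1 xy2 by simp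
    have A: "p * nsqrt (n - a) * e a = p * cnj p * ((of_nat n - of_nat a) * v $ a) + p * cnj q * (ladder n (Suc a) * v $ Suc a)"
    proof -
      have "p * nsqrt (n - a) * e a = p * cnj p * ((nsqrt (n - a) * nsqrt (n - a)) * v $ a) + p * cnj q * ((nsqrt (Suc a) * nsqrt (n - a)) * v $ Suc a)"
        unfolding e_def by (simp only: algebra_simps)
      then show ?thesis using a by (simp add: ladder_def of_nat_diff)
    qed
    have B: "q * nsqrt a * e (a - 1) = q * cnj p * (ladder n a * v $ (a - 1)) + q * cnj q * (of_nat a * v $ a)"
    proof (cases a)
      case (Suc a')
      have "q * nsqrt (Suc a') * e a' = q * cnj p * ((nsqrt (Suc a') * nsqrt (n - a')) * v $ a') + q * cnj q * ((nsqrt (Suc a') * nsqrt (Suc a')) * v $ Suc a')"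
        unfolding e_def by (simp only: algebra_simps)
      then show ?thesis by (simp add: Suc ladder_def)
    qed simp
    have "p * cnj p * ((of_nat n - of_nat a) * v $ a) + q * cnj q * (of_nat a * v $ a) =
        of_nat n / 2 * v $ a - complex_of_real z * ((of_nat n / 2 - of_nat a) * v $ a)"
      unfolding p q by (simp add: field_simps)
    then show ?thesis unfolding A B ev' by (simp add: algebra_simps)
  qed
  \<comment> \<open>For \<open>p \<noteq> 0\<close> the recurrence is solved upwards from
    \<open>a = 0\<close>; for \<open>p = 0\<close> its second term alone forces the zeros.\<close>
  have e0: "e a = 0" if "a < n" for a
  proof (cases "p = 0")
    case True
    then have "q \<noteq> 0" using p q by auto
    then show ?thesis using E[of "Suc a"] True that by (simp add: nsqrt_def)
  next
    case False
    show ?thesis using that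
    proof (induction a)
      case 0
      then show ?case using E[of 0] False by (simp add: nsqrt_def)
    next
      case (Suc a)
      then show ?case using E[of "Suc a"] False by (simp add: nsqrt_def)
    qed
  qed
  have one: "p * cnj p + q * cnj q = 1"
    unfolding p q by (simp add: field_simps)
  have "coherent n p q (trev_vec n v)"
    unfolding coherent_def
  proof (intro conjI allI impI)
    show "trev_vec n v \<in> carrier_vec (Suc n)" by (simp add: trev_vec_def)
    have "trev_vec n v \<bullet>c trev_vec n v = (\<Sum>x<Suc n. v $ (n - x) * cnj (v $ (n - x)))"
      by (auto simp: scalar_prod_def trev_vec_def atLeast0LessThan mult_ac simp del: sum.lessThan_Suc simp flip: power_mult_distrib intro!: sum.cong)
    also have "\<dots> = v \<bullet>c v"
      unfolding sum_lessThan_Suc_reflect[of "\<lambda>x. v $ x * cnj (v $ x)"]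
      using vc by (simp add: scalar_prod_def atLeast0LessThan del: sum.lessThan_Suc)
    finally show "trev_vec n v \<bullet>c trev_vec n v = 1" using v1 by simp
    fix i assume i: "i < n"
    \<comment> \<open>Reflection and conjugation exchange the roles of the two modes, and the
      alternating sign turns annihilation by the operator of \<open>(p, q)\<close> into annihilation
      by that of the orthogonal spinor, which is the condition in \<open>coherent\<close>.\<close>
    define a where "a = n - Suc i"
    have a: "a < n" "n - a = Suc i" "Suc a = n - i" using i by (auto simp: a_def)
    have "cnj (e a) = 0" using e0[OF a(1)] by simp
    then have "p * nsqrt (Suc i) * cnj (v $ a) + q * nsqrt (n - i) * cnj (v $ Suc a) = 0"
      unfolding e_def a(2) by (simp add: a(3))
    then have r: "p * nsqrt (Suc i) * cnj (v $ a) = - (q * nsqrt (n - i) * cnj (v $ Suc a))" by (simp add: eq_neg_iff_add_eq_0)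
    have "p * nsqrt (Suc i) * trev_vec n v $ Suc i = - ((- 1) ^ i * (p * nsqrt (Suc i) * cnj (v $ a)))"
      using i by (simp add: trev_vec_def a_def mult_ac)
    also have "\<dots> = (- 1) ^ i * (q * nsqrt (n - i) * cnj (v $ Suc a))" unfolding r by simp
    also have "\<dots> = q * nsqrt (n - i) * trev_vec n v $ i"
      using i a(3) by (simp add: trev_vec_def mult_ac)
    finally show "p * nsqrt (Suc i) * trev_vec n v $ Suc i = q * nsqrt (n - i) * trev_vec n v $ i" .
  qed
  then show ?thesis using one by blast
qed

end

theorem corollary2p5:
  fixes J K :: real and k :: int and f :: "real \<Rightarrow> real"
    and \<rho> :: "complex mat" and \<omega> :: "real^3" and v :: "complex vec"
  assumes "2 * J \<in> \<nat>" and "2 * K \<in> \<nat>"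
    and "of_int k = 2 * (K - J)"
    and "concave_on {0..1} f"
    and "density_mat (spin_dim J) \<rho>"
    and "\<omega> \<in> sphere 0 1"
    and "coherent_state J \<omega> v"
  shows "mat_trace (mat_fun f (channel J k \<rho>)) \<ge> mat_trace (mat_fun f (channel J k (ket_bra v)))"
proof -
  obtain n m where nm: "2 * J = real n" "2 * K = real m"
    using assms(1,2) by (auto simp: Nats_def)
  interpret two_spins J n K m by unfold_locales (fact nm)+
  have \<rho>: "density_mat (Suc n) \<rho>" "\<rho> \<in> carrier_mat (Suc n) (Suc n)"
    using assms(5) by (auto simp: J.dim density_mat_def hermitian_mat_def)
  have v: "v \<in> carrier_vec (Suc n)" using assms(7) by (simp add: coherent_state_def J.dim)
  then have vv: "ket_bra v \<in> carrier_mat (Suc n) (Suc n)" by (auto simp: ket_bra_def)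
  obtain p q where pq: "p * cnj p + q * cnj q = 1" and w: "coherent n p q (trev_vec n v)"
    using J.coherent_state_trev[OF assms(6,7)] by blast
  show ?thesis
  proof (cases "n \<le> m")
    case True
    then obtain l where l: "m = n + l" using le_Suc_ex by blast
    show ?thesis
      unfolding channel_eq_up_iter[OF assms(3) \<rho>(2) l] channel_eq_up_iter[OF assms(3) vv l] trev_ket_bra[OF v]
      by (rule up_iter_coherent_minimizes[OF assms(4) trev_density[OF \<rho>(1)] w pq])
  next
    case False
    then obtain l where l: "n = m + l" using le_Suc_ex[of m n] by auto
    have "density_mat (Suc m + l) (trev n \<rho>)" "coherent (m + l) p q (trev_vec n v)"
      using trev_density[OF \<rho>(1)] w l by simp_all
    then show ?thesis
      unfolding channel_eq_down_iter[OF assms(3) \<rho>(2) l] channel_eq_down_iter[OF assms(3) vv l] trev_ket_bra[OF v]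
      by (intro down_iter_coherent_minimizes[OF assms(4) _ _ pq])
  qed
qed

end
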